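(* Let $G$ be a semisimple group over $\mathbb C$ with maximal torus $A$ and root system $R$, and let $r:R\to\mathbb Z$ be a root valuation function. Define functions on $R$ by $$k_0(\alpha):=\frac{r_m(\alpha)-r(\alpha)}{2},\qquad k_1(\alpha):=\lceil k_0(\alpha)\rceil .$$ Then both $k=k_0$ and $k=k_1$ satisfy the following two conditions: (1) $k(\alpha)+k(-\alpha)\ge r_m(\alpha)-r(\alpha)$ for all $\alpha\in R$, (2) $k(\alpha)+k(\beta)-k(\alpha+\beta)\ge r(\alpha+\beta)-\min\{r(\alpha),r(\beta)\}$ for all $\alpha,\beta\in R$ such that $\alpha+\beta\in R$. Since $k_1$ is integer-valued, it then provides a root valuation lattice $\Lambda_{r,\lambda}$ for $r$, where $\lambda=r+k_1$.
   Context: $F=\mathbb C((\epsilon))$, $\mathcal O=\mathbb C[[\epsilon]]$, $\mathrm{val}$ the $\epsilon$-adic valuation. $G$ is connected; $\mathfrak g=\mathrm{Lie}\,G$, $\mathfrak a=\mathrm{Lie}\,A$, root spaces $\mathfrak g_\alpha$, and $P_\alpha^n:=\epsilon^n\mathfrak g_\alpha(\mathcal O)$. A root valuation function is a function $r:R\to\mathbb Z$ such that for every $m\in\mathbb Z$ the set $\{\alpha\in R:r(\alpha)\ge m\}$ is $\mathbb Q$-closed (equivalently, the root system of a Levi subgroup of $G$ containing $A$). Roots $\alpha,\beta$ are strongly orthogonal if neither $\alpha+\beta$ nor $\alpha-\beta$ lies in $R\cup\{0\}$. Put $r_m(\alpha):=\max\{r(\beta):\beta\in R\text{ is not strongly orthogonal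 to }\alpha\}$. $\mathfrak a(F)_r=\{u\in\mathfrak a(F):\mathrm{val}\,\alpha(u)=r(\alpha)\ \forall\alpha\in R\}$ and $\mathfrak a(F)_{\ge r}=\{u\in\mathfrak a(F):\mathrm{val}\,\alpha(u)\ge r(\alpha)\ \forall\alpha\in R\}$. For $\lambda:R\to\mathbb Z$ put $\Lambda_{r,\lambda}:=\mathfrak a(F)_{\ge r}\oplus\bigl(\bigoplus_{\alpha\in R}P_\alpha^{\lambda(\alpha)}\bigr)$. Let $K_{r,\lambda}$ be the identity component of the proalgebraic group $\{g\in G(F):g\Lambda_{r,\lambda}g^{-1}=\Lambda_{r,\lambda}\}$; its Lie algebra is $\mathfrak k_{r,\lambda}=\{X\in\mathfrak g(F):[X,\Lambda_{r,\lambda}]\subset\Lambda_{r,\lambda}\}$. $\Lambda_{r,\lambda}$ is a root valuation lattice for $r$ if the morphism $K_{r,\lambda}\times\mathfrak a(F)_r\to\Lambda_{r,\lambda}$, $(x,u)\mapsto xux^{-1}$, is a submersion (surjective differential at every point); by equivariance this means that $\mathfrak a(F)_{\ge r}+[\mathfrak k_{r,\lambda},u]=\Lambda_{r,\lambda}$ for every $u\in\mathfrak a(F)_r$. *)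

theory Defs
  imports
    "HOL-Analysis.Analysis"
    "HOL-Algebra.Solvable_Groups"
    "HOL-Computational_Algebra.Formal_Laurent_Series"
    "HOL-Library.Function_Algebras"
begin

no_notation fps_nth (infixl "$" 75)

section \<open>Linear algebraic groups over the complex numbers\<close>

text \<open>Every affine algebraic group over the complex numbers is a Zariski closed subgroup of some
  general linear group, so algebraic groups are taken in this form; \<open>'n\<close> is arbitrary.\<close>

inductive_set poly_fun :: "(complex^'n^'n \<Rightarrow> complex) set" where
  const: "(\<lambda>_. c) \<in> poly_fun"
| entry: "(\<lambda>g. g $ i $ j) \<in> poly_fun"
| add: "f \<in> poly_fun \<Longrightarrow> h \<in> poly_fun \<Longrightarrow> (\<lambda>g. f g + h g) \<in> poly_fun"
| mult: "f \<in> poly_fun \<Longrightarrow> h \<in> poly_fun \<Longrightarrow> (\<lambda>g. f g * h g) \<in> poly_fun"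

definition GL :: "(complex^'n^'n) monoid" where
  "GL = \<lparr>carrier = {g. invertible g}, mult = (**), one = mat 1\<rparr>"

text \<open>The Zariski topology on the general linear group, generated by the basic open sets.\<close>

definition zariski :: "(complex^'n^'n) topology" where
  "zariski = topology_generated_by {{g. invertible g \<and> f g \<noteq> 0} |f. f \<in> poly_fun}"

definition algebraic_group :: "(complex^'n^'n) set \<Rightarrow> bool" where
  "algebraic_group G \<longleftrightarrow> subgroup G GL \<and> closedin zariski G"

definition connected_algebraic_group :: "(complex^'n^'n) set \<Rightarrow> bool" where
  "connected_algebraic_group G \<longleftrightarrow> algebraic_group G \<and> connectedin zariski G"

text \<open>Semisimple means connected with trivial radical, i.e. there is no nontrivial closed connected
  solvable normal subgroup.\<close>

definition semisimple_group :: "(complex^'n^'n) set \<Rightarrow> bool" where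
  "semisimple_group G \<longleftrightarrow> connected_algebraic_group G \<and>
     (\<forall>N. connected_algebraic_group N \<and> N \<lhd> (GL\<lparr>carrier := G\<rparr>) \<and> solvable (GL\<lparr>carrier := N\<rparr>)
        \<longrightarrow> N = {mat 1})"

text \<open>A torus is a connected diagonalizable algebraic group.\<close>

definition torus :: "(complex^'n^'n) set \<Rightarrow> bool" where
  "torus T \<longleftrightarrow> connected_algebraic_group T \<and>
     (\<exists>P :: complex^'n^'n. invertible P \<and>
        (\<forall>t\<in>T. \<forall>i j. i \<noteq> j \<longrightarrow> (matrix_inv P ** t ** P) $ i $ j = 0))"

definition maximal_torus :: "(complex^'n^'n) set \<Rightarrow> (complex^'n^'n) set \<Rightarrow> bool" where
  "maximal_torus G A \<longleftrightarrow> torus A \<and> A \<subseteq> G \<and> (\<forall>T. torus T \<and> T \<subseteq> G \<and> A \<subseteq> T \<longrightarrow> T = A)"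


section \<open>Lie algebras and roots\<close>

definition msmult :: "'a::times \<Rightarrow> 'a^'n^'n \<Rightarrow> 'a^'n^'n" where
  "msmult c X = (\<chi> i j. c * X $ i $ j)"

definition bracket :: "'a::ring_1^'n^'n \<Rightarrow> 'a^'n^'n \<Rightarrow> 'a^'n^'n" where
  "bracket X Y = X ** Y - Y ** X"

text \<open>The tangent space at the identity.\<close>

definition lie :: "(complex^'n^'n) set \<Rightarrow> (complex^'n^'n) set" where
  "lie G = {X. \<forall>f\<in>poly_fun. (\<forall>g\<in>G. f g = 0) \<longrightarrow> deriv (\<lambda>t. f (mat 1 + msmult t X)) 0 = 0}"

definition root_space ::
  "(complex^'n^'n) set \<Rightarrow> (complex^'n^'n) set \<Rightarrow> (complex^'n^'n \<Rightarrow> complex) \<Rightarrow> (complex^'n^'n) set"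
where
  "root_space G A \<alpha> = {X \<in> lie G. \<forall>H\<in>lie A. bracket H X = msmult (\<alpha> H) X}"

text \<open>A root is an element of the dual of \<open>lie A\<close>, encoded as a function that vanishes outside
  \<open>lie A\<close>; with this normalization the pointwise sum, difference and negative of functions are those
  of the dual space. Linearity on \<open>lie A\<close> follows from \<open>root_space G A \<alpha> \<noteq> {0}\<close>.\<close>

definition roots ::
  "(complex^'n^'n) set \<Rightarrow> (complex^'n^'n) set \<Rightarrow> (complex^'n^'n \<Rightarrow> complex) set"
where
  "roots G A = {\<alpha>. (\<forall>H. H \<notin> lie A \<longrightarrow> \<alpha> H = 0) \<and> \<alpha> \<noteq> 0 \<and> (\<exists>X\<in>root_space G A \<alpha>. X \<noteq> 0)}"


section \<open>Root valuation functions\<close>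

definition Q_closed :: "('b \<Rightarrow> complex) set \<Rightarrow> ('b \<Rightarrow> complex) set \<Rightarrow> bool" where
  "Q_closed R S \<longleftrightarrow> S \<subseteq> R \<and>
     (\<forall>\<alpha>\<in>R. (\<exists>T q. finite T \<and> T \<subseteq> S \<and> \<alpha> = (\<lambda>H. \<Sum>\<beta>\<in>T. of_rat (q \<beta>) * \<beta> H)) \<longrightarrow> \<alpha> \<in> S)"

definition root_valuation :: "('b \<Rightarrow> complex) set \<Rightarrow> (('b \<Rightarrow> complex) \<Rightarrow> int) \<Rightarrow> bool" where
  "root_valuation R r \<longleftrightarrow> (\<forall>m::int. Q_closed R {\<alpha>\<in>R. r \<alpha> \<ge> m})"

definition strongly_orthogonal ::
  "('b \<Rightarrow> complex) set \<Rightarrow> ('b \<Rightarrow> complex) \<Rightarrow> ('b \<Rightarrow> complex) \<Rightarrow> bool"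
where
  "strongly_orthogonal R \<alpha> \<beta> \<longleftrightarrow> \<alpha> + \<beta> \<notin> R \<union> {0} \<and> \<alpha> - \<beta> \<notin> R \<union> {0}"

definition r_max ::
  "('b \<Rightarrow> complex) set \<Rightarrow> (('b \<Rightarrow> complex) \<Rightarrow> int) \<Rightarrow> ('b \<Rightarrow> complex) \<Rightarrow> int"
where
  "r_max R r \<alpha> = Max {r \<beta> |\<beta>. \<beta> \<in> R \<and> \<not> strongly_orthogonal R \<alpha> \<beta>}"

definition k0 ::
  "('b \<Rightarrow> complex) set \<Rightarrow> (('b \<Rightarrow> complex) \<Rightarrow> int) \<Rightarrow> ('b \<Rightarrow> complex) \<Rightarrow> real"
where
  "k0 R r \<alpha> = (real_of_int (r_max R r \<alpha>) - real_of_int (r \<alpha>)) / 2"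

definition k1 ::
  "('b \<Rightarrow> complex) set \<Rightarrow> (('b \<Rightarrow> complex) \<Rightarrow> int) \<Rightarrow> ('b \<Rightarrow> complex) \<Rightarrow> int"
where
  "k1 R r \<alpha> = \<lceil>k0 R r \<alpha>\<rceil>"


section \<open>Root valuation lattices\<close>

text \<open>For a complex subspace \<open>V\<close> of the matrices, \<open>V \<otimes> \<complex>((\<epsilon>))\<close> consists of the matrices over
  \<open>\<complex>((\<epsilon>))\<close> all of whose coefficient matrices lie in \<open>V\<close>, because \<open>V\<close> is finite-dimensional;
  \<open>\<epsilon>\<^sup>m V \<otimes> \<complex>[[\<epsilon>]]\<close> is the subset where moreover the coefficients of index below \<open>m\<close> vanish.\<close>

definition coeff_mat :: "complex fls^'n^'n \<Rightarrow> int \<Rightarrow> complex^'n^'n" where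
  "coeff_mat X k = (\<chi> i j. fls_nth (X $ i $ j) k)"

definition F_points :: "(complex^'n^'n) set \<Rightarrow> (complex fls^'n^'n) set" where
  "F_points V = {X. \<forall>k. coeff_mat X k \<in> V}"

definition O_points_shift :: "int \<Rightarrow> (complex^'n^'n) set \<Rightarrow> (complex fls^'n^'n) set" where
  "O_points_shift m V = {X \<in> F_points V. \<forall>k<m. coeff_mat X k = 0}"

text \<open>The \<open>\<complex>((\<epsilon>))\<close>-linear extension of a functional on \<open>lie A\<close>, applied to an element of
  \<open>F_points (lie A)\<close>.\<close>

definition extend :: "(complex^'n^'n \<Rightarrow> complex) \<Rightarrow> complex fls^'n^'n \<Rightarrow> complex fls" where
  "extend \<alpha> u = Abs_fls (\<lambda>k. \<alpha> (coeff_mat u k))"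

text \<open>The valuation of a nonzero series is \<open>fls_subdegree\<close>; since \<open>fls_subdegree 0 = 0\<close> whereas the
  valuation of \<open>0\<close> is infinite, the zero series is treated separately.\<close>

definition aF_eq ::
  "(complex^'n^'n) set \<Rightarrow> (complex^'n^'n) set \<Rightarrow> ((complex^'n^'n \<Rightarrow> complex) \<Rightarrow> int)
     \<Rightarrow> (complex fls^'n^'n) set"
where
  "aF_eq G A r = {u \<in> F_points (lie A). \<forall>\<alpha>\<in>roots G A.
     extend \<alpha> u \<noteq> 0 \<and> fls_subdegree (extend \<alpha> u) = r \<alpha>}"

definition aF_ge ::
  "(complex^'n^'n) set \<Rightarrow> (complex^'n^'n) set \<Rightarrow> ((complex^'n^'n \<Rightarrow> complex) \<Rightarrow> int)
     \<Rightarrow> (complex fls^'n^'n) set"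
where
  "aF_ge G A r = {u \<in> F_points (lie A). \<forall>\<alpha>\<in>roots G A.
     extend \<alpha> u = 0 \<or> fls_subdegree (extend \<alpha> u) \<ge> r \<alpha>}"

definition Lambda ::
  "(complex^'n^'n) set \<Rightarrow> (complex^'n^'n) set \<Rightarrow> ((complex^'n^'n \<Rightarrow> complex) \<Rightarrow> int)
     \<Rightarrow> ((complex^'n^'n \<Rightarrow> complex) \<Rightarrow> int) \<Rightarrow> (complex fls^'n^'n) set"
where
  "Lambda G A r l = {u + (\<Sum>\<alpha>\<in>roots G A. x \<alpha>) |u x.
     u \<in> aF_ge G A r \<and> (\<forall>\<alpha>\<in>roots G A. x \<alpha> \<in> O_points_shift (l \<alpha>) (root_space G A \<alpha>))}"

definition stab_lie ::
  "(complex^'n^'n) set \<Rightarrow> (complex fls^'n^'n) set \<Rightarrow> (complex fls^'n^'n) set"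
where
  "stab_lie G L = {X \<in> F_points (lie G). \<forall>Y\<in>L. bracket X Y \<in> L}"

text \<open>Surjectivity of the differential of \<open>(x, u) \<mapsto> x u x\<^sup>-\<^sup>1\<close> at the points \<open>(1, u)\<close>, where the
  differential is \<open>(X, v) \<mapsto> [X, u] + v\<close>; by equivariance this gives surjectivity at all points.\<close>

definition root_valuation_lattice ::
  "(complex^'n^'n) set \<Rightarrow> (complex^'n^'n) set \<Rightarrow> ((complex^'n^'n \<Rightarrow> complex) \<Rightarrow> int)
     \<Rightarrow> ((complex^'n^'n \<Rightarrow> complex) \<Rightarrow> int) \<Rightarrow> bool"
where
  "root_valuation_lattice G A r l \<longleftrightarrow>
     (\<forall>u\<in>aF_eq G A r.
        {v + bracket X u |v X. v \<in> aF_ge G A r \<and> X \<in> stab_lie G (Lambda G A r l)}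
          = Lambda G A r l)"

end

theory Submission
  imports Defs "HOL-Complex_Analysis.Complex_Analysis" "HOL-Computational_Algebra.Field_as_Ring"
    "HOL-Computational_Algebra.Fundamental_Theorem_Algebra" "HOL-Computational_Algebra.Polynomial_Factorial"
begin

no_notation fps_nth (infixl "$" 75)

text \<open>
  The trace form \<open>tr (X Y)\<close> is nondegenerate on \<open>lie G\<close>: an element of its radical is orthogonal to all its
  replicas (the elements of \<open>lie G\<close> obtained by applying additive maps \<open>\<complex> \<rightarrow> \<rat>\<close> to its eigenvalues), so it is
  nilpotent; by Engel's theorem a nonzero radical would have a nonzero centre, whose exponentials generate a
  commutative normal subgroup of \<open>G\<close>. Maximality of the torus then shows that the centralizer of \<open>lie A\<close> in
  \<open>lie G\<close> consists of sums of an element of \<open>lie A\<close> and a nilpotent one, and nondegeneracy removes the nilpotent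
  part. Consequently the root spaces of \<open>\<alpha>\<close> and \<open>-\<alpha>\<close> are in duality and their bracket lies in \<open>lie A\<close>, and
  representations of \<open>sl\<^sub>2\<close> give the one fact about root systems that is needed: a root strongly orthogonal to
  \<open>\<alpha>\<close> and \<open>\<beta>\<close> is strongly orthogonal to \<open>\<alpha> + \<beta>\<close>. Hence \<open>r_max (\<alpha> + \<beta>) \<le> max (r_max \<alpha>) (r_max \<beta>)\<close>, and the
  inequalities follow because the minimum of \<open>r\<close> over \<open>\<alpha>\<close>, \<open>\<beta>\<close>, \<open>\<alpha> + \<beta>\<close> is attained twice. They say that
  \<open>O_points_shift k (root_space G A \<alpha>)\<close> with \<open>k = k1 \<alpha>\<close> stabilizes the lattice, and bracketing it with a regular \<open>u\<close> gives the whole root part of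
  the lattice.
\<close>

section \<open>Square matrices\<close>

text \<open>The obstacle is that a complex bilinear form has no positivity. It is recovered from
  eigenvalues in the given matrix embedding: squares of rational or integer values, and squared
  moduli obtained by conjugating eigenvalues, where the conjugated matrix may leave
  \<open>lie G\<close> as long as it commutes with what it is paired with. The number
  \<open>k0\<close> splits the bound \<open>r_max R r \<alpha> - r \<alpha>\<close> of condition (1)
  evenly between \<alpha> and -\<alpha>, on which \<open>r\<close> and \<open>r_max\<close> agree,
  so (1) holds with equality. The bound itself comes from brackets of opposite root spaces: they lie
  in \<open>lie A\<close> and are killed by every root strongly orthogonal to \<alpha>, so only the
  other roots constrain their valuation, and \<open>r_max\<close> is the largest of these
  constraints. Condition (2) expresses that a bracket of two root parts lands in the root part of
  the sum. Rounding up respects both conditions because their right-hand sides are integers.\<close>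

lemma msmult_nth [simp]: "msmult c X $ i $ j = c * X $ i $ j"
  by (simp add: msmult_def)

lemma msmult_mult_left: "msmult c X ** Y = msmult c (X ** Y)" for c :: "'a::comm_semiring_1"
  by (simp add: matrix_matrix_mult_def msmult_def vec_eq_iff sum_distrib_left mult_ac)

lemma msmult_mult_right: "X ** msmult c Y = msmult c (X ** Y)" for c :: "'a::comm_semiring_1"
  by (simp add: matrix_matrix_mult_def msmult_def vec_eq_iff sum_distrib_left mult_ac)

lemmas msmult_mult = msmult_mult_left msmult_mult_right

lemma msmult_add: "msmult c (X + Y) = msmult c X + msmult c Y" for c :: "'a::comm_ring_1"
  by (simp add: vec_eq_iff algebra_simps)

lemma msmult_diff: "msmult c (X - Y) = msmult c X - msmult c Y" for c :: "'a::comm_ring_1"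
  by (simp add: vec_eq_iff algebra_simps)

lemma msmult_add_left: "msmult (c + d) X = msmult c X + msmult d X" for c :: "'a::comm_ring_1"
  by (simp add: vec_eq_iff algebra_simps)

lemma msmult_msmult: "msmult c (msmult d X) = msmult (c * d) X" for c :: "'a::comm_ring_1"
  by (simp add: vec_eq_iff algebra_simps)

lemma msmult_one [simp]: "msmult 1 X = X" for X :: "'a::comm_ring_1^'n^'n"
  by (simp add: vec_eq_iff)

lemma msmult_zero [simp]: "msmult 0 X = 0" "msmult c (0 :: 'a^'n^'n) = 0" for c :: "'a::comm_ring_1" and X :: "'a^'n^'n"
  by (simp_all add: vec_eq_iff)

lemma msmult_minus: "msmult c (- X) = - msmult c X" "msmult (- c) X = - msmult c X"
  for c :: "'a::comm_ring_1"
  by (simp_all add: vec_eq_iff)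

lemma msmult_eq_0_iff: "msmult c X = 0 \<longleftrightarrow> c = 0 \<or> X = 0" for c :: "'a::idom"
  by (auto simp: vec_eq_iff)

lemma mat_mult_left: "mat c ** X = msmult c X" for c :: "'a::comm_ring_1"
  by (simp add: matrix_matrix_mult_def msmult_def vec_eq_iff mat_def if_distrib if_distribR
      sum.delta cong: if_cong)

lemma mat_mult_right: "X ** mat c = msmult c X" for c :: "'a::comm_ring_1"
  by (simp add: matrix_matrix_mult_def msmult_def vec_eq_iff mat_def if_distrib if_distribR
      sum.delta mult.commute cong: if_cong)

lemma mat_eq_msmult: "mat c = msmult c (mat 1)" for c :: "'a::comm_ring_1"
  by (simp add: vec_eq_iff mat_def)

lemma matrix_mult_uminus: "(- X) ** Y = - (X ** Y)" "X ** (- Y) = - (X ** Y)"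
  for X Y :: "'a::comm_ring_1^'n^'n"
  by (simp_all add: matrix_matrix_mult_def vec_eq_iff sum_negf)

lemma matrix_diff_ldistrib: "X ** (Y - Z) = X ** Y - X ** Z" for X Y Z :: "'a::comm_ring_1^'n^'n"
  by (simp add: matrix_matrix_mult_def vec_eq_iff sum_subtractf algebra_simps)

lemma matrix_diff_rdistrib: "(X - Y) ** Z = X ** Z - Y ** Z" for X Y Z :: "'a::comm_ring_1^'n^'n"
  by (simp add: matrix_matrix_mult_def vec_eq_iff sum_subtractf algebra_simps)

lemma matrix_add_rdist: "(X + Y) ** Z = X ** Z + Y ** Z" for X Y Z :: "'a::comm_ring_1^'n^'n"
  by (simp add: matrix_matrix_mult_def vec_eq_iff sum.distrib algebra_simps)

lemma matrix_mult_zero [simp]: "0 ** X = 0" "X ** 0 = 0" for X :: "'a::comm_ring_1^'n^'n"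
  by (simp_all add: matrix_matrix_mult_def vec_eq_iff)

lemmas matrix_ring_simps = matrix_add_ldistrib matrix_add_rdist matrix_diff_ldistrib
  matrix_diff_rdistrib matrix_mult_uminus matrix_mul_assoc

lemma matrix_sum_left: "(\<Sum>i\<in>I. f i) ** X = (\<Sum>i\<in>I. f i ** X)" for f :: "'b \<Rightarrow> 'a::comm_ring_1^'n^'n" and X :: "'a::comm_ring_1^'n^'n"
  by (induction I rule: infinite_finite_induct) (simp_all add: matrix_ring_simps)

lemma matrix_sum_right: "X ** (\<Sum>i\<in>I. f i) = (\<Sum>i\<in>I. X ** f i)" for f :: "'b \<Rightarrow> 'a::comm_ring_1^'n^'n" and X :: "'a::comm_ring_1^'n^'n"
  by (induction I rule: infinite_finite_induct) (simp_all add: matrix_ring_simps)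

lemma trace_msmult: "trace (msmult c X) = c * trace X" for c :: "'a::comm_ring_1"
  by (simp add: trace_def sum_distrib_left)

lemma trace_zero [simp]: "trace (0 :: 'a::comm_ring_1^'n^'n) = 0"
  by (simp add: trace_def)

section \<open>Powers of a matrix and nilpotence\<close>

primrec mpow :: "'a::comm_ring_1^'n^'n \<Rightarrow> nat \<Rightarrow> 'a^'n^'n" where
  "mpow X 0 = mat 1"
| "mpow X (Suc k) = X ** mpow X k"

lemma mpow_add: "mpow X (k + l) = mpow X k ** mpow X l"
  by (induction k) (simp_all add: matrix_mul_assoc)

lemma mpow_commute: "X ** Y = Y ** X \<Longrightarrow> mpow X k ** Y = Y ** mpow X k"
  by (induction k) (simp, metis (no_types, opaque_lifting) matrix_mul_assoc mpow.simps(2))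

lemma mpow_Suc_right: "mpow X (Suc k) = mpow X k ** X"
  using mpow_commute[of X X k] by simp

lemma mpow_mult_distrib:
  assumes "X ** Y = Y ** X" shows "mpow (X ** Y) k = mpow X k ** mpow Y k"
proof (induction k)
  case (Suc k)
  have "mpow (X ** Y) (Suc k) = X ** (Y ** mpow X k) ** mpow Y k"
    by (simp add: Suc matrix_mul_assoc)
  also have "Y ** mpow X k = mpow X k ** Y" using mpow_commute[OF assms] by simp
  finally show ?case by (simp add: matrix_mul_assoc)
qed simp

lemma mpow_zero_mono: "mpow X k = 0 \<Longrightarrow> k \<le> l \<Longrightarrow> mpow X l = 0"
  by (metis le_iff_add mpow_add matrix_mult_zero(1))

definition nilp :: "complex^'n^'n \<Rightarrow> bool" where
  "nilp X \<longleftrightarrow> (\<exists>k. mpow X k = 0)"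

lemma nilp_mult_commute: "nilp X \<Longrightarrow> X ** Y = Y ** X \<Longrightarrow> nilp (X ** Y)"
  unfolding nilp_def by (metis mpow_mult_distrib matrix_mult_zero(1))

section \<open>The Jordan decomposition\<close>

definition poly_mat :: "complex poly \<Rightarrow> complex^'n^'n \<Rightarrow> complex^'n^'n" where
  "poly_mat p X = fold_coeffs (\<lambda>a M. mat a + X ** M) p 0"

lemma poly_mat_0 [simp]: "poly_mat 0 X = 0"
  by (simp add: poly_mat_def)

lemma mat_0_eq [simp]: "mat 0 = (0 :: 'a::comm_ring_1^'n^'n)"
  by (simp add: mat_def vec_eq_iff)

lemma poly_mat_pCons [simp]: "poly_mat (pCons a p) X = mat a + X ** poly_mat p X"
  by (cases "p = 0 \<and> a = 0") (auto simp: poly_mat_def)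

lemma mat_add: "mat (a + b) = mat a + (mat b :: 'a::comm_ring_1^'n^'n)"
  by (simp add: mat_def vec_eq_iff)

lemma mat_mul: "mat (a * b) = mat a ** (mat b :: 'a::comm_ring_1^'n^'n)"
  by (simp add: mat_mult_left) (simp add: mat_def vec_eq_iff)

lemma poly_mat_add: "poly_mat (p + q) X = poly_mat p X + poly_mat q X"
  by (induction p q rule: poly_induct2) (simp_all add: mat_add matrix_ring_simps)

lemma poly_mat_smult: "poly_mat (smult c p) X = msmult c (poly_mat p X)"
  by (induction p) (simp_all add: mat_mul msmult_add msmult_mult mat_mult_left)

lemma poly_mat_mult: "poly_mat (p * q) X = poly_mat p X ** poly_mat q X"
  by (induction p)
    (simp_all add: poly_mat_add poly_mat_smult matrix_ring_simps msmult_add msmult_mult mat_mult_left)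

lemma poly_mat_1 [simp]: "poly_mat 1 X = mat 1"
  by (simp add: one_pCons)

lemma poly_mat_power: "poly_mat (p ^ k) X = mpow (poly_mat p X) k"
  by (induction k) (simp_all add: poly_mat_mult)

lemma poly_mat_sum: "poly_mat (\<Sum>i\<in>I. f i) X = (\<Sum>i\<in>I. poly_mat (f i) X)"
  by (induction I rule: infinite_finite_induct) (simp_all add: poly_mat_add)

lemma poly_mat_commute:
  assumes "X ** Y = Y ** X" shows "poly_mat p X ** Y = Y ** poly_mat p X"
proof (induction p)
  case (pCons a p)
  have "X ** poly_mat p X ** Y = X ** (poly_mat p X ** Y)" by (simp add: matrix_mul_assoc)
  also have "\<dots> = X ** Y ** poly_mat p X" by (simp add: pCons matrix_mul_assoc)
  finally show ?case using assms by (simp add: matrix_ring_simps mat_mult_left mat_mult_right)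
qed simp

lemma poly_mat_monom: "poly_mat (Polynomial.monom c k) X = msmult c (mpow X k)"
  by (induction k) (simp_all add: monom_0 monom_Suc msmult_mult mat_eq_msmult[of c])

text \<open>One more power than the real dimension of the matrix space must be linearly dependent.
  Dependence is a property of the set of powers, which is smaller when two powers coincide; that
  case is split off and gives a difference of two monomials.\<close>

lemma annihilating_poly_exists:
  fixes X :: "complex^'n^'n"
  obtains p where "p \<noteq> 0" "poly_mat p X = 0"
proof (cases "inj_on (mpow X) {..DIM(complex^'n^'n)}")
  case False
  then obtain i j where "i \<noteq> j" "mpow X i = mpow X j" by (auto simp: inj_on_def)
  have "Polynomial.coeff (Polynomial.monom 1 i + smult (-1) (Polynomial.monom 1 j)) i = (1 :: complex)"
    using \<open>i \<noteq> j\<close> by simp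
  then have "Polynomial.monom 1 i + smult (-1) (Polynomial.monom 1 j) \<noteq> (0 :: complex poly)"
    by (metis Polynomial.coeff_0 zero_neq_one)
  then show ?thesis
    using that[of "Polynomial.monom 1 i + smult (-1) (Polynomial.monom 1 j)"] \<open>mpow X i = mpow X j\<close>
    by (simp add: poly_mat_add poly_mat_smult poly_mat_monom msmult_minus del: smult_minus_left smult_1_left)
next
  case True
  let ?D = "DIM(complex^'n^'n)"
  let ?S = "mpow X ` {..?D}"
  have "card ?S = Suc ?D" using True by (simp add: card_image)
  then have "dependent ?S" using independent_card_le_dim[of ?S UNIV] by (auto simp: dim_UNIV)
  then obtain u v where uv: "v \<in> ?S" "u v \<noteq> 0" "(\<Sum>v\<in>?S. u v *\<^sub>R v) = 0"
    by (auto simp: real_vector.dependent_finite)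
  then obtain k where k: "k \<le> ?D" "v = mpow X k" by auto
  define p where "p = (\<Sum>i\<le>?D. Polynomial.monom (of_real (u (mpow X i)) :: complex) i)"
  have "Polynomial.coeff p k = of_real (u v)"
    using k by (simp add: p_def coeff_sum if_distrib sum.delta cong: if_cong)
  then have "p \<noteq> 0" using uv by auto
  moreover have "poly_mat p X = (\<Sum>i\<le>?D. u (mpow X i) *\<^sub>R mpow X i)"
    unfolding p_def poly_mat_sum poly_mat_monom by (intro sum.cong) (auto simp: vec_eq_iff scaleR_conv_of_real[where 'a=complex])
  then have "poly_mat p X = 0" using uv(3) True by (simp add: sum.reindex)
  ultimately show ?thesis using that by blast
qed

text \<open>Induction on \<open>L\<close>: a Bezout identity u p + v q(z) = 1, with p the product
  over \<open>L\<close>, supplies \<open>u\<close> as the coefficient of the new index, and the old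
  coefficients are multiplied by \<open>v\<close>.\<close>

lemma partition_of_unity:
  fixes q :: "complex \<Rightarrow> complex poly"
  assumes "finite L" "L \<noteq> {}" "\<And>x y. x \<in> L \<Longrightarrow> y \<in> L \<Longrightarrow> x \<noteq> y \<Longrightarrow> coprime (q x) (q y)"
  shows "\<exists>a. (\<Sum>x\<in>L. a x * (\<Prod>y\<in>L - {x}. q y)) = 1"
  using assms
proof (induction L rule: finite_ne_induct)
  case (singleton x)
  show ?case by (intro exI[of _ "\<lambda>_. 1"]) simp
next
  case (insert z L)
  then obtain a where a: "(\<Sum>x\<in>L. a x * (\<Prod>y\<in>L - {x}. q y)) = 1" by auto
  have "coprime (\<Prod>y\<in>L. q y) (q z)"
    by (intro prod_coprime_left) (use insert in auto)
  then obtain u v where uv: "u * (\<Prod>y\<in>L. q y) + v * q z = 1"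
    by (metis bezout_coefficients_fst_snd coprime_iff_gcd_eq_1)
  define b where "b = (\<lambda>x. if x = z then u else v * a x)"
  have "(\<Sum>x\<in>insert z L. b x * (\<Prod>y\<in>insert z L - {x}. q y)) =
      u * (\<Prod>y\<in>L. q y) + (\<Sum>x\<in>L. v * a x * (\<Prod>y\<in>insert z L - {x}. q y))"
  proof -
    have "insert z L - {z} = L" using insert by auto
    then show ?thesis using insert by (simp add: b_def) (intro sum.cong, auto)
  qed
  also have "(\<Sum>x\<in>L. v * a x * (\<Prod>y\<in>insert z L - {x}. q y)) =
      (\<Sum>x\<in>L. v * q z * (a x * (\<Prod>y\<in>L - {x}. q y)))"
  proof (intro sum.cong refl)
    fix x assume "x \<in> L"
    then have "insert z L - {x} = insert z (L - {x})" using insert by auto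
    then show "v * a x * (\<Prod>y\<in>insert z L - {x}. q y) = v * q z * (a x * (\<Prod>y\<in>L - {x}. q y))"
      using insert by simp
  qed
  also have "\<dots> = v * q z" using a by (simp add: sum_distrib_left[symmetric])
  finally show ?case using uv by (intro exI[of _ b]) simp
qed

lemma coprime_linear_powers:
  fixes x y :: complex
  assumes "x \<noteq> y" shows "coprime ([:- x, 1:] ^ k) ([:- y, 1:] ^ l)"
proof -
  have "coprime [:- x, 1:] [:- y, 1:]"
  proof (rule coprimeI)
    fix c assume "c dvd [:- x, 1:]" "c dvd [:- y, 1:]"
    then have "c dvd [:- x, 1:] - [:- y, 1:]" by (rule dvd_diff)
    then have "c dvd [:y - x:]" by simp
    moreover have "[:y - x:] dvd 1" using assms by (simp add: is_unit_pCons_iff)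
    ultimately show "is_unit c" using dvd_trans by blast
  qed
  then show ?thesis by (intro coprime_power_left_iff[THEN iffD2] coprime_power_right_iff[THEN iffD2] disjI1)
qed

text \<open>With q_x the full power of T - x in an annihilating polynomial, a partition of unity for
  the cofactors of the q_x gives the projections. They are polynomials in X, whence the last clause;
  the sum \<open>m\<close> of all multiplicities serves as a common exponent.\<close>

lemma spectral_projections:
  fixes X :: "complex^'n^'n"
  obtains L :: "complex set" and E m where
    "finite L" "(\<Sum>x\<in>L. E x) = mat 1"
    "\<And>x y. x \<in> L \<Longrightarrow> y \<in> L \<Longrightarrow> x \<noteq> y \<Longrightarrow> E x ** E y = 0"
    "\<And>x. x \<in> L \<Longrightarrow> mpow (X - mat x) m ** E x = 0"
    "\<And>x Y. X ** Y = Y ** X \<Longrightarrow> E x ** Y = Y ** E x"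
proof -
  obtain p where p: "p \<noteq> 0" "poly_mat p X = 0" using annihilating_poly_exists .
  define L where "L = {z. poly p z = 0}"
  define q where "q = (\<lambda>z. [:-z, 1:] ^ Polynomial.order z p)"
  have fin: "finite L" unfolding L_def using p poly_roots_finite by blast
  have "smult (lead_coeff p) (\<Prod>z\<in>L. q z) = p"
    unfolding L_def q_def by (rule complex_poly_decompose)
  then have "msmult (lead_coeff p) (poly_mat (\<Prod>z\<in>L. q z) X) = 0" using p by (metis poly_mat_smult)
  then have prod0: "poly_mat (\<Prod>z\<in>L. q z) X = 0" using p by (simp add: msmult_eq_0_iff)
  have "L \<noteq> {}"
  proof
    assume "L = {}"
    then have "(mat 1 :: complex^'n^'n) = 0" using prod0 by simp
    then show False by (simp add: mat_def vec_eq_iff) (metis one_neq_zero)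
  qed
  then obtain a where a: "(\<Sum>x\<in>L. a x * (\<Prod>y\<in>L - {x}. q y)) = 1"
    using partition_of_unity[OF fin, of q] coprime_linear_powers unfolding q_def by blast
  define E where "E = (\<lambda>x. poly_mat (a x * (\<Prod>y\<in>L - {x}. q y)) X)"
  define m where "m = (\<Sum>x\<in>L. Polynomial.order x p)"
  have lin: "poly_mat [:- x, 1:] X = X - mat x" for x
    by simp (simp add: mat_def vec_eq_iff)
  show ?thesis
  proof (rule that[of L E m])
    show "(\<Sum>x\<in>L. E x) = mat 1" unfolding E_def poly_mat_sum[symmetric] a by simp
    show "E x ** E y = 0" if "x \<in> L" "y \<in> L" "x \<noteq> y" for x y
    proof -
      have "(\<Prod>z\<in>L. q z) = q x * (\<Prod>y\<in>L - {x}. q y)" using fin that by (simp add: prod.remove)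
      \<comment> \<open>The cofactor of \<open>y\<close> still contains \<open>q x\<close>, the one
        factor that the cofactor of \<open>x\<close> lacks.\<close>
      moreover have "q x dvd (\<Prod>z\<in>L - {y}. q z)" using fin that by (intro dvd_prodI) auto
      ultimately have "(\<Prod>z\<in>L. q z) dvd (\<Prod>z\<in>L - {y}. q z) * (\<Prod>z\<in>L - {x}. q z)"
        by (simp add: mult_dvd_mono)
      then have "(\<Prod>z\<in>L. q z) dvd (a x * (\<Prod>z\<in>L - {x}. q z)) * (a y * (\<Prod>z\<in>L - {y}. q z))"
        using dvd_mult[of _ _ "a x * a y"] by (simp add: mult_ac)
      then obtain w where "(a x * (\<Prod>z\<in>L - {x}. q z)) * (a y * (\<Prod>z\<in>L - {y}. q z)) = (\<Prod>z\<in>L. q z) * w"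
        by (elim dvdE)
      then show ?thesis unfolding E_def poly_mat_mult[symmetric] using prod0 by (simp add: poly_mat_mult)
    qed
    show "mpow (X - mat x) m ** E x = 0" if "x \<in> L" for x
    proof -
      have "(\<Prod>z\<in>L. q z) = q x * (\<Prod>y\<in>L - {x}. q y)" using fin that by (simp add: prod.remove)
      then have "poly_mat (a x * (\<Prod>z\<in>L. q z)) X = poly_mat (q x) X ** E x"
        unfolding E_def poly_mat_mult[symmetric] by (simp add: mult_ac)
      then have "mpow (X - mat x) (Polynomial.order x p) ** E x = 0"
        using prod0 by (simp add: poly_mat_mult q_def poly_mat_power lin del: poly_mat_pCons)
      moreover have "Polynomial.order x p \<le> m" unfolding m_def
        using fin that by (intro member_le_sum[of x L "\<lambda>x. Polynomial.order x p"]) auto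
      ultimately show ?thesis
        by (metis (no_types, lifting) le_iff_add add.commute matrix_mul_assoc matrix_mult_zero(2) mpow_add)
    qed
    show "E x ** Y = Y ** E x" if "X ** Y = Y ** X" for x Y
      unfolding E_def using that by (rule poly_mat_commute)
  qed (rule fin)
qed

section \<open>Change of basis and diagonalizable matrices\<close>

lemma matrix_inv_left: "invertible P \<Longrightarrow> matrix_inv P ** P = mat 1"
  and matrix_inv_right: "invertible P \<Longrightarrow> P ** matrix_inv P = mat 1"
  unfolding matrix_inv_def invertible_def by (metis (mono_tags, lifting) someI_ex)+

lemma matrix_inv_unique: "(X :: complex^'n^'n) ** Y = mat 1 \<Longrightarrow> matrix_inv X = Y"
  by (metis invertible_right_inverse matrix_inv_left matrix_mul_assoc matrix_mul_lid matrix_mul_rid)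

definition diagm :: "('n \<Rightarrow> complex) \<Rightarrow> complex^'n^'n" where
  "diagm d = (\<chi> i j. if i = j then d i else 0)"

definition cj :: "complex^'n^'n \<Rightarrow> complex^'n^'n \<Rightarrow> complex^'n^'n" where
  "cj P X = matrix_inv P ** X ** P"

definition uncj :: "complex^'n^'n \<Rightarrow> complex^'n^'n \<Rightarrow> complex^'n^'n" where
  "uncj P X = P ** X ** matrix_inv P"

text \<open>Eigenbasis and eigenvalue function are kept apart, so that applying an arbitrary map to
  the eigenvalues, the passage to a replica, is \<open>dg P (\<psi> \<circ> d)\<close>.\<close>

definition dg :: "complex^'n^'n \<Rightarrow> ('n \<Rightarrow> complex) \<Rightarrow> complex^'n^'n" where
  "dg P d = uncj P (diagm d)"

lemma diagm_mult_nth [simp]: "(diagm d ** X) $ i $ j = d i * X $ i $ j"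
  by (simp add: diagm_def matrix_matrix_mult_def if_distrib if_distribR sum.delta cong: if_cong)

lemma mult_diagm_nth [simp]: "(X ** diagm d) $ i $ j = X $ i $ j * d j"
  by (simp add: diagm_def matrix_matrix_mult_def if_distrib if_distribR sum.delta cong: if_cong)

lemma diagm_nth: "diagm d $ i $ j = (if i = j then d i else 0)"
  by (simp add: diagm_def)

lemma diagm_mult: "diagm d ** diagm e = diagm (\<lambda>i. d i * e i)"
  by (simp add: vec_eq_iff) (simp add: diagm_def)

lemma diagm_one: "diagm (\<lambda>_. 1) = mat 1"
  by (simp add: diagm_def mat_def)

lemma cj_uncj [simp]: "invertible P \<Longrightarrow> cj P (uncj P X) = X"
  by (simp add: cj_def uncj_def matrix_mul_assoc matrix_inv_left)
     (simp add: matrix_mul_assoc[symmetric] matrix_inv_left)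

lemma uncj_cj [simp]: "invertible P \<Longrightarrow> uncj P (cj P X) = X"
  by (simp add: cj_def uncj_def matrix_mul_assoc matrix_inv_right)
     (simp add: matrix_mul_assoc[symmetric] matrix_inv_right)

lemma cj_dg [simp]: "invertible P \<Longrightarrow> cj P (dg P d) = diagm d"
  by (simp add: dg_def)

lemma cj_eq_iff: "invertible P \<Longrightarrow> cj P X = cj P Y \<longleftrightarrow> X = Y"
  by (metis uncj_cj)

lemma cj_mult: "invertible P \<Longrightarrow> cj P (X ** Y) = cj P X ** cj P Y"
proof -
  assume "invertible P"
  have "cj P X ** cj P Y = matrix_inv P ** X ** (P ** matrix_inv P) ** Y ** P"
    by (simp add: cj_def matrix_mul_assoc)
  then show ?thesis using \<open>invertible P\<close> by (simp add: cj_def matrix_inv_right matrix_mul_assoc)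
qed

lemma cj_one [simp]: "invertible P \<Longrightarrow> cj P (mat 1) = mat 1"
  by (simp add: cj_def matrix_inv_left)

lemma cj_diff: "cj P (X - Y) = cj P X - cj P Y"
  by (simp add: cj_def matrix_ring_simps)

lemma cj_msmult: "cj P (msmult c X) = msmult c (cj P X)"
  by (simp add: cj_def msmult_mult)

lemma cj_zero [simp]: "cj P 0 = 0"
  by (simp add: cj_def)

lemma cj_bracket: "invertible P \<Longrightarrow> cj P (bracket X Y) = bracket (cj P X) (cj P Y)"
  by (simp add: bracket_def cj_diff cj_mult)

lemma trace_cj: "invertible P \<Longrightarrow> trace (cj P X) = trace X"
  unfolding cj_def by (subst trace_mul_sym) (simp add: matrix_mul_assoc matrix_inv_right)

lemma cj_mpow: "invertible P \<Longrightarrow> cj P (mpow X k) = mpow (cj P X) k"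
  by (induction k) (simp_all add: cj_mult)

lemma trace_diagm: "trace (diagm d) = (\<Sum>i\<in>UNIV. d i)"
  by (simp add: trace_def diagm_def)

lemma trace_dg: "invertible P \<Longrightarrow> trace (dg P d) = (\<Sum>i\<in>UNIV. d i)"
  by (metis cj_dg trace_cj trace_diagm)

lemma dg_mult: "invertible P \<Longrightarrow> dg P d ** dg P e = dg P (\<lambda>i. d i * e i)"
  by (metis cj_dg cj_eq_iff cj_mult diagm_mult)

lemma dg_one: "invertible P \<Longrightarrow> dg P (\<lambda>_. 1) = mat 1"
  by (metis cj_dg cj_eq_iff cj_one diagm_one)

lemma dg_zero: "dg P (\<lambda>_. 0) = 0" for P :: "complex^'n^'n"
proof -
  have "diagm (\<lambda>_. 0) = (0 :: complex^'n^'n)" by (simp add: diagm_def vec_eq_iff)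
  then show ?thesis by (simp add: dg_def uncj_def)
qed

text \<open>In the eigenbasis a commuting \<open>Y\<close> has nonzero entries only between equal
  eigenvalues, and \<psi> preserves equality.\<close>

lemma dg_commute_comp:
  assumes "invertible P" "dg P d ** Y = Y ** dg P d"
  shows "dg P (\<psi> \<circ> d) ** Y = Y ** dg P (\<psi> \<circ> d)"
proof -
  have "diagm d ** cj P Y = cj P Y ** diagm d"
    using assms(1) by (simp only: cj_mult[symmetric] cj_dg[symmetric] assms(2))
  then have "d i * cj P Y $ i $ j = cj P Y $ i $ j * d j" for i j
    by (metis diagm_mult_nth mult_diagm_nth)
  then have "cj P Y $ i $ j = 0 \<or> d i = d j" for i j
    by (metis mult.commute mult_cancel_left)
  then have "(\<psi> \<circ> d) i * cj P Y $ i $ j = cj P Y $ i $ j * (\<psi> \<circ> d) j" for i j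
    by (metis comp_apply mult.commute mult_zero_left)
  then have "diagm (\<psi> \<circ> d) ** cj P Y = cj P Y ** diagm (\<psi> \<circ> d)"
    by (simp add: vec_eq_iff)
  then have "cj P (dg P (\<psi> \<circ> d) ** Y) = cj P (Y ** dg P (\<psi> \<circ> d))"
    using assms(1) by (simp only: cj_mult cj_dg)
  then show ?thesis using assms(1) by (simp only: cj_eq_iff)
qed

lemma basis_matrix_exists:
  fixes V :: "(complex^'n) set"
  assumes "vec.span V = UNIV"
  obtains P :: "complex^'n^'n" where "invertible P" "\<And>j. column j P \<in> V"
proof -
  obtain B where B: "B \<subseteq> V" "vec.independent B" "V \<subseteq> vec.span B"
    using vec.maximal_independent_subset by blast
  then have sp: "vec.span B = UNIV"
    using assms by (metis top.extremum_unique vec.span_mono vec.span_span)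
  have "card B = CARD('n)"
    using B sp by (metis vec.dim_eq_card vec.dim_UNIV vec.dim_span card_cart_basis)
  moreover have "finite B" using B vec.finiteI_independent by blast
  ultimately obtain f :: "'n \<Rightarrow> complex^'n" where f: "bij_betw f UNIV B"
    by (metis finite_class.finite_UNIV finite_same_card_bij)
  define P :: "complex^'n^'n" where "P = (\<chi> i j. f j $ i)"
  have col: "column j P = f j" for j by (simp add: column_def P_def vec_eq_iff)
  then have "columns P = B" using f by (auto simp: columns_def bij_betw_def)
  then have "invertible P"
    using sp by (metis invertible_right_inverse matrix_right_invertible_span_columns)
  moreover have "column j P \<in> V" for j using col f B by (auto simp: bij_betw_def)
  ultimately show ?thesis using that by blast
qed

text \<open>A spanning set of common eigenvectors contains a basis, whose vectors become the columns
  of \<open>P\<close>.\<close>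

lemma simultaneous_diag:
  fixes V :: "(complex^'n) set"
  assumes "vec.span V = UNIV" "\<And>v S. v \<in> V \<Longrightarrow> S \<in> A \<Longrightarrow> \<exists>c. S *v v = c *s v"
  obtains P :: "complex^'n^'n" where "invertible P" "\<And>S. S \<in> A \<Longrightarrow> \<exists>d. S = dg P d"
proof -
  obtain P :: "complex^'n^'n" where P: "invertible P" "\<And>j. column j P \<in> V"
    using basis_matrix_exists[OF assms(1)] by blast
  show ?thesis
  proof (rule that[OF P(1)])
    fix S assume "S \<in> A"
    then obtain d where d: "\<And>j. S *v column j P = d j *s column j P"
      using assms(2)[OF P(2)] by metis
    have "(S ** P) $ i $ j = (P ** diagm d) $ i $ j" for i j
    proof -
      have "(S ** P) $ i $ j = (S *v column j P) $ i"
        by (simp add: matrix_matrix_mult_def matrix_vector_mult_def column_def)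
      also have "\<dots> = (d j *s column j P) $ i" by (simp only: d)
      finally show ?thesis by (simp add: column_def mult.commute)
    qed
    then have "S ** P = P ** diagm d" by (simp add: vec_eq_iff del: mult_diagm_nth)
    then have "S = dg P d"
      unfolding dg_def uncj_def
      by (metis P(1) matrix_inv_right matrix_mul_assoc matrix_mul_rid)
    then show "\<exists>d. S = dg P d" by blast
  qed
qed

text \<open>The semisimple part is the sum of x E_x over the spectral projections. Commutation is
  recorded for the whole commutant of X, so that group elements as well as Lie algebra elements can
  be inserted.\<close>

theorem jordan_decomposition:
  fixes X :: "complex^'n^'n"
  obtains P d N where "invertible P" "X = dg P d + N" "nilp N"
    "\<And>Y. X ** Y = Y ** X \<Longrightarrow> dg P d ** Y = Y ** dg P d"
proof -
  obtain L E m where LE: "finite L" "(\<Sum>x\<in>L. E x) = mat 1"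
    "\<And>x y. x \<in> L \<Longrightarrow> y \<in> L \<Longrightarrow> x \<noteq> y \<Longrightarrow> E x ** E y = 0"
    "\<And>x. x \<in> L \<Longrightarrow> mpow (X - mat x) m ** E x = 0"
    "\<And>x Y. X ** Y = Y ** X \<Longrightarrow> E x ** Y = Y ** E x"
    using spectral_projections[of X] by metis
  have idem: "E x ** E x = E x" if "x \<in> L" for x
  proof -
    have "E x = (\<Sum>y\<in>L. E x ** E y)" using LE(2) by (simp add: matrix_sum_right[symmetric])
    also have "\<dots> = E x ** E x"
      using LE(1,3) that by (simp add: sum.remove[of L x]) (metis (mono_tags, lifting) DiffE insertI1 sum.neutral)
    finally show ?thesis by simp
  qed
  define S where "S = (\<Sum>x\<in>L. msmult x (E x))"
  have SE: "S ** E y = msmult y (E y)" if "y \<in> L" for y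
  proof -
    have "S ** E y = (\<Sum>x\<in>L. msmult x (E x ** E y))" by (simp add: S_def matrix_sum_left msmult_mult)
    also have "\<dots> = (\<Sum>x\<in>L. if x = y then msmult y (E y) else 0)"
      using LE(3) idem that by (intro sum.cong) auto
    finally show ?thesis using that LE(1) by simp
  qed
  \<comment> \<open>Eigenvectors of \<open>S\<close>; they span because the projections add up to
    the identity.\<close>
  define V where "V = {E x *v axis j 1 |x j. x \<in> L}"
  have "v \<in> vec.span V" for v
  proof -
    have "v = (\<Sum>x\<in>L. E x) *v v" using LE(2) by simp
    also have "\<dots> = (\<Sum>x\<in>L. E x *v v)"
      by (induction L rule: infinite_finite_induct) (simp_all add: matrix_vector_mult_add_rdistrib)
    also have "\<dots> = (\<Sum>x\<in>L. \<Sum>j\<in>UNIV. (v $ j) *s (E x *v axis j 1))"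
      by (subst basis_expansion[symmetric, of v]) (simp add: vec.sum vec.scale)
    also have "\<dots> \<in> vec.span V"
      by (intro vec.span_sum vec.span_scale vec.span_base) (auto simp: V_def)
    finally show ?thesis .
  qed
  then have "vec.span V = UNIV" by auto
  moreover have "\<exists>c. S *v v = c *s v" if v: "v \<in> V" for v
  proof -
    obtain x j where x: "x \<in> L" "v = E x *v axis j 1" using v unfolding V_def by blast
    have "S *v v = msmult x (E x) *v axis j 1" using SE[OF x(1)] x(2) by (simp add: matrix_vector_mul_assoc)
    also have "\<dots> = x *s v"
      using x(2) by (simp add: vec_eq_iff matrix_vector_mult_def sum_distrib_left mult_ac)
    finally show ?thesis by blast
  qed
  ultimately obtain P where P: "invertible P" "\<exists>d. S = dg P d"
    using simultaneous_diag[of V "{S}"] by (metis singletonD singletonI)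
  then obtain d where d: "S = dg P d" by blast
  define N where "N = X - S"
  have XE: "X ** E y = E y ** X" for y using LE(5) by simp
  \<comment> \<open>On the image of \<open>E y\<close> the operator \<open>N\<close> acts as
    \<open>X - mat y\<close>, so the m-th power of \<open>N\<close> vanishes on every such
    image.\<close>
  have NE: "N ** E y = (X - mat y) ** E y" if "y \<in> L" for y
    by (simp add: N_def matrix_ring_simps SE[OF that] mat_mult_left)
  have "mpow N k ** E y = mpow (X - mat y) k ** E y" if "y \<in> L" for y k
  proof (induction k)
    case (Suc k)
    have *: "(X - mat y) ** E y = E y ** (X - mat y)"
      by (simp add: matrix_ring_simps mat_mult_left mat_mult_right XE)
    have "mpow N (Suc k) ** E y = mpow N k ** (N ** E y)"
      by (simp add: mpow_Suc_right matrix_mul_assoc del: mpow.simps)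
    also have "\<dots> = mpow N k ** E y ** (X - mat y)" by (simp add: NE[OF that] * matrix_mul_assoc)
    also have "\<dots> = mpow (X - mat y) k ** (E y ** (X - mat y))" by (simp add: Suc matrix_mul_assoc)
    also have "\<dots> = mpow (X - mat y) (Suc k) ** E y"
      by (simp add: *[symmetric] mpow_Suc_right matrix_mul_assoc del: mpow.simps)
    finally show ?case .
  qed simp
  then have "mpow N m ** (\<Sum>x\<in>L. E x) = 0"
    using LE(4) by (simp add: matrix_sum_right)
  then have "nilp N" using LE(2) by (auto simp: nilp_def)
  moreover have "S ** Y = Y ** S" if "X ** Y = Y ** X" for Y
    using LE(5)[OF that] by (simp add: S_def matrix_sum_left matrix_sum_right msmult_mult)
  ultimately show ?thesis using that[OF P(1), of d N] d by (simp add: N_def)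
qed

section \<open>Traces of nilpotent matrices\<close>

lemma projection_exists:
  fixes F :: "(complex^'n) set"
  assumes "vec.subspace F"
  obtains Q :: "complex^'n^'n" where "\<And>v. Q *v v \<in> F" "\<And>v. v \<in> F \<Longrightarrow> Q *v v = v"
proof -
  have "Vector_Spaces.linear (*s) (*s) (\<lambda>x::complex^'n. x)" by (rule vec.linear_id[unfolded id_def])
  from vec.linear_exists_left_inverse_on[OF this assms]
  obtain g where g: "g ` UNIV \<subseteq> F" "Vector_Spaces.linear (*s) (*s) g" "\<forall>v\<in>F. g v = v"
    by (auto simp: inj_on_def)
  then have "matrix g *v v = g v" for v by (simp add: matrix_works)
  then show ?thesis using that[of "matrix g"] g by auto
qed

text \<open>Let Q_k project onto the kernel of M^k. As M maps the kernel of M^(k+1) into that of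
  M^k, cyclicity gives tr(M Q_(k+1)) = tr(M Q_k), and the trace descends from Q_K = 1 to Q_0 =
  0.\<close>

lemma trace_nilp:
  fixes M :: "complex^'n^'n"
  assumes "nilp M" shows "trace M = 0"
proof -
  obtain K where K: "mpow M K = 0" using assms by (auto simp: nilp_def)
  define F where "F = (\<lambda>k. {v. mpow M k *v v = 0})"
  have "vec.subspace (F k)" for k
    by (auto simp: F_def vec.subspace_def matrix_vector_right_distrib vec.scale)
  then have "\<exists>Q :: complex^'n^'n. (\<forall>v. Q *v v \<in> F k) \<and> (\<forall>v\<in>F k. Q *v v = v)" for k
    using projection_exists[of "F k"] by metis
  then obtain Q :: "nat \<Rightarrow> complex^'n^'n" where
    Q: "\<And>k v. Q k *v v \<in> F k" "\<And>k v. v \<in> F k \<Longrightarrow> Q k *v v = v" by metis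
  have "trace (M ** Q (Suc k)) = trace (M ** Q k)" for k
  proof -
    have "M *v v \<in> F k" if "v \<in> F (Suc k)" for v
      using that by (simp add: F_def mpow_Suc_right matrix_vector_mul_assoc del: mpow.simps)
    then have 1: "Q k ** (M ** Q (Suc k)) = M ** Q (Suc k)"
      using Q by (simp add: matrix_eq matrix_vector_mul_assoc[symmetric])
    have "F k \<subseteq> F (Suc k)" by (auto simp: F_def matrix_vector_mul_assoc[symmetric])
    then have "Q (Suc k) *v (Q k *v v) = Q k *v v" for v
      using Q by blast
    then have 2: "Q (Suc k) ** Q k = Q k"
      by (simp add: matrix_eq matrix_vector_mul_assoc[symmetric])
    have "trace (M ** Q (Suc k)) = trace (M ** Q (Suc k) ** Q k)"
      using trace_mul_sym[of "Q k" "M ** Q (Suc k)"] 1 by simp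
    then show ?thesis using 2 by (simp add: matrix_mul_assoc[symmetric])
  qed
  then have "trace (M ** Q k) = trace (M ** Q 0)" for k by (induction k) auto
  moreover have "Q K = mat 1" using Q(2)[of _ K] by (simp add: F_def K matrix_eq)
  moreover have "Q 0 = 0" using Q(1)[of 0] by (simp add: F_def matrix_eq)
  ultimately show ?thesis by (metis matrix_mul_rid matrix_mult_zero(2) trace_zero)
qed

lemma trace_nilp_commute: "nilp N \<Longrightarrow> N ** Y = Y ** N \<Longrightarrow> trace (N ** Y) = 0"
  using nilp_mult_commute trace_nilp by blast

section \<open>Engel's theorem\<close>

lemma bracket_zero [simp]: "bracket X 0 = 0" "bracket 0 X = 0" for X :: "'a::comm_ring_1^'n^'n"
  by (simp_all add: bracket_def)

lemma bracket_add_right: "bracket X (Y + Z) = bracket X Y + bracket X Z" for X :: "'a::comm_ring_1^'n^'n"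
  by (simp add: bracket_def matrix_ring_simps)

lemma bracket_add_left: "bracket (X + Y) Z = bracket X Z + bracket Y Z" for X :: "'a::comm_ring_1^'n^'n"
  by (simp add: bracket_def matrix_ring_simps)

lemma bracket_msmult_right: "bracket X (msmult c Y) = msmult c (bracket X Y)" for c :: "'a::comm_ring_1"
  by (simp add: bracket_def msmult_mult msmult_diff)

lemma bracket_msmult_left: "bracket (msmult c X) Y = msmult c (bracket X Y)" for c :: "'a::comm_ring_1"
  by (simp add: bracket_def msmult_mult msmult_diff)

lemma bracket_scaleR: "bracket X (c *\<^sub>R Y) = c *\<^sub>R bracket X Y" "bracket (c *\<^sub>R X) Y = c *\<^sub>R bracket X Y"
  for X Y :: "complex^'n^'n"
  by (simp_all add: bracket_def scaleR_diff_right matrix_scalar_ac scalar_matrix_assoc)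

lemma bracket_anti: "bracket X Y = - bracket Y X" for X :: "'a::comm_ring_1^'n^'n"
  by (simp add: bracket_def)

lemma bracket_self [simp]: "bracket X X = 0" for X :: "'a::comm_ring_1^'n^'n"
  by (simp add: bracket_def)

lemma bracket_eq_0_iff: "bracket X Y = 0 \<longleftrightarrow> X ** Y = Y ** X" for X :: "'a::comm_ring_1^'n^'n"
  by (simp add: bracket_def)

lemma jacobi: "bracket (bracket X Y) Z = bracket X (bracket Y Z) - bracket Y (bracket X Z)"
  for X :: "'a::comm_ring_1^'n^'n"
  by (simp add: bracket_def matrix_ring_simps)

lemma trace_bracket: "trace (bracket X Y ** Z) = trace (X ** bracket Y Z)" for X :: "'a::comm_ring_1^'n^'n"
proof -
  have "trace (Y ** X ** Z) = trace (X ** Z ** Y)"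
    by (metis matrix_mul_assoc trace_mul_sym)
  then show ?thesis by (simp add: bracket_def matrix_ring_simps trace_sub)
qed

section \<open>Words and uniform nilpotence\<close>

definition wprod :: "(complex^'n^'n) list \<Rightarrow> complex^'n^'n" where
  "wprod ws = foldr (**) ws (mat 1)"

lemma wprod_simps [simp]: "wprod [] = mat 1" "wprod (X # ws) = X ** wprod ws"
  by (simp_all add: wprod_def)

lemma wprod_append: "wprod (us @ vs) = wprod us ** wprod vs"
  by (induction us) (simp_all add: matrix_mul_assoc)

text \<open>The conclusion of Engel's theorem in associative form: one length bound for all words
  instead of a common flag. Nilpotence of products and of iterated brackets can then be read off by
  counting letters.\<close>

definition wnil :: "(complex^'n^'n) set \<Rightarrow> bool" where
  "wnil S \<longleftrightarrow> (\<exists>N. \<forall>ws. set ws \<subseteq> S \<and> N \<le> length ws \<longrightarrow> wprod ws = 0)"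

lemma wnilI:
  assumes "\<And>ws. set ws \<subseteq> S \<Longrightarrow> length ws = N \<Longrightarrow> wprod ws = 0"
  shows "wnil S"
  unfolding wnil_def
proof (intro exI allI impI)
  fix ws assume ws: "set ws \<subseteq> S \<and> N \<le> length ws"
  then have "wprod (take N ws) = 0" using assms[of "take N ws"] set_take_subset[of N ws] by auto
  then show "wprod ws = 0" by (metis append_take_drop_id matrix_mult_zero(1) wprod_append)
qed

lemma linear_mult_left: "linear (\<lambda>Y. X ** Y)"
  and linear_mult_right: "linear (\<lambda>Y :: complex^'n^'n. Y ** X)"
  for X :: "complex^'n^'n"
  by (auto intro!: linearI simp: matrix_ring_simps matrix_scalar_ac scalar_matrix_assoc)

lemma span_mult:
  fixes S T :: "(complex^'n^'n) set"
  assumes "X \<in> span S" "Y \<in> span T"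
  shows "X ** Y \<in> span {A ** B |A B. A \<in> S \<and> B \<in> T}"
proof -
  have 1: "A ** Y \<in> span {A ** B |A B. A \<in> S \<and> B \<in> T}" if "A \<in> S" for A
  proof -
    have "A ** Y \<in> (\<lambda>Z. A ** Z) ` span T" using assms(2) by blast
    also have "\<dots> = span ((\<lambda>Z. A ** Z) ` T)" by (simp only: linear_span_image[OF linear_mult_left])
    also have "\<dots> \<subseteq> span {A ** B |A B. A \<in> S \<and> B \<in> T}" using that by (intro span_mono) auto
    finally show ?thesis .
  qed
  have "X ** Y \<in> (\<lambda>Z. Z ** Y) ` span S" using assms(1) by blast
  also have "\<dots> = span ((\<lambda>Z. Z ** Y) ` S)" by (simp only: linear_span_image[OF linear_mult_right])
  also have "\<dots> \<subseteq> span {A ** B |A B. A \<in> S \<and> B \<in> T}"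
    using 1 by (intro span_minimal) auto
  finally show ?thesis .
qed

lemma wprod_span:
  assumes "set ws \<subseteq> span T"
  shows "wprod ws \<in> span {wprod us |us. set us \<subseteq> T \<and> length us = length ws}"
  using assms
proof (induction ws)
  case Nil
  show ?case by (intro span_base) simp
next
  case (Cons X ws)
  have "X ** wprod ws \<in> span {A ** B |A B. A \<in> T \<and> B \<in> {wprod us |us. set us \<subseteq> T \<and> length us = length ws}}"
    using Cons by (intro span_mult) auto
  also have "\<dots> \<subseteq> span {wprod us |us. set us \<subseteq> T \<and> length us = length (X # ws)}"
  proof (intro span_mono subsetI)
    fix Z assume "Z \<in> {A ** B |A B. A \<in> T \<and> B \<in> {wprod us |us. set us \<subseteq> T \<and> length us = length ws}}"
    then obtain A us where "A \<in> T" "set us \<subseteq> T" "length us = length ws" "Z = wprod (A # us)" by auto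
    then show "Z \<in> {wprod us |us. set us \<subseteq> T \<and> length us = length (X # ws)}"
      by (intro CollectI exI[of _ "A # us"]) auto
  qed
  finally show ?case by simp
qed

lemma span_sub_zero: "T \<subseteq> {0} \<Longrightarrow> X \<in> span T \<Longrightarrow> X = 0" for X :: "'a::real_vector"
  using span_mono[of T "{0}"] by auto

lemma wnil_span: "wnil T \<Longrightarrow> wnil (span T)"
proof -
  assume "wnil T"
  then obtain N where N: "\<And>us. set us \<subseteq> T \<Longrightarrow> N \<le> length us \<Longrightarrow> wprod us = 0"
    unfolding wnil_def by blast
  show "wnil (span T)"
  proof (rule wnilI[of _ N])
    fix ws assume "set ws \<subseteq> span T" "length ws = N"
    then show "wprod ws = 0"
      using wprod_span[of ws T] N by (intro span_sub_zero[of "{wprod us |us. set us \<subseteq> T \<and> length us = N}"]) auto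
  qed
qed

text \<open>Expanding [s, Z] = s Z - Z s puts each letter to the left or to the right of
  \<open>w\<close> and loses none.\<close>

lemma foldr_bracket_span:
  fixes S :: "(complex^'n^'n) set"
  shows "set ss \<subseteq> S \<Longrightarrow> foldr bracket ss w \<in>
     span {wprod us ** w ** wprod vs |us vs. set us \<subseteq> S \<and> set vs \<subseteq> S \<and> length us + length vs = length ss}"
proof (induction ss)
  case Nil
  show ?case by (intro span_base) force
next
  case (Cons s ss)
  let ?T = "\<lambda>n. {wprod us ** w ** wprod vs |us vs. set us \<subseteq> S \<and> set vs \<subseteq> S \<and> length us + length vs = n}"
  let ?Z = "foldr bracket ss w"
  have s: "s \<in> S" and Z: "?Z \<in> span (?T (length ss))" using Cons by auto
  have "s ** ?Z \<in> span {A ** B |A B. A \<in> {s} \<and> B \<in> ?T (length ss)}"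
    using Z by (intro span_mult) (auto intro: span_base)
  also have "\<dots> \<subseteq> span (?T (Suc (length ss)))"
  proof (intro span_mono subsetI)
    fix Y assume "Y \<in> {A ** B |A B. A \<in> {s} \<and> B \<in> ?T (length ss)}"
    then obtain us vs where *: "set us \<subseteq> S" "set vs \<subseteq> S" "length us + length vs = length ss"
      "Y = s ** (wprod us ** w ** wprod vs)" by auto
    then have "Y = wprod (s # us) ** w ** wprod vs" by (simp add: matrix_mul_assoc)
    then show "Y \<in> ?T (Suc (length ss))"
      using * s by (intro CollectI exI[of _ "s # us"] exI[of _ vs]) auto
  qed
  finally have 1: "s ** ?Z \<in> span (?T (Suc (length ss)))" .
  have "?Z ** s \<in> span {A ** B |A B. A \<in> ?T (length ss) \<and> B \<in> {s}}"
    using Z by (intro span_mult) (auto intro: span_base)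
  also have "\<dots> \<subseteq> span (?T (Suc (length ss)))"
  proof (intro span_mono subsetI)
    fix Y assume "Y \<in> {A ** B |A B. A \<in> ?T (length ss) \<and> B \<in> {s}}"
    then obtain us vs where *: "set us \<subseteq> S" "set vs \<subseteq> S" "length us + length vs = length ss"
      "Y = (wprod us ** w ** wprod vs) ** s" by auto
    then have "Y = wprod us ** w ** wprod (vs @ [s])" by (simp add: wprod_append matrix_mul_assoc)
    then show "Y \<in> ?T (Suc (length ss))"
      using * s by (intro CollectI exI[of _ us] exI[of _ "vs @ [s]"]) auto
  qed
  finally have 2: "?Z ** s \<in> span (?T (Suc (length ss)))" .
  show ?case using span_diff[OF 1 2] by (simp add: bracket_def[of s ?Z])
qed

lemma foldr_bracket_zero:
  fixes S :: "(complex^'n^'n) set"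
  assumes "wnil S"
  obtains N where "\<And>ss w. set ss \<subseteq> S \<Longrightarrow> N \<le> length ss \<Longrightarrow> foldr bracket ss w = 0"
proof -
  obtain N where N: "\<And>us. set us \<subseteq> S \<Longrightarrow> N \<le> length us \<Longrightarrow> wprod us = 0"
    using assms unfolding wnil_def by blast
  show ?thesis
  \<comment> \<open>Of 2N letters distributed over the two sides of \<open>w\<close>, one side
    receives at least N.\<close>
  proof (rule that[of "2 * N"])
    fix ss and w :: "complex^'n^'n" assume ss: "set ss \<subseteq> S" "2 * N \<le> length ss"
    have "N \<le> length us \<or> N \<le> length vs" if "length us + length vs = length ss"
      for us vs :: "(complex^'n^'n) list" using that ss by linarith
    then have "wprod us ** w ** wprod vs = 0"
      if "set us \<subseteq> S" "set vs \<subseteq> S" "length us + length vs = length ss" for us vs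
      using N[OF that(1)] N[OF that(2)] that(3) by fastforce
    then have "{wprod us ** w ** wprod vs |us vs. set us \<subseteq> S \<and> set vs \<subseteq> S \<and> length us + length vs = length ss} \<subseteq> {0}"
      by auto
    then show "foldr bracket ss w = 0" by (rule span_sub_zero) (rule foldr_bracket_span[OF ss(1)])
  qed
qed

text \<open>Moving \<open>x\<close> across one \<open>w\<close> leaves the correction
  \<open>bracket x w\<close>, again a single element of \<open>S\<close>; hence the number of
  letters from \<open>S\<close> does not change.\<close>

lemma word_move_left:
  fixes S :: "(complex^'n^'n) set"
  assumes S: "subspace S" and w: "\<And>s. s \<in> S \<Longrightarrow> bracket s w \<in> S"
  shows "x \<in> S \<Longrightarrow> x ** mpow w a \<in> span {mpow w b ** y |b y. y \<in> S}"
proof (induction a arbitrary: x)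
  case 0
  then show ?case by (intro span_base) (auto intro!: exI[of _ "0::nat"])
next
  case (Suc a)
  have "x ** mpow w (Suc a) = w ** (x ** mpow w a) + bracket x w ** mpow w a"
    by (simp add: bracket_def matrix_ring_simps)
  moreover have "bracket x w ** mpow w a \<in> span {mpow w b ** y |b y. y \<in> S}"
    using Suc.IH w Suc.prems by blast
  moreover have "w ** (x ** mpow w a) \<in> span {mpow w b ** y |b y. y \<in> S}"
  proof -
    have "w ** (x ** mpow w a) \<in> span {A ** B |A B. A \<in> {w} \<and> B \<in> {mpow w b ** y |b y. y \<in> S}}"
      using Suc by (intro span_mult[where S="{w}" and X=w] span_base[of w]) auto
    also have "\<dots> \<subseteq> span {mpow w b ** y |b y. y \<in> S}"
    proof (intro span_mono subsetI)
      fix Z assume "Z \<in> {A ** B |A B. A \<in> {w} \<and> B \<in> {mpow w b ** y |b y. y \<in> S}}"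
      then obtain b y where "y \<in> S" "Z = mpow w (Suc b) ** y" by (auto simp: matrix_mul_assoc)
      then show "Z \<in> {mpow w b ** y |b y. y \<in> S}" by blast
    qed
    finally show ?thesis .
  qed
  ultimately show ?case by (simp only: span_add)
qed

text \<open>The exact count of letters from \<open>S\<close> is carried along: it makes words with
  many such letters vanish once \<open>S\<close> is uniformly nilpotent.\<close>

lemma word_normal_form:
  fixes S :: "(complex^'n^'n) set"
  assumes S: "subspace S" and w: "\<And>s. s \<in> S \<Longrightarrow> bracket s w \<in> S" and "w \<notin> S"
  shows "set us \<subseteq> insert w S \<Longrightarrow> wprod us \<in>
    span {mpow w a ** wprod vs |a vs. set vs \<subseteq> S \<and> length vs = length (filter (\<lambda>x. x \<noteq> w) us)}"
proof (induction us)
  case Nil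
  show ?case by (intro span_base) (auto intro!: exI[of _ "0::nat"] exI[of _ "[]"])
next
  case (Cons x us)
  define m where "m = length (filter (\<lambda>x. x \<noteq> w) us)"
  let ?T = "\<lambda>m. {mpow w a ** wprod vs |a vs. set vs \<subseteq> S \<and> length vs = m}"
  have IH: "wprod us \<in> span (?T m)" using Cons by (simp add: m_def)
  show ?case
  proof (cases "x = w")
    case True
    have "w ** wprod us \<in> span {A ** B |A B. A \<in> {w} \<and> B \<in> ?T m}"
      using IH by (intro span_mult) (auto intro: span_base)
    also have "\<dots> \<subseteq> span (?T m)"
    proof (intro span_mono subsetI)
      fix Z assume "Z \<in> {A ** B |A B. A \<in> {w} \<and> B \<in> ?T m}"
      then obtain a vs where "set vs \<subseteq> S \<and> length vs = m" "Z = mpow w (Suc a) ** wprod vs"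
        by (auto simp: matrix_mul_assoc)
      then show "Z \<in> ?T m" by blast
    qed
    finally show ?thesis using True by (simp add: m_def)
  next
    case False
    then have xS: "x \<in> S" using Cons by auto
    have "x ** wprod us \<in> span {A ** B |A B. A \<in> {x} \<and> B \<in> ?T m}"
      using IH by (intro span_mult) (auto intro: span_base)
    also have "\<dots> \<subseteq> span (?T (Suc m))"
    proof (intro span_minimal subsetI subspace_span)
      fix Z assume "Z \<in> {A ** B |A B. A \<in> {x} \<and> B \<in> ?T m}"
      then obtain a vs where vs: "set vs \<subseteq> S" "length vs = m" "Z = x ** mpow w a ** wprod vs"
        by (auto simp: matrix_mul_assoc)
      have "x ** mpow w a \<in> span {mpow w b ** y |b y. y \<in> S}" using word_move_left[OF S w xS] .
      then have "Z \<in> span {A ** B |A B. A \<in> {mpow w b ** y |b y. y \<in> S} \<and> B \<in> {wprod vs}}"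
        unfolding vs by (intro span_mult) (auto intro: span_base)
      also have "\<dots> \<subseteq> span (?T (Suc m))"
      proof (intro span_mono subsetI)
        fix Z assume "Z \<in> {A ** B |A B. A \<in> {mpow w b ** y |b y. y \<in> S} \<and> B \<in> {wprod vs}}"
        then obtain b y where "y \<in> S" "Z = mpow w b ** wprod (y # vs)" by (auto simp: matrix_mul_assoc)
        then show "Z \<in> ?T (Suc m)" using vs by (intro CollectI exI[of _ b] exI[of _ "y # vs"]) auto
      qed
      finally show "Z \<in> span (?T (Suc m))" .
    qed
    finally show ?thesis using False by (simp add: m_def)
  qed
qed

lemma wprod_lead:
  "wprod us = mpow w (length (takeWhile (\<lambda>x. x = w) us)) ** wprod (dropWhile (\<lambda>x. x = w) us)"
  by (induction us) (simp_all add: matrix_mul_assoc)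

text \<open>In a nonzero word every run of \<open>w\<close> is shorter than \<open>k\<close>, so
  each other letter together with the run behind it accounts for at most \<open>k\<close> letters.
  The leading run is a separate term because it is the part that grows when a letter is
  prepended.\<close>

lemma word_length_bound:
  assumes "mpow w k = 0"
  shows "wprod us \<noteq> 0 \<Longrightarrow> length us \<le> length (filter (\<lambda>x. x \<noteq> w) us) * k + length (takeWhile (\<lambda>x. x = w) us)
     \<and> length (takeWhile (\<lambda>x. x = w) us) < k"
proof (induction us)
  case Nil
  then show ?case using assms by (cases k) auto
next
  case (Cons x us)
  have "wprod us \<noteq> 0" using Cons by auto
  then have IH: "length us \<le> length (filter (\<lambda>x. x \<noteq> w) us) * k + length (takeWhile (\<lambda>x. x = w) us)"
     "length (takeWhile (\<lambda>x. x = w) us) < k" using Cons by auto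
  have "length (takeWhile (\<lambda>x. x = w) (x # us)) < k"
    by (rule ccontr) (use Cons.prems wprod_lead[of "x # us" w] mpow_zero_mono[OF assms] in auto)
  then show ?case using IH by auto
qed

text \<open>By the normal form a nonzero word has fewer than \<open>N\<close> letters from
  \<open>S\<close>, hence fewer than N k + k letters altogether, the last \<open>k\<close> bounding
  the leading run.\<close>

lemma wnil_insert:
  fixes S :: "(complex^'n^'n) set"
  assumes S: "subspace S" and w: "\<And>s. s \<in> S \<Longrightarrow> bracket s w \<in> S" and "w \<notin> S" and "wnil S" and "nilp w"
  shows "wnil (insert w S)"
proof -
  obtain N where N: "\<And>us. set us \<subseteq> S \<Longrightarrow> N \<le> length us \<Longrightarrow> wprod us = 0"
    using \<open>wnil S\<close> unfolding wnil_def by blast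
  obtain k where k: "mpow w k = 0" using \<open>nilp w\<close> by (auto simp: nilp_def)
  show ?thesis
  proof (rule wnilI[of _ "N * k + k"])
    fix us assume us: "set us \<subseteq> insert w S" "length us = N * k + k"
    show "wprod us = 0"
    proof (rule ccontr)
      assume nz: "wprod us \<noteq> 0"
      define m where "m = length (filter (\<lambda>x. x \<noteq> w) us)"
      have "m < N"
      proof (rule ccontr)
        assume "\<not> m < N"
        then have "{mpow w a ** wprod vs |a vs. set vs \<subseteq> S \<and> length vs = m} \<subseteq> {0}" using N by auto
        then have "wprod us = 0"
          by (rule span_sub_zero) (unfold m_def, rule word_normal_form[OF S w \<open>w \<notin> S\<close> us(1)])
        then show False using nz by simp
      qed
      then have "m * k \<le> N * k" by simp
      then show False using word_length_bound[OF k nz] us(2) unfolding m_def by linarith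
    qed
  qed
qed

text \<open>A maximal subalgebra \<open>S\<close> all of whose long words vanish is everything: the words in \<open>ad S\<close> vanish as
  well, so otherwise some \<open>w\<close> outside \<open>S\<close> normalizes \<open>S\<close>, and \<open>S + \<real> w\<close> is larger.\<close>

theorem engel:
  fixes W :: "(complex^'n^'n) set"
  assumes W: "subspace W" and nil: "\<And>X. X \<in> W \<Longrightarrow> nilp X"
    and br: "\<And>X Y. X \<in> W \<Longrightarrow> Y \<in> W \<Longrightarrow> bracket X Y \<in> W"
  shows "wnil W"
proof -
  define good where "good = (\<lambda>S. subspace S \<and> S \<subseteq> W \<and> (\<forall>X\<in>S. \<forall>Y\<in>S. bracket X Y \<in> S) \<and> wnil S)"
  have "wprod us = 0" if "set us \<subseteq> {0}" "length us = 1" for us :: "(complex^'n^'n) list"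
    using that by (cases us) auto
  then have "wnil ({0} :: (complex^'n^'n) set)" using wnilI by blast
  then have "good {0}" using W by (auto simp: good_def subspace_def)
  moreover have "\<forall>S. good S \<longrightarrow> dim S < Suc (DIM(complex^'n^'n))"
    by (metis dim_subset_UNIV le_imp_less_Suc)
  ultimately obtain S where S: "good S" "\<And>T. good T \<Longrightarrow> dim T \<le> dim S"
    using ex_has_greatest_nat[of good "{0}" dim] by blast
  then have sub: "subspace S" "S \<subseteq> W" "\<And>X Y. X \<in> S \<Longrightarrow> Y \<in> S \<Longrightarrow> bracket X Y \<in> S" "wnil S"
    by (auto simp: good_def)
  have "S = W"
  proof (rule ccontr)
    assume "S \<noteq> W"
    then obtain w0 where w0: "w0 \<in> W" "w0 \<notin> S" using sub by blast
    obtain N where N: "\<And>ss w. set ss \<subseteq> S \<Longrightarrow> N \<le> length ss \<Longrightarrow> foldr bracket ss w = 0"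
      using foldr_bracket_zero[OF sub(4)] by blast
    \<comment> \<open>Long bracket words end at 0, which lies in \<open>S\<close>. So there is a
      longest word that keeps \<open>w0\<close> outside \<open>S\<close>, and any further bracket
      sends its value into \<open>S\<close>.\<close>
    define Q where "Q = (\<lambda>ss. set ss \<subseteq> S \<and> foldr bracket ss w0 \<notin> S)"
    have "Q []" using w0 by (simp add: Q_def)
    moreover have "\<forall>ss. Q ss \<longrightarrow> length ss < N"
      using N sub(1) subspace_0 unfolding Q_def by (metis not_le)
    ultimately obtain ss where ss: "Q ss" "\<And>ts. Q ts \<Longrightarrow> length ts \<le> length ss"
      using ex_has_greatest_nat[of Q "[]" length] by blast
    define w where "w = foldr bracket ss w0"
    have "w \<notin> S" using ss by (simp add: Q_def w_def)
    have "set ss \<subseteq> W \<Longrightarrow> foldr bracket ss w0 \<in> W" by (induction ss) (auto simp: w0 br)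
    then have "w \<in> W" using ss sub(2) by (auto simp: Q_def w_def)
    have sw: "bracket s w \<in> S" if "s \<in> S" for s
    proof (rule ccontr)
      assume "bracket s w \<notin> S"
      then have "Q (s # ss)" using that ss by (simp add: Q_def w_def)
      then show False using ss(2) by fastforce
    qed
    have ws: "bracket w s \<in> S" if "s \<in> S" for s
      using sw[OF that] sub(1) by (metis bracket_anti subspace_neg)
    define T where "T = span (insert w S)"
    have T: "\<exists>c s. X = c *\<^sub>R w + s \<and> s \<in> S" if "X \<in> T" for X
      using that unfolding T_def span_breakdown_eq
      by (metis sub(1) span_eq_iff add.commute diff_add_cancel)
    have "wnil T" unfolding T_def
      by (intro wnil_span wnil_insert sub sw \<open>w \<notin> S\<close> nil \<open>w \<in> W\<close>)
    moreover have "bracket X Y \<in> T" if XY: "X \<in> T" "Y \<in> T" for X Y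
    proof -
      obtain c s d t where *: "X = c *\<^sub>R w + s" "s \<in> S" "Y = d *\<^sub>R w + t" "t \<in> S"
        using T[OF XY(1)] T[OF XY(2)] by blast
      have "bracket X Y = c *\<^sub>R bracket w t + d *\<^sub>R bracket s w + bracket s t"
        by (simp add: * bracket_add_left bracket_add_right bracket_scaleR)
      also have "\<dots> \<in> S"
        using * sub sw ws by (intro subspace_add subspace_scale) auto
      finally show ?thesis by (simp add: T_def span_base)
    qed
    moreover have "T \<subseteq> W" unfolding T_def using \<open>w \<in> W\<close> sub W by (intro span_minimal) auto
    ultimately have "good T" by (auto simp: good_def T_def subspace_span)
    then have "dim T \<le> dim S" using S by blast
    moreover have "dim T = Suc (dim S)"
      unfolding T_def using \<open>w \<notin> S\<close> sub(1) by (simp add: dim_insert span_eq_iff[THEN iffD2])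
    ultimately show False by simp
  qed
  then show ?thesis using sub by simp
qed

section \<open>Polynomial functions and tangent spaces\<close>

lemma poly_fun_sum: "(\<And>i. i \<in> I \<Longrightarrow> f i \<in> poly_fun) \<Longrightarrow> (\<lambda>g. \<Sum>i\<in>I. f i g) \<in> poly_fun"
  by (induction I rule: infinite_finite_induct) (auto intro: poly_fun.intros)

lemma poly_fun_prod: "(\<And>i. i \<in> I \<Longrightarrow> f i \<in> poly_fun) \<Longrightarrow> (\<lambda>g. \<Prod>i\<in>I. f i g) \<in> poly_fun"
  by (induction I rule: infinite_finite_induct) (auto intro: poly_fun.intros)

lemma poly_fun_diff: "f \<in> poly_fun \<Longrightarrow> h \<in> poly_fun \<Longrightarrow> (\<lambda>g. f g - h g) \<in> poly_fun"
  using poly_fun.add[OF _ poly_fun.mult[OF poly_fun.const[of "- 1"]], of f h] by simp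

lemma poly_fun_power: "f \<in> poly_fun \<Longrightarrow> (\<lambda>g. f g ^ k) \<in> poly_fun"
  by (induction k) (auto intro: poly_fun.intros)

definition pmap :: "(complex^'n^'n \<Rightarrow> complex^'m^'m) \<Rightarrow> bool" where
  "pmap \<phi> \<longleftrightarrow> (\<forall>i j. (\<lambda>g. \<phi> g $ i $ j) \<in> poly_fun)"

lemma pmap_compose: "f \<in> poly_fun \<Longrightarrow> pmap \<phi> \<Longrightarrow> (\<lambda>g. f (\<phi> g)) \<in> poly_fun"
  by (induction rule: poly_fun.induct) (auto intro: poly_fun.intros simp: pmap_def)

lemma pmap_id [simp]: "pmap (\<lambda>g. g)"
  by (auto simp: pmap_def intro: poly_fun.intros)

lemma pmap_const [simp]: "pmap (\<lambda>g. C)"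
  by (auto simp: pmap_def intro: poly_fun.intros)

lemma pmap_mult: "pmap \<phi> \<Longrightarrow> pmap \<psi> \<Longrightarrow> pmap (\<lambda>g. \<phi> g ** \<psi> g)"
  by (auto simp: pmap_def matrix_matrix_mult_def intro!: poly_fun_sum poly_fun.intros)

lemma pmap_diff: "pmap \<phi> \<Longrightarrow> pmap \<psi> \<Longrightarrow> pmap (\<lambda>g. \<phi> g - \<psi> g)"
  by (auto simp: pmap_def intro!: poly_fun_diff)

lemma pmap_entry: "pmap \<phi> \<Longrightarrow> (\<lambda>g. \<phi> g $ i $ j) \<in> poly_fun"
  by (auto simp: pmap_def)

section \<open>Differentiation along matrix curves\<close>

definition mderiv :: "(complex \<Rightarrow> complex^'n^'n) \<Rightarrow> complex^'n^'n \<Rightarrow> complex \<Rightarrow> bool" where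
  "mderiv \<gamma> D t \<longleftrightarrow> (\<forall>i j. ((\<lambda>s. \<gamma> s $ i $ j) has_field_derivative D $ i $ j) (at t))"

lemma mderiv_const [simp]: "mderiv (\<lambda>_. C) 0 t"
  by (simp add: mderiv_def)

lemma mderiv_add: "mderiv \<gamma> D t \<Longrightarrow> mderiv \<delta> E t \<Longrightarrow> mderiv (\<lambda>s. \<gamma> s + \<delta> s) (D + E) t"
  by (auto simp: mderiv_def intro!: derivative_intros)

lemma mderiv_sum: "(\<And>i. i \<in> I \<Longrightarrow> mderiv (\<gamma> i) (D i) t) \<Longrightarrow> mderiv (\<lambda>s. \<Sum>i\<in>I. \<gamma> i s) (\<Sum>i\<in>I. D i) t"
  by (induction I rule: infinite_finite_induct) (simp_all add: mderiv_add)

lemma mderiv_mult: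
  assumes "mderiv \<gamma> D t" "mderiv \<delta> E t"
  shows "mderiv (\<lambda>s. \<gamma> s ** \<delta> s) (\<gamma> t ** E + D ** \<delta> t) t"
  unfolding mderiv_def
proof (intro allI)
  fix i j
  have "((\<lambda>s. \<Sum>k\<in>UNIV. \<gamma> s $ i $ k * \<delta> s $ k $ j) has_field_derivative
     (\<Sum>k\<in>UNIV. \<gamma> t $ i $ k * E $ k $ j + D $ i $ k * \<delta> t $ k $ j)) (at t)"
    using assms by (intro DERIV_sum DERIV_mult') (auto simp: mderiv_def)
  then show "((\<lambda>s. (\<gamma> s ** \<delta> s) $ i $ j) has_field_derivative (\<gamma> t ** E + D ** \<delta> t) $ i $ j) (at t)"
    by (simp add: matrix_matrix_mult_def sum.distrib)
qed

lemma mderiv_msmult: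
  assumes "(f has_field_derivative f') (at t)"
  shows "mderiv (\<lambda>s. msmult (f s) X) (msmult f' X) t"
  using assms by (auto simp: mderiv_def intro!: DERIV_cmult_right)

lemma mderiv_mult_const: "mderiv \<gamma> D t \<Longrightarrow> mderiv (\<lambda>s. C ** \<gamma> s) (C ** D) t"
  and mderiv_const_mult: "mderiv \<gamma> D t \<Longrightarrow> mderiv (\<lambda>s. \<gamma> s ** C) (D ** C) t"
  using mderiv_mult[OF mderiv_const, of \<gamma> D t C] mderiv_mult[OF _ mderiv_const, of \<gamma> D t C] by simp_all

lemma mderiv_line: "mderiv (\<lambda>t. g + msmult t X) X t"
  by (auto simp: mderiv_def intro!: derivative_eq_intros)

definition dd :: "(complex^'n^'n \<Rightarrow> complex) \<Rightarrow> complex^'n^'n \<Rightarrow> complex^'n^'n \<Rightarrow> complex" where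
  "dd f g X = deriv (\<lambda>t. f (g + msmult t X)) 0"

definition pd :: "(complex^'n^'n \<Rightarrow> complex) \<Rightarrow> 'n \<Rightarrow> 'n \<Rightarrow> complex^'n^'n \<Rightarrow> complex" where
  "pd f i j g = dd f g (\<chi> k l. if k = i \<and> l = j then 1 else 0)"

text \<open>The chain rule along every curve is built in: this property passes through sums and
  products in the induction over \<open>poly_fun\<close>, and exponential curves are needed later,
  not only lines.\<close>

definition is_grad :: "(complex^'n^'n \<Rightarrow> complex) \<Rightarrow> ('n \<Rightarrow> 'n \<Rightarrow> complex^'n^'n \<Rightarrow> complex) \<Rightarrow> bool" where
  "is_grad f p \<longleftrightarrow> (\<forall>i j. p i j \<in> poly_fun) \<and> (\<forall>\<gamma> D t. mderiv \<gamma> D t \<longrightarrow>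
      ((\<lambda>s. f (\<gamma> s)) has_field_derivative (\<Sum>i\<in>UNIV. \<Sum>j\<in>UNIV. p i j (\<gamma> t) * D $ i $ j)) (at t))"

lemma is_gradD:
  assumes "is_grad f p"
  shows "p i j \<in> poly_fun"
    and "mderiv \<gamma> D t \<Longrightarrow>
      ((\<lambda>s. f (\<gamma> s)) has_field_derivative (\<Sum>i\<in>UNIV. \<Sum>j\<in>UNIV. p i j (\<gamma> t) * D $ i $ j)) (at t)"
  using assms unfolding is_grad_def by blast+

lemma is_grad_exists:
  fixes f :: "complex^'n^'n \<Rightarrow> complex"
  assumes "f \<in> poly_fun"
  shows "\<exists>p. is_grad f p"
  using assms
proof induction
  case (const c)
  show ?case by (intro exI[of _ "\<lambda>i j _. 0"]) (auto simp: is_grad_def intro: poly_fun.intros)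
next
  case (entry a b)
  define p :: "'n \<Rightarrow> 'n \<Rightarrow> complex^'n^'n \<Rightarrow> complex"
    where "p = (\<lambda>i j _. if i = a then if j = b then 1 else 0 else 0)"
  have "(\<Sum>i\<in>UNIV. \<Sum>j\<in>UNIV. p i j g * D $ i $ j) = D $ a $ b" for g D
  proof -
    have "p i j g * D $ i $ j = (if j = b then (if i = a then D $ a $ b else 0) else 0)" for i j
      by (simp add: p_def)
    then show ?thesis by simp
  qed
  then show ?case
    by (intro exI[of _ p]) (auto simp: is_grad_def p_def mderiv_def intro: poly_fun.intros)
next
  case (add f h)
  then obtain p q where p: "is_grad f p" and q: "is_grad h q" by blast
  have "is_grad (\<lambda>g. f g + h g) (\<lambda>i j g. p i j g + q i j g)"
    unfolding is_grad_def
  proof (intro conjI allI impI)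
    show "(\<lambda>g. p i j g + q i j g) \<in> poly_fun" for i j
      by (intro poly_fun.intros is_gradD(1)[OF p] is_gradD(1)[OF q])
    fix \<gamma> :: "complex \<Rightarrow> complex^'n^'n" and D t assume "mderiv \<gamma> D t"
    from DERIV_add[OF is_gradD(2)[OF p this] is_gradD(2)[OF q this]]
    show "((\<lambda>s. f (\<gamma> s) + h (\<gamma> s)) has_field_derivative
        (\<Sum>i\<in>UNIV. \<Sum>j\<in>UNIV. (p i j (\<gamma> t) + q i j (\<gamma> t)) * D $ i $ j)) (at t)"
      by (simp add: distrib_right sum.distrib)
  qed
  then show ?case by blast
next
  case (mult f h)
  then obtain p q where p: "is_grad f p" and q: "is_grad h q" by blast
  have "is_grad (\<lambda>g. f g * h g) (\<lambda>i j g. f g * q i j g + p i j g * h g)"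
    unfolding is_grad_def
  proof (intro conjI allI impI)
    show "(\<lambda>g. f g * q i j g + p i j g * h g) \<in> poly_fun" for i j
      by (intro poly_fun.intros is_gradD(1)[OF p] is_gradD(1)[OF q] mult.hyps)
    fix \<gamma> :: "complex \<Rightarrow> complex^'n^'n" and D t assume "mderiv \<gamma> D t"
    from DERIV_mult'[OF is_gradD(2)[OF p this] is_gradD(2)[OF q this]]
    show "((\<lambda>s. f (\<gamma> s) * h (\<gamma> s)) has_field_derivative
        (\<Sum>i\<in>UNIV. \<Sum>j\<in>UNIV. (f (\<gamma> t) * q i j (\<gamma> t) + p i j (\<gamma> t) * h (\<gamma> t)) * D $ i $ j)) (at t)"
      by (simp add: distrib_right sum.distrib sum_distrib_left sum_distrib_right algebra_simps)
  qed
  then show ?case by blast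
qed

lemma dd_sum:
  assumes "f \<in> poly_fun"
  shows "dd f g X = (\<Sum>i\<in>UNIV. \<Sum>j\<in>UNIV. pd f i j g * X $ i $ j)"
    and "pd f i j \<in> poly_fun"
    and "mderiv \<gamma> D t \<Longrightarrow> ((\<lambda>s. f (\<gamma> s)) has_field_derivative dd f (\<gamma> t) D) (at t)"
proof -
  obtain p where "is_grad f p" using is_grad_exists[OF assms] ..
  note p = is_gradD[OF this]
  have dd: "dd f g X = (\<Sum>i\<in>UNIV. \<Sum>j\<in>UNIV. p i j g * X $ i $ j)" for g X
    unfolding dd_def using p(2)[OF mderiv_line, of g X 0] by (intro DERIV_imp_deriv) simp
  have "pd f a b g = p a b g" for a b g
  proof -
    have "pd f a b g = (\<Sum>i\<in>UNIV. \<Sum>j\<in>UNIV. p i j g * (if i = a \<and> j = b then 1 else 0))"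
      by (simp add: pd_def dd)
    moreover have "p i j g * (if i = a \<and> j = b then 1 else 0) = (if j = b then (if i = a then p a b g else 0) else 0)"
      for i j by simp
    ultimately show ?thesis by simp
  qed
  then have pd: "pd f a b = p a b" for a b by auto
  show "dd f g X = (\<Sum>i\<in>UNIV. \<Sum>j\<in>UNIV. pd f i j g * X $ i $ j)" by (simp add: dd pd)
  show "pd f i j \<in> poly_fun" by (simp add: pd p)
  show "mderiv \<gamma> D t \<Longrightarrow> ((\<lambda>s. f (\<gamma> s)) has_field_derivative dd f (\<gamma> t) D) (at t)"
    using p(2) by (simp add: dd)
qed

lemmas dd_chain = dd_sum(3)

lemma dd_poly_fun:
  assumes "f \<in> poly_fun" "pmap \<phi>" "pmap \<psi>"
  shows "(\<lambda>g. dd f (\<phi> g) (\<psi> g)) \<in> poly_fun"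
proof -
  have "(\<lambda>g. pd f i j (\<phi> g) * \<psi> g $ i $ j) \<in> poly_fun" for i j
    by (rule poly_fun.mult[OF pmap_compose[OF dd_sum(2)[OF assms(1)] assms(2)] pmap_entry[OF assms(3)]])
  then show ?thesis unfolding dd_sum(1)[OF assms(1)] by (intro poly_fun_sum)
qed

lemma dd_add: "f \<in> poly_fun \<Longrightarrow> dd f g (X + Y) = dd f g X + dd f g Y"
  by (simp add: dd_sum(1) sum.distrib algebra_simps)

lemma dd_msmult: "f \<in> poly_fun \<Longrightarrow> dd f g (msmult c X) = c * dd f g X"
  by (simp add: dd_sum(1) sum_distrib_left mult_ac)

lemma dd_unique:
  "f \<in> poly_fun \<Longrightarrow> mderiv \<gamma> D t \<Longrightarrow> ((\<lambda>s. f (\<gamma> s)) has_field_derivative d) (at t) \<Longrightarrow> dd f (\<gamma> t) D = d"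
  using dd_chain DERIV_unique by blast

lemma dd_translate:
  fixes B C :: "complex^'n^'n"
  assumes "f \<in> poly_fun"
  shows "dd (\<lambda>h. f (B ** h ** C)) g X = dd f (B ** g ** C) (B ** X ** C)"
proof -
  have "((\<lambda>t. f (B ** (g + msmult t X) ** C)) has_field_derivative dd f (B ** (g + msmult 0 X) ** C) (B ** X ** C)) (at 0)"
    by (rule dd_chain[OF assms mderiv_const_mult[OF mderiv_mult_const[OF mderiv_line]]])
  then show ?thesis unfolding dd_def[of "\<lambda>h. f (B ** h ** C)"] by (intro DERIV_imp_deriv) simp
qed

section \<open>Vanishing ideals and tangent spaces\<close>

definition van :: "(complex^'n^'n) set \<Rightarrow> (complex^'n^'n \<Rightarrow> complex) set" where
  "van S = {f \<in> poly_fun. \<forall>g\<in>S. f g = 0}"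

lemma lie_iff: "X \<in> lie G \<longleftrightarrow> (\<forall>f\<in>van G. dd f (mat 1) X = 0)"
  by (auto simp: lie_def van_def dd_def)

lemma lie_add: "X \<in> lie G \<Longrightarrow> Y \<in> lie G \<Longrightarrow> X + Y \<in> lie G"
  by (auto simp: lie_iff van_def dd_add)

lemma lie_msmult: "X \<in> lie G \<Longrightarrow> msmult c X \<in> lie G"
  by (auto simp: lie_iff van_def dd_msmult)

lemma lie_zero [simp]: "0 \<in> lie G"
  using dd_msmult[of _ "mat 1" 0 0] by (auto simp: lie_iff van_def)

lemma lie_minus: "X \<in> lie G \<Longrightarrow> - X \<in> lie G"
  using lie_msmult[of X G "-1"] by (simp add: msmult_minus)

lemma lie_diff: "X \<in> lie G \<Longrightarrow> Y \<in> lie G \<Longrightarrow> X - Y \<in> lie G"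
  using lie_add[of X G "- Y"] lie_minus[of Y G] by simp

lemma lie_sum: "(\<And>i. i \<in> I \<Longrightarrow> f i \<in> lie G) \<Longrightarrow> (\<Sum>i\<in>I. f i) \<in> lie G"
  by (induction I rule: infinite_finite_induct) (auto intro: lie_add)

lemma lie_mono: "A \<subseteq> G \<Longrightarrow> lie A \<subseteq> lie G"
  by (auto simp: lie_iff van_def subset_iff)

lemma lie_curve:
  assumes "\<And>t. \<gamma> t \<in> G" "mderiv \<gamma> X 0" "\<gamma> 0 = mat 1"
  shows "X \<in> lie G"
  unfolding lie_iff
proof
  fix f assume f: "f \<in> van G"
  have "((\<lambda>s. f (\<gamma> s)) has_field_derivative 0) (at 0)"
    using f assms(1) by (simp add: van_def)
  then show "dd f (mat 1) X = 0"
    using dd_unique[of f \<gamma> X 0 0] f assms(2,3) by (simp add: van_def)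
qed

lemma GL_simps: "carrier GL = {g. invertible g}" "mult GL = (**)" "one GL = mat 1"
  by (simp_all add: GL_def)

lemma group_GL: "group (GL :: (complex^'n^'n) monoid)"
proof (rule groupI)
  fix x :: "complex^'n^'n" assume "x \<in> carrier GL"
  then have "invertible (matrix_inv x)" "matrix_inv x ** x = mat 1"
    by (auto simp: GL_simps matrix_inv_left matrix_inv_right invertible_def)
      (metis invertible_def matrix_inv_left matrix_inv_right)
  then show "\<exists>y\<in>carrier GL. y \<otimes>\<^bsub>GL\<^esub> x = \<one>\<^bsub>GL\<^esub>" by (auto simp: GL_simps)
qed (auto simp: GL_simps invertible_mult matrix_mul_assoc, auto simp: invertible_def)

lemma inv_GL: "invertible g \<Longrightarrow> inv\<^bsub>GL\<^esub> g = matrix_inv g"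
  using group.inv_equality[OF group_GL, of "matrix_inv g" g]
  by (simp add: GL_simps matrix_inv_left) (metis invertible_def matrix_inv_left matrix_inv_right)

lemma subgroup_GL_iff:
  "subgroup G GL \<longleftrightarrow> (\<forall>g\<in>G. invertible g) \<and> mat 1 \<in> G \<and> (\<forall>g\<in>G. \<forall>h\<in>G. g ** h \<in> G) \<and> (\<forall>g\<in>G. matrix_inv g \<in> G)"
  unfolding subgroup_def by (auto simp: GL_simps inv_GL subset_iff)

section \<open>Zariski closures\<close>

lemma openin_zariski_basic: "f \<in> poly_fun \<Longrightarrow> openin zariski {g. invertible g \<and> f g \<noteq> 0}"
  unfolding zariski_def by (intro topology_generated_by_Basis) blast

lemma topspace_zariski [simp]: "topspace zariski = {g. invertible g}"
proof -
  have "{g. invertible g \<and> (1 :: complex) \<noteq> 0} \<in> {{g. invertible g \<and> f g \<noteq> 0} |f. f \<in> poly_fun}"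
    by (intro CollectI exI[of _ "\<lambda>_. 1"] conjI refl poly_fun.const)
  then show ?thesis unfolding zariski_def topology_generated_by_topspace by auto
qed

text \<open>Finite intersections of basic sets are basic again, by multiplying the polynomials, so
  the generating family is a base.\<close>

lemma zariski_open_point:
  assumes "openin zariski U" "h \<in> U"
  shows "\<exists>f\<in>poly_fun. f h \<noteq> 0 \<and> {g. invertible g \<and> f g \<noteq> 0} \<subseteq> U"
proof -
  have "generate_topology_on {{g. invertible g \<and> f g \<noteq> 0} |f. f \<in> poly_fun} U"
    using assms(1) unfolding zariski_def openin_topology_generated_by_iff .
  then show ?thesis using assms(2)
  proof (induction)
    case (Int a b)
    then obtain f k where "f \<in> poly_fun" "k \<in> poly_fun" "f h \<noteq> 0" "k h \<noteq> 0"
      "{g. invertible g \<and> f g \<noteq> 0} \<subseteq> a" "{g. invertible g \<and> k g \<noteq> 0} \<subseteq> b" by blast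
    then show ?case by (intro bexI[of _ "\<lambda>g. f g * k g"] poly_fun.mult) auto
  next
    case (UN K)
    then show ?case by (meson UnionE Union_upper subset_trans)
  qed auto
qed

lemma closedin_zariski_invertible: "closedin zariski G \<Longrightarrow> g \<in> G \<Longrightarrow> invertible g"
  using closedin_subset by fastforce

lemma mem_closedin_zariski:
  assumes "closedin zariski G" "invertible h" "\<And>f. f \<in> van G \<Longrightarrow> f h = 0"
  shows "h \<in> G"
proof (rule ccontr)
  assume "h \<notin> G"
  then have "openin zariski (topspace zariski - G)" "h \<in> topspace zariski - G"
    using assms by (auto simp del: topspace_zariski) (simp add: assms(2))
  then obtain f where f: "f \<in> poly_fun" "f h \<noteq> 0" "{g. invertible g \<and> f g \<noteq> 0} \<subseteq> topspace zariski - G"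
    using zariski_open_point by blast
  then have "f \<in> van G" using closedin_zariski_invertible[OF assms(1)] by (auto simp: van_def)
  then show False using assms(3) f by blast
qed

text \<open>The Zariski closure inside the invertible matrices, given by equations so that
  polynomial identities on \<open>S\<close> pass to it by substitution.\<close>

definition zcl :: "(complex^'n^'n) set \<Rightarrow> (complex^'n^'n) set" where
  "zcl S = {g. invertible g \<and> (\<forall>f\<in>van S. f g = 0)}"

lemma closedin_zeros:
  assumes "F \<subseteq> poly_fun" shows "closedin zariski {g. invertible g \<and> (\<forall>f\<in>F. f g = 0)}"
proof -
  have "topspace zariski - {g. invertible g \<and> (\<forall>f\<in>F. f g = 0)} = (\<Union>f\<in>F. {g. invertible g \<and> f g \<noteq> 0})"
    by auto
  moreover have "openin zariski (\<Union>f\<in>F. {g. invertible g \<and> f g \<noteq> 0})"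
    using assms by (intro openin_Union) (auto intro!: openin_zariski_basic)
  ultimately show ?thesis by (auto simp: closedin_def)
qed

lemma closedin_zcl: "closedin zariski (zcl S)"
  unfolding zcl_def by (rule closedin_zeros) (auto simp: van_def)

lemma zcl_base: "(\<And>g. g \<in> S \<Longrightarrow> invertible g) \<Longrightarrow> S \<subseteq> zcl S"
  by (auto simp: zcl_def van_def)

lemma van_antimono: "S \<subseteq> T \<Longrightarrow> van T \<subseteq> van S"
  by (auto simp: van_def)

lemma zcl_subset: "S \<subseteq> G \<Longrightarrow> closedin zariski G \<Longrightarrow> zcl S \<subseteq> G"
  using van_antimono[of S G] mem_closedin_zariski[of G] unfolding zcl_def by blast

lemma connectedin_zcl:
  assumes "connectedin zariski S" shows "connectedin zariski (zcl S)"
proof (rule connectedin_intermediate_closure_of[OF assms])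
  have inv: "\<And>g. g \<in> S \<Longrightarrow> invertible g" using connectedin_subset_topspace[OF assms] by auto
  then show "S \<subseteq> zcl S" by (rule zcl_base)
  show "zcl S \<subseteq> zariski closure_of S"
    using inv by (intro zcl_subset closure_of_subset closedin_closure_of) auto
qed

lemma zcl_eqI:
  assumes "pmap \<phi>" "pmap \<psi>" "\<And>g. g \<in> S \<Longrightarrow> \<phi> g = \<psi> g" "g \<in> zcl S"
  shows "\<phi> g = \<psi> g"
proof -
  have v: "(\<lambda>g. (\<phi> g - \<psi> g) $ i $ j) \<in> van S" for i j
    using assms(3) pmap_entry[OF pmap_diff[OF assms(1,2)], of i j] by (simp add: van_def)
  have "\<forall>f\<in>van S. f g = 0" using assms(4) by (simp add: zcl_def)
  from bspec[OF this v] show ?thesis by (simp add: vec_eq_iff)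
qed

text \<open>Density of \<open>S\<close> in its closure is used once in each variable.\<close>

lemma zcl_commute:
  assumes "\<And>g h. g \<in> S \<Longrightarrow> h \<in> S \<Longrightarrow> g ** h = h ** g" "g \<in> zcl S" "h \<in> zcl S"
  shows "g ** h = h ** g"
proof -
  have "g ** h = h ** g" if "g \<in> S" for g
    using zcl_eqI[of "\<lambda>h. g ** h" "\<lambda>h. h ** g" S h] assms that by (simp add: pmap_mult)
  then show ?thesis
    using zcl_eqI[of "\<lambda>g. g ** h" "\<lambda>g. h ** g" S g] assms by (simp add: pmap_mult)
qed

text \<open>A translated polynomial of the vanishing ideal is again in it. Two-sided translates
  cover left multiplication, right multiplication and conjugation at once.\<close>

lemma zcl_translate:
  assumes "\<And>h. h \<in> S \<Longrightarrow> B ** h ** C \<in> zcl S" "invertible B" "invertible C" "h \<in> zcl S"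
  shows "B ** h ** C \<in> zcl S"
proof -
  have "f (B ** h ** C) = 0" if f: "f \<in> van S" for f
  proof -
    have "(\<lambda>h. f (B ** h ** C)) \<in> poly_fun"
      using f by (intro pmap_compose[of f "\<lambda>h. B ** h ** C"]) (simp_all add: van_def pmap_mult)
    moreover have "f (B ** h ** C) = 0" if "h \<in> S" for h
      using assms(1)[OF that] f by (auto simp: zcl_def)
    ultimately have "(\<lambda>h. f (B ** h ** C)) \<in> van S" by (simp add: van_def)
    then show ?thesis using assms(4) by (auto simp: zcl_def)
  qed
  then show ?thesis using assms by (auto simp: zcl_def invertible_mult)
qed

section \<open>Inversion and closures of subgroups\<close>

lemma poly_fun_det: "pmap \<phi> \<Longrightarrow> (\<lambda>g. det (\<phi> g)) \<in> poly_fun"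
  unfolding det_def by (intro poly_fun_sum poly_fun.mult poly_fun.const poly_fun_prod pmap_entry)

lemma matrix_inv_cramer:
  fixes h :: "complex^'n^'n"
  assumes "invertible h"
  shows "matrix_inv h $ k $ j * det h = det (\<chi> a l. if l = k then (if a = j then 1 else 0) else h $ a $ l)"
proof -
  have "h *v column j (matrix_inv h) = (\<chi> a. if a = j then 1 else 0)"
    using matrix_inv_right[OF assms]
    by (simp add: vec_eq_iff matrix_vector_mult_def column_def matrix_matrix_mult_def mat_def)
  then have "(h *v column j (matrix_inv h)) $ a = (if a = j then 1 else 0)" for a by simp
  moreover have "column j (matrix_inv h) $ k = matrix_inv h $ k $ j" by (simp add: column_def)
  ultimately show ?thesis
    using cramer_lemma[where k=k and A=h and x="column j (matrix_inv h)"]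
    by (simp cong del: if_weak_cong)
qed

text \<open>By Cramer's rule the entries of the inverse become polynomial after multiplication by
  the determinant; on invertible matrices the factor det^N does not affect zeros.\<close>

lemma poly_fun_inverse:
  assumes "f \<in> poly_fun"
  shows "\<exists>F\<in>poly_fun. \<exists>N. \<forall>h. invertible h \<longrightarrow> F h = det h ^ N * f (matrix_inv h)"
  using assms
proof induction
  case (const c)
  show ?case by (intro bexI[of _ "\<lambda>_. c"] exI[of _ 0]) (auto intro: poly_fun.intros)
next
  case (entry k j)
  have "pmap (\<lambda>h. \<chi> a l. if l = k then (if a = j then 1 else 0) else h $ a $ l)"
    unfolding pmap_def
  proof (intro allI)
    fix a l
    show "(\<lambda>h. (\<chi> a l. if l = k then (if a = j then 1 else 0) else h $ a $ l) $ a $ l) \<in> poly_fun"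
      by (cases "l = k") (auto intro: poly_fun.intros)
  qed
  then show ?case
    by (intro bexI[OF _ poly_fun_det] exI[of _ 1] allI impI) (auto simp: matrix_inv_cramer[symmetric])
next
  case (add f k)
  then obtain F K N M where *: "F \<in> poly_fun" "K \<in> poly_fun"
    "\<And>h. invertible h \<Longrightarrow> F h = det h ^ N * f (matrix_inv h)"
    "\<And>h. invertible h \<Longrightarrow> K h = det h ^ M * k (matrix_inv h)" by metis
  have "(\<lambda>h. det h ^ M * F h + det h ^ N * K h) \<in> poly_fun"
    using * by (intro poly_fun.add poly_fun.mult poly_fun_power poly_fun_det) auto
  then show ?case
    using * by (intro bexI[of _ "\<lambda>h. det h ^ M * F h + det h ^ N * K h"] exI[of _ "N + M"])
      (auto simp: power_add algebra_simps)
next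
  case (mult f k)
  then obtain F K N M where *: "F \<in> poly_fun" "K \<in> poly_fun"
    "\<And>h. invertible h \<Longrightarrow> F h = det h ^ N * f (matrix_inv h)"
    "\<And>h. invertible h \<Longrightarrow> K h = det h ^ M * k (matrix_inv h)" by metis
  then show ?case
    by (intro bexI[of _ "\<lambda>h. F h * K h"] exI[of _ "N + M"] poly_fun.mult)
      (auto simp: power_add algebra_simps)
qed

lemma subgroup_zcl:
  assumes "subgroup S GL" shows "subgroup (zcl S) GL"
proof -
  have S: "\<And>g. g \<in> S \<Longrightarrow> invertible g" "mat 1 \<in> S" "\<And>g h. g \<in> S \<Longrightarrow> h \<in> S \<Longrightarrow> g ** h \<in> S"
    "\<And>g. g \<in> S \<Longrightarrow> matrix_inv g \<in> S" using assms by (auto simp: subgroup_GL_iff)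
  have base: "S \<subseteq> zcl S" using S(1) by (rule zcl_base)
  have inv: "invertible g" if "g \<in> zcl S" for g using that by (simp add: zcl_def)
  have one: "invertible (mat 1 :: complex^'n^'n)" by (auto simp: invertible_def)
  \<comment> \<open>The left factor is first restricted to \<open>S\<close>; the next step extends
    it to the closure.\<close>
  have 1: "g ** h \<in> zcl S" if "g \<in> S" "h \<in> zcl S" for g h
  proof -
    have "g ** h' ** mat 1 \<in> zcl S" if "h' \<in> S" for h'
      using S(3)[OF \<open>g \<in> S\<close> that] base by auto
    from zcl_translate[OF this S(1)[OF \<open>g \<in> S\<close>] one \<open>h \<in> zcl S\<close>] show ?thesis by simp
  qed
  have 2: "g ** h \<in> zcl S" if "g \<in> zcl S" "h \<in> zcl S" for g h
  proof -
    have "mat 1 ** g' ** h \<in> zcl S" if "g' \<in> S" for g'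
      using 1[OF that \<open>h \<in> zcl S\<close>] by simp
    from zcl_translate[OF this one inv[OF \<open>h \<in> zcl S\<close>] \<open>g \<in> zcl S\<close>] show ?thesis by simp
  qed
  have 3: "matrix_inv g \<in> zcl S" if g: "g \<in> zcl S" for g
  proof -
    have "f (matrix_inv g) = 0" if f: "f \<in> van S" for f
    proof -
      have "f \<in> poly_fun" using f by (simp add: van_def)
      then obtain F N where F: "F \<in> poly_fun" "\<And>h. invertible h \<Longrightarrow> F h = det h ^ N * f (matrix_inv h)"
        using poly_fun_inverse by blast
      then have "F \<in> van S" using f S by (auto simp: van_def)
      then have "det g ^ N * f (matrix_inv g) = 0" using F inv[OF g] g by (auto simp: zcl_def)
      then show ?thesis using inv[OF g] by (simp add: invertible_det_nz)
    qed
    moreover have "invertible (matrix_inv g)"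
      using inv[OF g] by (metis invertible_def matrix_inv_left matrix_inv_right)
    ultimately show ?thesis by (simp add: zcl_def)
  qed
  show ?thesis using inv base S(2) 2 3 by (auto simp: subgroup_GL_iff)
qed

lemma algebraic_group_zcl: "subgroup S GL \<Longrightarrow> connectedin zariski S \<Longrightarrow> connected_algebraic_group (zcl S)"
  by (simp add: connected_algebraic_group_def algebraic_group_def subgroup_zcl closedin_zcl connectedin_zcl)

text \<open>Polynomial functions are continuous along the curve, so \<gamma> is continuous from the
  usual topology of the complex line to the Zariski topology, and the line is connected.\<close>

lemma connected_curve:
  assumes "\<And>i j. continuous_on UNIV (\<lambda>t. \<gamma> t $ i $ j)" "\<And>t::complex. invertible (\<gamma> t)"
  shows "connectedin zariski (range \<gamma>)"
proof -
  have cont: "continuous_on UNIV (\<lambda>t. f (\<gamma> t))" if "f \<in> poly_fun" for f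
    using that by induction (auto intro!: continuous_intros assms(1))
  have 1: "open ((\<lambda>t. f (\<gamma> t)) -` (- {0}))" if "f \<in> poly_fun" for f
    using cont[OF that] by (intro open_vimage) auto
  have 2: "\<gamma> -` {g. invertible g \<and> f g \<noteq> 0} = (\<lambda>t. f (\<gamma> t)) -` (- {0})" for f
    using assms(2) by auto
  have "open (\<gamma> -` {g. invertible g \<and> f g \<noteq> 0})" if "f \<in> poly_fun" for f
    unfolding 2 using that by (rule 1)
  then have "open (\<gamma> -` U)" if "U \<in> {{g. invertible g \<and> f g \<noteq> 0} |f. f \<in> poly_fun}" for U
    using that by blast
  moreover have "\<gamma> ` UNIV \<subseteq> topspace zariski" using assms(2) by auto
  ultimately have "continuous_map euclidean zariski \<gamma>"
    unfolding zariski_def by (intro continuous_on_generated_topo) auto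
  then show ?thesis
    using connectedin_continuous_map_image[of euclidean zariski \<gamma> UNIV] connected_UNIV by simp
qed

section \<open>Lie algebras of algebraic groups\<close>

lemma algebraic_groupD:
  assumes "algebraic_group G"
  shows "closedin zariski G" "\<And>g. g \<in> G \<Longrightarrow> invertible g" "mat 1 \<in> G"
    "\<And>g h. g \<in> G \<Longrightarrow> h \<in> G \<Longrightarrow> g ** h \<in> G" "\<And>g. g \<in> G \<Longrightarrow> matrix_inv g \<in> G"
  using assms by (auto simp: algebraic_group_def subgroup_GL_iff)

lemma lie_conj:
  assumes "algebraic_group G" "g \<in> G" "X \<in> lie G"
  shows "g ** X ** matrix_inv g \<in> lie G"
  unfolding lie_iff
proof
  note G = algebraic_groupD[OF assms(1)]
  fix f assume f: "f \<in> van G"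
  have "(\<lambda>h. f (g ** h ** matrix_inv g)) \<in> van G"
    using f G assms(2) by (auto simp: van_def intro!: pmap_compose[of f "\<lambda>h. g ** h ** matrix_inv g"] pmap_mult)
  then have "dd (\<lambda>h. f (g ** h ** matrix_inv g)) (mat 1) X = 0" using assms(3) by (simp add: lie_iff)
  then show "dd f (mat 1) (g ** X ** matrix_inv g) = 0"
    using f G(2)[OF assms(2)] by (simp add: van_def dd_translate matrix_inv_right)
qed

text \<open>For g in G the function f(g h) of h again vanishes on G; hence the left-invariant
  derivation attached to X preserves the vanishing ideal.\<close>

lemma lie_left_derivative:
  assumes "algebraic_group G" "X \<in> lie G" "f \<in> van G"
  shows "(\<lambda>g. dd f g (g ** X)) \<in> van G"
proof -
  note G = algebraic_groupD[OF assms(1)]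
  have f: "f \<in> poly_fun" using assms by (simp add: van_def)
  have "dd f g (g ** X) = 0" if g: "g \<in> G" for g
  proof -
    have "(\<lambda>h. f (g ** h ** mat 1)) \<in> van G"
      using assms(3) G g by (auto simp: van_def intro!: pmap_compose[of f "\<lambda>h. g ** h"] pmap_mult)
    then have "dd (\<lambda>h. f (g ** h ** mat 1)) (mat 1) X = 0" using assms(2) unfolding lie_iff by blast
    then show ?thesis using dd_translate[OF f, of g "mat 1" "mat 1" X] by simp
  qed
  then show ?thesis using f by (auto simp: van_def intro!: dd_poly_fun pmap_mult)
qed

text \<open>The derivatives of f along \<gamma> are values of iterated left-invariant derivations of
  f, which stay in the vanishing ideal. So all derivatives at 0 vanish, and the identity theorem for
  holomorphic functions applies.\<close>

lemma lie_integral_curve: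
  assumes G: "algebraic_group G" and X: "X \<in> lie G"
    and \<gamma>: "\<And>t. mderiv \<gamma> (\<gamma> t ** X) t" "\<gamma> 0 = mat 1" and f: "f \<in> van G"
  shows "f (\<gamma> t) = 0"
proof (rule holomorphic_fun_eq_0_on_connected[of "\<lambda>t. f (\<gamma> t)" UNIV 0])
  define L where "L = (\<lambda>f g. dd f g (g ** X))"
  have L: "(L ^^ n) f \<in> van G" for n
    by (induction n) (auto simp: f L_def intro: lie_left_derivative[OF G X])
  have der: "((\<lambda>s. h (\<gamma> s)) has_field_derivative L h (\<gamma> t)) (at t)" if "h \<in> van G" for h t
    unfolding L_def using that \<gamma> by (intro dd_chain) (auto simp: van_def)
  have "(deriv ^^ n) (\<lambda>t. f (\<gamma> t)) = (\<lambda>t. (L ^^ n) f (\<gamma> t))" for n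
  proof (induction n)
    case (Suc n)
    have "deriv (\<lambda>t. (L ^^ n) f (\<gamma> t)) t = L ((L ^^ n) f) (\<gamma> t)" for t
      using der[OF L] by (rule DERIV_imp_deriv)
    then show ?case by (simp add: Suc)
  qed simp
  then show "(deriv ^^ n) (\<lambda>t. f (\<gamma> t)) 0 = 0" for n
    using L[of n] \<gamma>(2) algebraic_groupD(3)[OF G] by (simp add: van_def)
  show "(\<lambda>t. f (\<gamma> t)) holomorphic_on UNIV"
    using der[OF f] by (auto simp: holomorphic_on_def field_differentiable_def intro: has_field_derivative_at_within)
qed auto

lemma semisimple_no_abelian_normal:
  assumes ss: "semisimple_group G" and N: "connected_algebraic_group N" "N \<subseteq> G"
    and comm: "\<And>g h. g \<in> N \<Longrightarrow> h \<in> N \<Longrightarrow> g ** h = h ** g"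
    and nor: "\<And>g h. g \<in> G \<Longrightarrow> h \<in> N \<Longrightarrow> g ** h ** matrix_inv g \<in> N"
  shows "N = {mat 1}"
proof -
  interpret GL: group "GL :: (complex^'n^'n) monoid" by (rule group_GL)
  have sG: "subgroup G GL" and sN: "subgroup N GL"
    using ss N by (auto simp: semisimple_group_def connected_algebraic_group_def algebraic_group_def)
  interpret G: group "GL\<lparr>carrier := G\<rparr>" by (rule GL.subgroup_imp_group[OF sG])
  have inv: "inv\<^bsub>GL\<lparr>carrier := G\<rparr>\<^esub> g = matrix_inv g" if "g \<in> G" for g
    using GL.m_inv_consistent[OF sG that] inv_GL sG that by (auto simp: subgroup_GL_iff)
  have "N \<lhd> GL\<lparr>carrier := G\<rparr>"
    unfolding G.normal_inv_iff
    using GL.subgroup_incl[OF sN sG N(2)] nor inv by (auto simp: GL_simps)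
  moreover have "solvable (GL\<lparr>carrier := N\<rparr>)"
  proof -
    interpret N: group "GL\<lparr>carrier := N\<rparr>" by (rule GL.subgroup_imp_group[OF sN])
    interpret N: comm_group "GL\<lparr>carrier := N\<rparr>"
      by (rule N.group_comm_groupI) (simp add: GL_simps comm)
    have "derived (GL\<lparr>carrier := N\<rparr>) (carrier (GL\<lparr>carrier := N\<rparr>)) = {\<one>\<^bsub>GL\<lparr>carrier := N\<rparr>\<^esub>}"
      by (rule N.derived_eq_singleton) simp
    then show ?thesis unfolding N.solvable_iff_trivial_derived_seq by (intro exI[of _ 1]) simp
  qed
  ultimately show ?thesis using ss N(1) unfolding semisimple_group_def by blast
qed

section \<open>One-parameter subgroups and replicas\<close>

lemma poly_exp_shift_inj:
  fixes q :: "complex poly"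
  assumes "\<nu> \<noteq> 0" "pderiv q + smult \<nu> q = 0" shows "q = 0"
proof (rule ccontr)
  assume "q \<noteq> 0"
  have "Polynomial.coeff (pderiv q + smult \<nu> q) (degree q) = \<nu> * lead_coeff q"
    by (simp add: coeff_pderiv coeff_eq_0)
  then show False using assms \<open>q \<noteq> 0\<close> by simp
qed

text \<open>Multiplying by \<open>exp (- \<mu> t)\<close> and differentiating lowers the degree of the coefficient of
  \<open>exp (\<mu> t)\<close> and does not annihilate any other coefficient.\<close>

lemma exp_poly_independent:
  fixes q :: "complex \<Rightarrow> complex poly"
  assumes "finite M" "\<And>t. (\<Sum>\<mu>\<in>M. exp (\<mu> * t) * poly (q \<mu>) t) = 0" "\<mu> \<in> M"
  shows "q \<mu> = 0"
  using assms
proof (induction M arbitrary: q \<mu> rule: finite_induct)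
  case (insert \<nu> M)
  note finM = insert.hyps(1) and notin = insert.hyps(2)
  have key: "\<forall>\<mu>\<in>insert \<nu> M. q \<mu> = 0"
    if "\<And>t. (\<Sum>\<mu>\<in>insert \<nu> M. exp (\<mu> * t) * poly (q \<mu>) t) = 0" for q
    using that
  \<comment> \<open>The measure separates a nonzero constant (value 1) from the zero polynomial
    (value 0), so that differentiation always decreases it.\<close>
  proof (induction "if q \<nu> = 0 then 0 else Suc (degree (q \<nu>))" arbitrary: q rule: less_induct)
    case less
    show ?case
    proof (cases "q \<nu> = 0")
      case True
      then have "(\<Sum>\<mu>\<in>M. exp (\<mu> * t) * poly (q \<mu>) t) = 0" for t
        using less.prems[of t] finM notin by simp
      then show ?thesis using insert.IH True by blast
    next
      case False
      define p where "p = (\<lambda>\<mu>. pderiv (q \<mu>) + smult (\<mu> - \<nu>) (q \<mu>))"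
      have "(\<Sum>\<mu>\<in>insert \<nu> M. exp (\<mu> * t) * poly (p \<mu>) t) = 0" for t
      proof -
        have "(\<Sum>\<mu>\<in>insert \<nu> M. exp ((\<mu> - \<nu>) * s) * poly (q \<mu>) s) = 0" for s
        proof -
          have "(\<Sum>\<mu>\<in>insert \<nu> M. exp ((\<mu> - \<nu>) * s) * poly (q \<mu>) s) =
              exp (- \<nu> * s) * (\<Sum>\<mu>\<in>insert \<nu> M. exp (\<mu> * s) * poly (q \<mu>) s)"
            unfolding sum_distrib_left
            by (intro sum.cong) (auto simp: algebra_simps exp_add[symmetric] exp_diff exp_minus field_simps)
          then show ?thesis using less.prems by simp
        qed
        then have "((\<lambda>s. \<Sum>\<mu>\<in>insert \<nu> M. exp ((\<mu> - \<nu>) * s) * poly (q \<mu>) s) has_field_derivative 0) (at t)"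
          by simp
        moreover have "((\<lambda>s. \<Sum>\<mu>\<in>insert \<nu> M. exp ((\<mu> - \<nu>) * s) * poly (q \<mu>) s) has_field_derivative
            (\<Sum>\<mu>\<in>insert \<nu> M. exp ((\<mu> - \<nu>) * t) * poly (p \<mu>) t)) (at t)"
        proof (intro DERIV_sum)
          fix \<mu>
          have "((\<lambda>s. exp ((\<mu> - \<nu>) * s) * poly (q \<mu>) s) has_field_derivative
             exp ((\<mu> - \<nu>) * t) * poly (pderiv (q \<mu>)) t + exp ((\<mu> - \<nu>) * t) * (\<mu> - \<nu>) * poly (q \<mu>) t) (at t)"
            by (intro DERIV_mult' poly_DERIV) (auto intro!: derivative_eq_intros)
          then show "((\<lambda>s. exp ((\<mu> - \<nu>) * s) * poly (q \<mu>) s) has_field_derivative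
             exp ((\<mu> - \<nu>) * t) * poly (p \<mu>) t) (at t)"
            by (simp add: p_def algebra_simps)
        qed
        ultimately have "(\<Sum>\<mu>\<in>insert \<nu> M. exp ((\<mu> - \<nu>) * t) * poly (p \<mu>) t) = 0"
          using DERIV_unique by blast
        moreover have "(\<Sum>\<mu>\<in>insert \<nu> M. exp (\<mu> * t) * poly (p \<mu>) t) =
            exp (\<nu> * t) * (\<Sum>\<mu>\<in>insert \<nu> M. exp ((\<mu> - \<nu>) * t) * poly (p \<mu>) t)"
          unfolding sum_distrib_left
          by (intro sum.cong) (auto simp: algebra_simps exp_add[symmetric] exp_diff exp_minus field_simps)
        ultimately show ?thesis by simp
      qed
      moreover have p\<nu>: "p \<nu> = pderiv (q \<nu>)" by (simp add: p_def)
      have "(if p \<nu> = 0 then 0 else Suc (degree (p \<nu>))) < (if q \<nu> = 0 then 0 else Suc (degree (q \<nu>)))"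
        using False unfolding p\<nu> by (auto simp: degree_pderiv pderiv_eq_0_iff)
      ultimately have p0: "\<forall>\<mu>\<in>insert \<nu> M. p \<mu> = 0" using less.hyps by blast
      have qM: "q \<mu> = 0" if "\<mu> \<in> M" for \<mu>
        using poly_exp_shift_inj[of "\<mu> - \<nu>" "q \<mu>"] p0 that notin by (auto simp: p_def)
      have "exp (\<nu> * t) * poly (q \<nu>) t = 0" for t
        using less.prems[of t] finM notin qM by simp
      then have "poly (q \<nu>) t = 0" for t by simp
      then have "q \<nu> = 0" using poly_all_0_iff_0 by blast
      then show ?thesis using qM by simp
    qed
  qed
  show ?case using key[OF insert.prems(1)] insert.prems(2) by blast
qed simp

text \<open>The domain is a general additive monoid because two cases occur: the complex eigenvalues
  and the exponent vectors of monomials.\<close>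

definition ehom :: "('a::comm_monoid_add \<Rightarrow> complex) \<Rightarrow> bool" where
  "ehom \<psi> \<longleftrightarrow> \<psi> 0 = 1 \<and> (\<forall>a b. \<psi> (a + b) = \<psi> a * \<psi> b)"

lemma ehom_exp: "ehom (\<lambda>a. exp (s * \<phi> a))" if "\<And>a b. \<phi> (a + b) = \<phi> a + \<phi> b" for \<phi> :: "complex \<Rightarrow> complex"
proof -
  have "\<phi> 0 = 0" using that[of 0 0] by simp
  then show ?thesis by (simp add: ehom_def that distrib_left exp_add)
qed

text \<open>Along matrices with entries \<open>\<Sum>\<mu>. \<psi> \<mu> * C \<mu> t\<close> the values of a polynomial function have the same
  shape, with coefficients that do not depend on the character \<open>\<psi>\<close>.\<close>

lemma poly_fun_exp_poly:
  fixes C :: "'n::finite \<Rightarrow> 'n \<Rightarrow> 'a::comm_monoid_add \<Rightarrow> complex poly"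
  assumes "f \<in> poly_fun" "finite L"
  shows "\<exists>M q. finite M \<and> (\<forall>\<psi> t. ehom \<psi> \<longrightarrow>
     f (\<chi> i j. \<Sum>x\<in>L. \<psi> x * poly (C i j x) t) = (\<Sum>\<mu>\<in>M. \<psi> \<mu> * poly (q \<mu>) t))"
  using assms(1)
proof induction
  case (const c)
  show ?case
    by (intro exI[of _ "{0}"] exI[of _ "\<lambda>_. [:c:]"]) (simp add: ehom_def)
next
  case (entry i j)
  show ?case using assms(2) by (intro exI[of _ L] exI[of _ "C i j"]) simp
next
  case (add f h)
  then obtain M q N p where *: "finite M" "finite N"
    "\<And>\<psi> t. ehom \<psi> \<Longrightarrow> f (\<chi> i j. \<Sum>x\<in>L. \<psi> x * poly (C i j x) t) = (\<Sum>\<mu>\<in>M. \<psi> \<mu> * poly (q \<mu>) t)"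
    "\<And>\<psi> t. ehom \<psi> \<Longrightarrow> h (\<chi> i j. \<Sum>x\<in>L. \<psi> x * poly (C i j x) t) = (\<Sum>\<mu>\<in>N. \<psi> \<mu> * poly (p \<mu>) t)"
    by blast
  define r where "r = (\<lambda>\<mu>. (if \<mu> \<in> M then q \<mu> else 0) + (if \<mu> \<in> N then p \<mu> else 0))"
  have "(\<Sum>\<mu>\<in>M \<union> N. \<psi> \<mu> * poly (r \<mu>) t) =
      (\<Sum>\<mu>\<in>M. \<psi> \<mu> * poly (q \<mu>) t) + (\<Sum>\<mu>\<in>N. \<psi> \<mu> * poly (p \<mu>) t)" for \<psi> t
  proof -
    have "(\<Sum>\<mu>\<in>M. \<psi> \<mu> * poly (q \<mu>) t) = (\<Sum>\<mu>\<in>M \<union> N. \<psi> \<mu> * poly (if \<mu> \<in> M then q \<mu> else 0) t)"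
      using *(1,2) by (intro sum.mono_neutral_cong_left) auto
    moreover have "(\<Sum>\<mu>\<in>N. \<psi> \<mu> * poly (p \<mu>) t) = (\<Sum>\<mu>\<in>M \<union> N. \<psi> \<mu> * poly (if \<mu> \<in> N then p \<mu> else 0) t)"
      using *(1,2) by (intro sum.mono_neutral_cong_left) auto
    ultimately show ?thesis unfolding r_def by (simp add: distrib_left sum.distrib del: if_image_distrib)
  qed
  then show ?case using * by (intro exI[of _ "M \<union> N"] exI[of _ r]) simp
next
  case (mult f h)
  then obtain M q N p where *: "finite M" "finite N"
    "\<And>\<psi> t. ehom \<psi> \<Longrightarrow> f (\<chi> i j. \<Sum>x\<in>L. \<psi> x * poly (C i j x) t) = (\<Sum>\<mu>\<in>M. \<psi> \<mu> * poly (q \<mu>) t)"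
    "\<And>\<psi> t. ehom \<psi> \<Longrightarrow> h (\<chi> i j. \<Sum>x\<in>L. \<psi> x * poly (C i j x) t) = (\<Sum>\<mu>\<in>N. \<psi> \<mu> * poly (p \<mu>) t)"
    by blast
  define K where "K = (\<lambda>z. fst z + snd z) ` (M \<times> N)"
  define r where "r = (\<lambda>\<kappa>. \<Sum>z | z \<in> M \<times> N \<and> fst z + snd z = \<kappa>. q (fst z) * p (snd z))"
  have "(\<Sum>\<kappa>\<in>K. \<psi> \<kappa> * poly (r \<kappa>) t) =
      (\<Sum>\<mu>\<in>M. \<psi> \<mu> * poly (q \<mu>) t) * (\<Sum>\<mu>\<in>N. \<psi> \<mu> * poly (p \<mu>) t)" if "ehom \<psi>" for \<psi> t
  proof -
    let ?F = "\<lambda>z. \<psi> (fst z) * poly (q (fst z)) t * (\<psi> (snd z) * poly (p (snd z)) t)"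
    have "(\<Sum>\<mu>\<in>M. \<psi> \<mu> * poly (q \<mu>) t) * (\<Sum>\<mu>\<in>N. \<psi> \<mu> * poly (p \<mu>) t) = (\<Sum>z\<in>M \<times> N. ?F z)"
      by (simp add: sum_product sum.cartesian_product case_prod_beta)
    also have "\<dots> = (\<Sum>\<kappa>\<in>K. \<Sum>z | z \<in> M \<times> N \<and> fst z + snd z = \<kappa>. ?F z)"
      unfolding K_def by (rule sum.image_gen) (use * in auto)
    also have "\<dots> = (\<Sum>\<kappa>\<in>K. \<psi> \<kappa> * poly (r \<kappa>) t)"
    proof (intro sum.cong refl)
      fix \<kappa>
      show "(\<Sum>z | z \<in> M \<times> N \<and> fst z + snd z = \<kappa>. ?F z) = \<psi> \<kappa> * poly (r \<kappa>) t"
        unfolding r_def poly_sum sum_distrib_left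
        by (intro sum.cong refl) (use that in \<open>auto simp: ehom_def mult_ac\<close>)
    qed
    finally show ?thesis by simp
  qed
  then show ?case using * by (intro exI[of _ K] exI[of _ r]) (simp add: K_def)
qed

section \<open>Exponentials from the Jordan decomposition\<close>

lemma dg_add: "dg P (\<lambda>i. d i + e i) = dg P d + dg P e"
proof -
  have "diagm (\<lambda>i. d i + e i) = diagm d + diagm e" by (simp add: vec_eq_iff diagm_def)
  then show ?thesis by (simp add: dg_def uncj_def matrix_ring_simps)
qed

lemma dg_scale: "dg P (\<lambda>i. c * d i) = msmult c (dg P d)"
proof -
  have "diagm (\<lambda>i. c * d i) = msmult c (diagm d)" by (simp add: vec_eq_iff diagm_def)
  then show ?thesis by (simp add: dg_def uncj_def msmult_mult)
qed

lemma dg_sum: "dg P (\<lambda>i. \<Sum>x\<in>L. f x i) = (\<Sum>x\<in>L. dg P (f x))"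
  by (induction L rule: infinite_finite_induct) (simp_all add: dg_zero dg_add)

lemma mderiv_dg:
  assumes "\<And>i. ((\<lambda>s. e s i) has_field_derivative e' i) (at t)"
  shows "mderiv (\<lambda>s. dg P (e s)) (dg P e') t"
proof -
  have "mderiv (\<lambda>s. diagm (e s)) (diagm e') t"
    using assms by (auto simp: mderiv_def diagm_def)
  then show ?thesis unfolding dg_def uncj_def by (intro mderiv_const_mult mderiv_mult_const)
qed

text \<open>This is exp(tN) for nilpotent N. It is used with \<open>Suc m\<close> terms when N^m =
  0: the term k = 0 is then always present, and the surplus term of
  \<open>unip N (Suc m) t ** N\<close> vanishes.\<close>

definition unip :: "complex^'n^'n \<Rightarrow> nat \<Rightarrow> complex \<Rightarrow> complex^'n^'n" where
  "unip N m t = (\<Sum>k<m. msmult (t ^ k / fact k) (mpow N k))"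

lemma unip_commute: "N ** Y = Y ** N \<Longrightarrow> unip N m t ** Y = Y ** unip N m t"
  by (simp add: unip_def matrix_sum_left matrix_sum_right msmult_mult mpow_commute)

lemma unip_0: "unip N (Suc m) 0 = mat 1"
  by (simp add: unip_def sum.lessThan_Suc_shift del: sum.lessThan_Suc)

lemma mderiv_unip:
  assumes "mpow N m = 0"
  shows "mderiv (unip N (Suc m)) (unip N (Suc m) t ** N) t"
proof -
  have "((\<lambda>s::complex. s ^ k / fact k) has_field_derivative
      (if k = 0 then 0 else t ^ (k - 1) / fact (k - 1))) (at t)" for k
  proof (cases k)
    case (Suc l)
    have "((\<lambda>s::complex. s ^ Suc l / fact (Suc l)) has_field_derivative
        (of_nat (Suc l) * t ^ l) / fact (Suc l)) (at t)"
      by (intro DERIV_cdivide) (auto intro!: derivative_eq_intros simp del: of_nat_Suc fact_Suc power_Suc)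
    moreover have "(of_nat (Suc l) * t ^ l) / fact (Suc l) = t ^ l / fact l"
      by (simp add: field_simps del: of_nat_Suc)
    ultimately show ?thesis using Suc by simp
  qed simp
  then have "mderiv (\<lambda>s. \<Sum>k<Suc m. msmult (s ^ k / fact k) (mpow N k))
     (\<Sum>k<Suc m. msmult (if k = 0 then 0 else t ^ (k - 1) / fact (k - 1)) (mpow N k)) t"
    by (intro mderiv_sum mderiv_msmult)
  also have "(\<Sum>k<Suc m. msmult (if k = 0 then 0 else t ^ (k - 1) / fact (k - 1)) (mpow N k)) =
      (\<Sum>k<m. msmult (t ^ k / fact k) (mpow N (Suc k)))"
    by (simp add: sum.lessThan_Suc_shift del: mpow.simps sum.lessThan_Suc)
  also have "\<dots> = (\<Sum>k<Suc m. msmult (t ^ k / fact k) (mpow N (Suc k)))"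
    using assms by simp
  also have "\<dots> = unip N (Suc m) t ** N"
    by (simp only: unip_def matrix_sum_left msmult_mult mpow_Suc_right)
  finally show ?thesis unfolding unip_def .
qed

text \<open>The curve exp(tX), given by the properties that are used. Existence comes in closed form
  from the Jordan decomposition, without convergence of a matrix series.\<close>

definition is_exp :: "complex^'n^'n \<Rightarrow> (complex \<Rightarrow> complex^'n^'n) \<Rightarrow> bool" where
  "is_exp X \<gamma> \<longleftrightarrow> (\<forall>t. mderiv \<gamma> (\<gamma> t ** X) t) \<and> \<gamma> 0 = mat 1 \<and> (\<forall>t. \<gamma> t ** \<gamma> (- t) = mat 1)
     \<and> (\<forall>t Y. X ** Y = Y ** X \<longrightarrow> \<gamma> t ** Y = Y ** \<gamma> t)"

lemma is_expD:
  assumes "is_exp X \<gamma>"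
  shows "mderiv \<gamma> (\<gamma> t ** X) t" "\<gamma> 0 = mat 1" "\<gamma> t ** \<gamma> (- t) = mat 1" "invertible (\<gamma> t)"
    "matrix_inv (\<gamma> t) = \<gamma> (- t)" "X ** Y = Y ** X \<Longrightarrow> \<gamma> t ** Y = Y ** \<gamma> t"
    "mderiv \<gamma> X 0" "continuous_on UNIV (\<lambda>t. \<gamma> t $ i $ j)"
proof -
  show 1: "mderiv \<gamma> (\<gamma> t ** X) t" and 2: "\<gamma> 0 = mat 1" and 3: "\<gamma> t ** \<gamma> (- t) = mat 1" for t
    using assms unfolding is_exp_def by blast+
  show "X ** Y = Y ** X \<Longrightarrow> \<gamma> t ** Y = Y ** \<gamma> t" using assms unfolding is_exp_def by blast
  show "mderiv \<gamma> X 0" using 1[of 0] 2 by simp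
  show "invertible (\<gamma> t)" using 3 invertible_right_inverse by blast
  show "matrix_inv (\<gamma> t) = \<gamma> (- t)" using 3 by (rule matrix_inv_unique)
  show "continuous_on UNIV (\<lambda>t. \<gamma> t $ i $ j)"
    using 1 by (auto simp: mderiv_def intro!: continuous_at_imp_continuous_on DERIV_isCont)
qed

lemma mderiv_zero_constant:
  assumes "\<And>t. mderiv \<beta> 0 t" shows "\<beta> t = \<beta> 0"
proof -
  have "\<beta> t $ i $ j = \<beta> 0 $ i $ j" for i j
  proof -
    have "((\<lambda>t. \<beta> t $ i $ j) has_field_derivative 0) (at x within UNIV)" for x
      using assms[of x] by (simp add: mderiv_def)
    then obtain c where "\<And>x. x \<in> UNIV \<Longrightarrow> \<beta> x $ i $ j = c"
      using has_field_derivative_zero_constant[OF convex_UNIV, of "\<lambda>t. \<beta> t $ i $ j"] by metis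
    then show ?thesis by simp
  qed
  then show ?thesis by (simp add: vec_eq_iff)
qed

locale jordan =
  fixes P :: "complex^'n^'n" and d :: "'n \<Rightarrow> complex" and N X :: "complex^'n^'n" and m :: nat
  assumes P: "invertible P" and X: "X = dg P d + N" and N: "mpow N m = 0"
    and comm: "\<And>Y. X ** Y = Y ** X \<Longrightarrow> dg P d ** Y = Y ** dg P d"
begin

text \<open>For \<psi> = \<open>\<lambda>a. exp (t * a)\<close> this is exp(tX). The character and
  the time of the unipotent factor are independent arguments; at t = 0 only the replica of the
  semisimple part remains.\<close>

definition cur :: "(complex \<Rightarrow> complex) \<Rightarrow> complex \<Rightarrow> complex^'n^'n" where
  "cur \<psi> t = dg P (\<psi> \<circ> d) ** unip N (Suc m) t"

lemma commute_N: "X ** Y = Y ** X \<Longrightarrow> N ** Y = Y ** N"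
  using comm[of Y] X by (simp add: matrix_ring_simps)

lemma cur_commute: "X ** Y = Y ** X \<Longrightarrow> cur \<psi> t ** Y = Y ** cur \<psi> t"
  unfolding cur_def using unip_commute[OF commute_N, of Y "Suc m" t] dg_commute_comp[OF P comm, of Y \<psi>]
  by (metis matrix_mul_assoc)

lemma mderiv_cur: "mderiv (\<lambda>t. cur (\<lambda>a. exp (t * a)) t) (cur (\<lambda>a. exp (t * a)) t ** X) t"
proof -
  let ?D = "\<lambda>t. dg P ((\<lambda>a. exp (t * a)) \<circ> d)" and ?U = "unip N (Suc m)"
  have "mderiv (\<lambda>t. dg P (\<lambda>i. exp (t * d i))) (dg P (\<lambda>i. exp (t * d i) * d i)) t"
    by (rule mderiv_dg) (auto intro!: derivative_eq_intros)
  then have "mderiv ?D (?D t ** dg P d) t"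
    using P by (simp add: dg_mult comp_def)
  then have "mderiv (\<lambda>t. cur (\<lambda>a. exp (t * a)) t) (?D t ** (?U t ** N) + (?D t ** dg P d) ** ?U t) t"
    unfolding cur_def by (intro mderiv_mult mderiv_unip N)
  moreover have "dg P d ** ?U t = ?U t ** dg P d"
    using unip_commute[of N "dg P d"] comm[of X] X by (simp add: matrix_ring_simps)
  then have "?D t ** (?U t ** N) + (?D t ** dg P d) ** ?U t = cur (\<lambda>a. exp (t * a)) t ** X"
    unfolding cur_def X by (simp add: matrix_ring_simps) (simp add: matrix_mul_assoc[symmetric])
  ultimately show ?thesis by simp
qed

lemma is_exp_cur: "is_exp X (\<lambda>t. cur (\<lambda>a. exp (t * a)) t)"
proof -
  let ?\<gamma> = "\<lambda>t. cur (\<lambda>a. exp (t * a)) t"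
  have 0: "?\<gamma> 0 = mat 1" using P by (simp add: cur_def unip_0 comp_def dg_one)
  have neg: "mderiv (\<lambda>t. ?\<gamma> (- t)) (- (?\<gamma> (- t) ** X)) t" for t
  proof -
    have "((\<lambda>s. ?\<gamma> (- s) $ i $ j) has_field_derivative (?\<gamma> (- t) ** X) $ i $ j * (- 1)) (at t)" for i j
      using mderiv_cur[of "- t"]
      by (intro DERIV_chain2[of "\<lambda>s. ?\<gamma> s $ i $ j" _ uminus]) (auto simp: mderiv_def intro!: derivative_eq_intros)
    then show ?thesis by (simp add: mderiv_def)
  qed
  \<comment> \<open>The inverse is found by differentiation: the product of the curve at t and at -t
    is constant, since X commutes with the curve.\<close>
  have "mderiv (\<lambda>t. ?\<gamma> t ** ?\<gamma> (- t)) 0 t" for t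
  proof -
    have "?\<gamma> t ** - (?\<gamma> (- t) ** X) + ?\<gamma> t ** X ** ?\<gamma> (- t) = 0"
      using cur_commute[of X "\<lambda>a. exp (- t * a)" "- t"]
      by (simp add: matrix_ring_simps)
    then show ?thesis using mderiv_mult[OF mderiv_cur[of t] neg[of t]] by simp
  qed
  then have "?\<gamma> t ** ?\<gamma> (- t) = ?\<gamma> 0 ** ?\<gamma> (- 0)" for t by (rule mderiv_zero_constant)
  then have "?\<gamma> t ** ?\<gamma> (- t) = mat 1" for t using 0 by simp
  then show ?thesis unfolding is_exp_def
    by (intro conjI allI impI mderiv_cur 0 cur_commute)
qed

text \<open>Grouping the indices by eigenvalue brings the entries into the shape that
  \<open>poly_fun_exp_poly\<close> takes, with coefficients free of \<psi>.\<close>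

lemma cur_entry:
  "cur \<psi> t = (\<chi> i j. \<Sum>x\<in>range d. \<psi> x * poly (\<Sum>k<Suc m.
      Polynomial.monom ((dg P (\<lambda>i. if d i = x then 1 else 0) ** mpow N k) $ i $ j / fact k) k) t)"
proof -
  let ?e = "\<lambda>x. dg P (\<lambda>i. if d i = x then 1 else 0)"
  have "\<psi> \<circ> d = (\<lambda>i. \<Sum>x\<in>range d. \<psi> x * (if d i = x then 1 else 0))"
    by (auto simp: fun_eq_iff if_distrib sum.delta cong: if_cong)
  then have "dg P (\<psi> \<circ> d) = (\<Sum>x\<in>range d. msmult (\<psi> x) (?e x))"
    by (simp only: dg_sum dg_scale)
  then have "cur \<psi> t = (\<Sum>x\<in>range d. msmult (\<psi> x) (?e x ** unip N (Suc m) t))"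
    by (simp only: cur_def matrix_sum_left msmult_mult_left)
  moreover have "?e x ** unip N (Suc m) t = (\<Sum>k<Suc m. msmult (t ^ k / fact k) (?e x ** mpow N k))" for x
    by (simp only: unip_def matrix_sum_right msmult_mult_right)
  ultimately have "cur \<psi> t = (\<Sum>x\<in>range d. msmult (\<psi> x) (\<Sum>k<Suc m. msmult (t ^ k / fact k) (?e x ** mpow N k)))"
    by simp
  then show ?thesis
    by (simp add: vec_eq_iff poly_sum poly_monom mult.commute)
qed

text \<open>The value of \<open>f\<close> is a sum of terms
  \<open>\<psi> \<mu> * poly (q \<mu>) t\<close> with the same \<open>q\<close> for all characters.
  For the exponential character the curve runs in the zero set of \<open>f\<close>, so independence
  of exponential polynomials gives q = 0, and then every character gives 0.\<close>

lemma replica: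
  assumes G: "algebraic_group G" and XG: "X \<in> lie G" and "ehom \<psi>" and f: "f \<in> van G"
  shows "f (cur \<psi> t) = 0"
proof -
  have "f \<in> poly_fun" using f by (simp add: van_def)
  from poly_fun_exp_poly[OF this, of "range d" "\<lambda>i j x. \<Sum>k<Suc m.
      Polynomial.monom ((dg P (\<lambda>i. if d i = x then 1 else 0) ** mpow N k) $ i $ j / fact k) k"]
  obtain M q where M: "finite M" and q: "\<And>\<psi> t. ehom \<psi> \<Longrightarrow> f (cur \<psi> t) = (\<Sum>\<mu>\<in>M. \<psi> \<mu> * poly (q \<mu>) t)"
    unfolding cur_entry by auto
  have "(\<Sum>\<mu>\<in>M. exp (\<mu> * t) * poly (q \<mu>) t) = 0" for t
  proof -
    have "f (cur (\<lambda>a. exp (t * a)) t) = 0"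
      using lie_integral_curve[OF G XG _ _ f] is_expD[OF is_exp_cur] by blast
    moreover have "ehom (\<lambda>a. exp (t * a))" using ehom_exp[of "\<lambda>a. a" t] by simp
    ultimately show ?thesis using q[of "\<lambda>a. exp (t * a)" t] by (simp add: mult.commute)
  qed
  then have "q \<mu> = 0" if "\<mu> \<in> M" for \<mu> using exp_poly_independent[OF M] that by blast
  then show ?thesis using q[OF \<open>ehom \<psi>\<close>] by simp
qed

lemma replica_group:
  assumes G: "algebraic_group G" and XG: "X \<in> lie G" and \<psi>: "ehom \<psi>"
  shows "dg P (\<psi> \<circ> d) \<in> G"
proof (rule mem_closedin_zariski)
  have "\<psi> a * \<psi> (- a) = 1" for a using \<psi> unfolding ehom_def by (metis add.right_inverse)
  then have "dg P (\<psi> \<circ> d) ** dg P (\<lambda>i. \<psi> (- d i)) = mat 1" using P by (simp add: dg_mult dg_one)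
  then show "invertible (dg P (\<psi> \<circ> d))" using invertible_right_inverse by blast
  show "f (dg P (\<psi> \<circ> d)) = 0" if "f \<in> van G" for f
    using replica[OF G XG \<psi> that, of 0] by (simp add: cur_def unip_0)
qed (rule algebraic_groupD[OF G])

text \<open>Every additive \<phi> yields the characters exp(s \<phi>(a)), and their replicas have
  derivative \<open>dg P (\<phi> \<circ> d)\<close> at s = 0. This admits functionals with rational
  values.\<close>

lemma replica_lie:
  assumes G: "algebraic_group G" and XG: "X \<in> lie G" and \<phi>: "\<And>a b. \<phi> (a + b) = \<phi> a + \<phi> b"
  shows "dg P (\<phi> \<circ> d) \<in> lie G"
proof (rule lie_curve)
  show "dg P (\<lambda>i. exp (s * \<phi> (d i))) \<in> G" for s
    using replica_group[OF G XG ehom_exp[OF \<phi>], of s] by (simp add: comp_def)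
  have "mderiv (\<lambda>s. dg P (\<lambda>i. exp (s * \<phi> (d i)))) (dg P (\<lambda>i. \<phi> (d i))) 0"
    by (rule mderiv_dg) (auto intro!: derivative_eq_intros)
  then show "mderiv (\<lambda>s. dg P (\<lambda>i. exp (s * \<phi> (d i)))) (dg P (\<phi> \<circ> d)) 0" by (simp add: comp_def)
qed (use P in \<open>simp add: dg_one\<close>)

end

lemma jordan_exists:
  obtains P d N m where "jordan P d N X m"
proof (rule jordan_decomposition[of X])
  fix P d N assume J: "invertible P" "X = dg P d + N" "nilp N"
    "\<And>Y. X ** Y = Y ** X \<Longrightarrow> dg P d ** Y = Y ** dg P d"
  then obtain m where "mpow N m = 0" by (auto simp: nilp_def)
  then have "jordan P d N X m" using J by (simp add: jordan_def)
  then show thesis by (rule that)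
qed

lemma is_exp_exists: obtains \<gamma> where "is_exp X \<gamma>"
proof -
  obtain P d N m where "jordan P d N X m" by (rule jordan_exists)
  then have "is_exp X (\<lambda>t. jordan.cur P d N m (\<lambda>a. exp (t * a)) t)" by (rule jordan.is_exp_cur)
  then show ?thesis by (rule that)
qed

lemma is_exp_in_group:
  assumes G: "algebraic_group G" and "X \<in> lie G" "is_exp X \<gamma>" shows "\<gamma> t \<in> G"
  by (rule mem_closedin_zariski[OF algebraic_groupD(1)[OF G]])
    (use lie_integral_curve[OF G assms(2)] is_expD[OF assms(3)] in blast)+

text \<open>Differentiate \<open>Ad (exp t X) Y\<close> at \<open>t = 0\<close>.\<close>

lemma bracket_stable:
  assumes "is_exp X \<gamma>" and "f \<in> poly_fun" and "\<And>t. dd f g (\<gamma> t ** Y ** matrix_inv (\<gamma> t)) = 0"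
  shows "dd f g (bracket X Y) = 0"
proof -
  note E = is_expD[OF assms(1)]
  have neg: "mderiv (\<lambda>t. \<gamma> (- t)) (- X) 0"
  proof -
    have "((\<lambda>s. \<gamma> (- s) $ i $ j) has_field_derivative X $ i $ j * (- 1)) (at 0)" for i j
      using E(7) by (intro DERIV_chain2[of "\<lambda>s. \<gamma> s $ i $ j" _ uminus])
        (auto simp: mderiv_def intro!: derivative_eq_intros)
    then show ?thesis by (simp add: mderiv_def)
  qed
  have "mderiv (\<lambda>t. \<gamma> t ** Y ** \<gamma> (- t)) (\<gamma> 0 ** Y ** (- X) + (X ** Y) ** \<gamma> (- 0)) 0"
    by (intro mderiv_mult neg mderiv_const_mult E(7))
  then have "mderiv (\<lambda>t. \<gamma> t ** Y ** \<gamma> (- t)) (bracket X Y) 0"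
    by (simp add: E(2) bracket_def matrix_ring_simps)
  then have "((\<lambda>t. \<Sum>i\<in>UNIV. \<Sum>j\<in>UNIV. pd f i j g * (\<gamma> t ** Y ** \<gamma> (- t)) $ i $ j) has_field_derivative
      (\<Sum>i\<in>UNIV. \<Sum>j\<in>UNIV. pd f i j g * bracket X Y $ i $ j)) (at 0)"
    by (intro DERIV_sum DERIV_cmult) (simp add: mderiv_def)
  then have "((\<lambda>t. dd f g (\<gamma> t ** Y ** matrix_inv (\<gamma> t))) has_field_derivative dd f g (bracket X Y)) (at 0)"
    by (simp add: dd_sum(1)[OF assms(2)] E(5))
  then have "((\<lambda>t. 0) has_field_derivative dd f g (bracket X Y)) (at (0::complex))"
    by (simp add: assms(3))
  then show ?thesis using DERIV_unique DERIV_const by blast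
qed

lemma lie_bracket:
  assumes G: "algebraic_group G" and "X \<in> lie G" "Y \<in> lie G" shows "bracket X Y \<in> lie G"
  unfolding lie_iff
proof
  fix f assume f: "f \<in> van G"
  obtain \<gamma> where \<gamma>: "is_exp X \<gamma>" using is_exp_exists .
  have "\<gamma> t ** Y ** matrix_inv (\<gamma> t) \<in> lie G" for t
    by (intro lie_conj[OF G] is_exp_in_group[OF G assms(2) \<gamma>] assms(3))
  then show "dd f (mat 1) (bracket X Y) = 0"
    using f by (intro bracket_stable[OF \<gamma>]) (auto simp: van_def lie_iff)
qed

section \<open>Groups generated by connected sets\<close>

lemma continuous_map_zariski_translate:
  assumes "invertible g" shows "continuous_map zariski zariski (\<lambda>h. g ** h)"
proof -
  have "openin zariski ((\<lambda>h. g ** h) -` {h. invertible h \<and> f h \<noteq> 0} \<inter> topspace zariski)"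
    if "f \<in> poly_fun" for f
  proof -
    have "(\<lambda>h. g ** h) -` {h. invertible h \<and> f h \<noteq> 0} \<inter> topspace zariski = {h. invertible h \<and> f (g ** h) \<noteq> 0}"
      using assms by (auto intro: invertible_mult)
    moreover have "(\<lambda>h. f (g ** h)) \<in> poly_fun"
      using that by (intro pmap_compose[of f "\<lambda>h. g ** h"] pmap_mult) auto
    ultimately show ?thesis using openin_zariski_basic[of "\<lambda>h. f (g ** h)"] by (simp only:)
  qed
  moreover have "(\<lambda>h. g ** h) ` topspace zariski \<subseteq> topspace zariski"
    using assms by (auto intro: invertible_mult)
  ultimately have "continuous_map zariski (topology_generated_by {{g. invertible g \<and> f g \<noteq> 0} |f. f \<in> poly_fun}) (\<lambda>h. g ** h)"
    by (intro continuous_on_generated_topo) (auto simp: zariski_def simp del: topspace_zariski)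
  then show ?thesis by (simp add: zariski_def)
qed

text \<open>Connectedness is by induction on words: if D joins 1 to \<open>u\<close> and C joins 1
  to the rest of the word, then D and u C meet in \<open>u\<close> and their union joins 1 to the
  whole word.\<close>

lemma words_group:
  fixes U :: "(complex^'n^'n) set"
  assumes inv: "\<And>u. u \<in> U \<Longrightarrow> invertible u" "\<And>u. u \<in> U \<Longrightarrow> matrix_inv u \<in> U"
    and con: "\<And>u. u \<in> U \<Longrightarrow> \<exists>C. C \<subseteq> U \<and> connectedin zariski C \<and> mat 1 \<in> C \<and> u \<in> C"
  defines "W \<equiv> {wprod us |us. set us \<subseteq> U}"
  shows "subgroup W GL" "connectedin zariski W" "U \<subseteq> W"
proof -
  have one: "invertible (mat 1 :: complex^'n^'n)" by (auto simp: invertible_def)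
  have winv: "invertible (wprod us) \<and> matrix_inv (wprod us) \<in> W" if "set us \<subseteq> U" for us
    using that
  proof (induction us)
    case Nil
    have "matrix_inv (mat 1 :: complex^'n^'n) = mat 1" by (rule matrix_inv_unique) simp
    then show ?case using one by (auto simp: W_def intro!: exI[of _ "[]"])
  next
    case (Cons u us)
    then have u: "u \<in> U" "invertible u" "invertible (wprod us)" "matrix_inv (wprod us) \<in> W" using inv by auto
    have "u ** wprod us ** (matrix_inv (wprod us) ** matrix_inv u) = u ** (wprod us ** matrix_inv (wprod us)) ** matrix_inv u"
      by (simp add: matrix_mul_assoc)
    then have "matrix_inv (u ** wprod us) = matrix_inv (wprod us) ** matrix_inv u"
      using u by (intro matrix_inv_unique) (simp add: matrix_inv_right)
    moreover obtain vs where "set vs \<subseteq> U" "matrix_inv (wprod us) = wprod vs" using u by (auto simp: W_def)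
    ultimately have "matrix_inv (wprod (u # us)) = wprod (vs @ [matrix_inv u])" "set (vs @ [matrix_inv u]) \<subseteq> U"
      using inv(2)[OF u(1)] by (simp_all add: wprod_append)
    then have "matrix_inv (wprod (u # us)) \<in> W" unfolding W_def by blast
    then show ?case using u by (simp add: invertible_mult)
  qed
  show sub: "subgroup W GL"
    unfolding subgroup_GL_iff
  proof (intro conjI ballI)
    show "mat 1 \<in> W" by (auto simp: W_def intro!: exI[of _ "[]"])
    show "g ** h \<in> W" if "g \<in> W" "h \<in> W" for g h
      using that unfolding W_def by (auto simp: wprod_append[symmetric]) (metis Un_subset_iff set_append)
  qed (use winv in \<open>auto simp: W_def\<close>)
  show UW: "U \<subseteq> W"
  proof
    fix u assume "u \<in> U" then show "u \<in> W" unfolding W_def by (intro CollectI exI[of _ "[u]"]) simp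
  qed
  have "\<exists>C\<subseteq>W. connectedin zariski C \<and> mat 1 \<in> C \<and> wprod us \<in> C" if "set us \<subseteq> U" for us
    using that
  proof (induction us)
    case Nil
    have "mat 1 \<in> W" by (auto simp: W_def intro!: exI[of _ "[]"])
    then show ?case using one by (intro exI[of _ "{mat 1}"]) (simp add: connectedin_sing)
  next
    case (Cons u us)
    then obtain C where C: "C \<subseteq> W" "connectedin zariski C" "mat 1 \<in> C" "wprod us \<in> C" by auto
    obtain D where D: "D \<subseteq> U" "connectedin zariski D" "mat 1 \<in> D" "u \<in> D" using con[of u] Cons.prems by auto
    have u: "u \<in> U" "invertible u" using Cons.prems inv by auto
    have "connectedin zariski ((\<lambda>h. u ** h) ` C)"
      using continuous_map_zariski_translate[OF u(2)] C(2) by (rule connectedin_continuous_map_image)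
    moreover have "u \<in> (\<lambda>h. u ** h) ` C" using C(3) by force
    ultimately have "connectedin zariski (D \<union> (\<lambda>h. u ** h) ` C)"
      using D by (intro connectedin_Un) auto
    moreover have "(\<lambda>h. u ** h) ` C \<subseteq> W"
      using sub UW u C(1) unfolding subgroup_GL_iff by blast
    ultimately show ?case using D UW C by (intro exI[of _ "D \<union> (\<lambda>h. u ** h) ` C"]) auto
  qed
  then have ex: "\<exists>C\<subseteq>W. connectedin zariski C \<and> mat 1 \<in> C \<and> g \<in> C" if "g \<in> W" for g
    using that unfolding W_def by blast
  have "connectedin zariski (\<Union>{C. C \<subseteq> W \<and> connectedin zariski C \<and> mat 1 \<in> C})"
    by (intro connectedin_Union) auto
  moreover have "\<Union>{C. C \<subseteq> W \<and> connectedin zariski C \<and> mat 1 \<in> C} = W" using ex by blast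
  ultimately show "connectedin zariski W" by simp
qed

lemma words_commute:
  assumes "\<And>u v. u \<in> U \<Longrightarrow> v \<in> U \<Longrightarrow> u ** v = v ** u" "set us \<subseteq> U" "set vs \<subseteq> U"
  shows "wprod us ** wprod vs = wprod vs ** wprod us"
proof -
  have 1: "u ** wprod vs = wprod vs ** u" if "u \<in> U" for u
    using assms(3) that
  proof (induction vs)
    case (Cons v vs)
    then have "u ** v = v ** u" "u ** wprod vs = wprod vs ** u" using assms(1) by auto
    then show ?case by (metis matrix_mul_assoc wprod_simps(2))
  qed simp
  show ?thesis using assms(2)
  proof (induction us)
    case (Cons u us)
    then have "u ** wprod vs = wprod vs ** u" "wprod us ** wprod vs = wprod vs ** wprod us" using 1 by auto
    then show ?case by (metis matrix_mul_assoc wprod_simps(2))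
  qed simp
qed

section \<open>Characters of tori\<close>

text \<open>Dedekind's elimination: the relation at the product of t and s, minus \<kappa>(t) times
  the relation at s, no longer contains \<kappa>. Set and operation are parameters since the group
  in question is a subset of the matrices.\<close>

lemma dedekind_independence:
  fixes \<Phi> :: "('b \<Rightarrow> complex) set" and op :: "'b \<Rightarrow> 'b \<Rightarrow> 'b"
  assumes "finite \<Phi>" and cl: "\<And>s t. s \<in> S \<Longrightarrow> t \<in> S \<Longrightarrow> op s t \<in> S"
    and mul: "\<And>\<phi> s t. \<phi> \<in> \<Phi> \<Longrightarrow> s \<in> S \<Longrightarrow> t \<in> S \<Longrightarrow> \<phi> (op s t) = \<phi> s * \<phi> t"
    and ne: "\<And>\<phi>. \<phi> \<in> \<Phi> \<Longrightarrow> \<exists>s\<in>S. \<phi> s \<noteq> 0"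
    and dist: "\<And>\<phi> \<kappa>. \<phi> \<in> \<Phi> \<Longrightarrow> \<kappa> \<in> \<Phi> \<Longrightarrow> \<forall>s\<in>S. \<phi> s = \<kappa> s \<Longrightarrow> \<phi> = \<kappa>"
    and "\<And>s. s \<in> S \<Longrightarrow> (\<Sum>\<phi>\<in>\<Phi>. b \<phi> * \<phi> s) = 0" and "\<phi> \<in> \<Phi>"
  shows "b \<phi> = 0"
  using assms
proof (induction \<Phi> arbitrary: b \<phi> rule: finite_induct)
  case (insert \<kappa> \<Phi>)
  note cl = insert.prems(1) and mul = insert.prems(2) and ne = insert.prems(3) and dist = insert.prems(4)
  have b0: "b \<phi> = 0" if \<phi>: "\<phi> \<in> \<Phi>" for \<phi>
  proof -
    obtain t where t: "t \<in> S" "\<phi> t \<noteq> \<kappa> t" using dist[of \<phi> \<kappa>] \<phi> insert.hyps by auto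
    have "(\<Sum>\<phi>\<in>\<Phi>. (b \<phi> * (\<phi> t - \<kappa> t)) * \<phi> s) = 0" if s: "s \<in> S" for s
    proof -
      have 1: "(\<Sum>\<phi>\<in>insert \<kappa> \<Phi>. b \<phi> * (\<phi> t * \<phi> s)) = 0"
        using insert.prems(5)[OF cl[OF t(1) s]] mul[OF _ t(1) s] by simp
      have 2: "(\<Sum>\<phi>\<in>insert \<kappa> \<Phi>. b \<phi> * (\<kappa> t * \<phi> s)) = 0"
        using insert.prems(5)[OF s] by (simp add: sum_distrib_left[symmetric] mult.left_commute)
      have "(\<Sum>\<phi>\<in>insert \<kappa> \<Phi>. b \<phi> * (\<phi> t * \<phi> s) - b \<phi> * (\<kappa> t * \<phi> s)) = 0"
        unfolding sum_subtractf 1 2 by simp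
      then show ?thesis using insert.hyps by (simp add: algebra_simps)
    qed
    then have "b \<phi> * (\<phi> t - \<kappa> t) = 0"
      using insert.IH[of "\<lambda>\<phi>. b \<phi> * (\<phi> t - \<kappa> t)" \<phi>] cl mul ne dist \<phi> by blast
    then show ?thesis using t by simp
  qed
  obtain s where s: "s \<in> S" "\<kappa> s \<noteq> 0" using ne by blast
  have "b \<kappa> * \<kappa> s = 0" using insert.prems(5)[OF s(1)] insert.hyps b0 by simp
  then show ?case using s b0 insert.prems(6) by auto
qed simp

lemma dd_entry: "dd (\<lambda>g. (B ** g ** C) $ i $ j) h X = (B ** X ** C) $ i $ j" for B C :: "complex^'n^'n"
proof -
  have "(\<lambda>g. g $ i $ j) \<in> poly_fun" by (rule poly_fun.entry)
  from dd_translate[OF this, of B C h X] show ?thesis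
    using dd_unique[OF \<open>(\<lambda>g. g $ i $ j) \<in> poly_fun\<close> mderiv_line, of "B ** h ** C" "B ** X ** C" 0]
    by (simp add: dd_def) (auto intro!: DERIV_imp_deriv derivative_eq_intros)
qed

section \<open>Diagonal tori and monomials\<close>

lemma poly_fun_cj: "(\<lambda>g. cj P g $ i $ j) \<in> poly_fun"
  unfolding cj_def by (intro pmap_entry pmap_mult pmap_const pmap_id)

lemma cj_diag_imp_dg:
  assumes "invertible P" "\<And>i j. i \<noteq> j \<Longrightarrow> cj P g $ i $ j = 0"
  shows "g = dg P (\<lambda>i. cj P g $ i $ i)"
proof -
  have "cj P g = diagm (\<lambda>i. cj P g $ i $ i)" using assms(2) by (auto simp: vec_eq_iff diagm_nth)
  then show ?thesis using assms(1) by (metis cj_dg cj_eq_iff)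
qed

lemma cj_dg_nth: "invertible P \<Longrightarrow> cj P (dg P d) $ i $ j = (if i = j then d i else 0)"
  by (simp add: diagm_nth)

locale diag_torus =
  fixes A :: "(complex^'n^'n) set" and P :: "complex^'n^'n"
  assumes conA: "connected_algebraic_group A" and P: "invertible P"
    and diag: "\<And>t i j. t \<in> A \<Longrightarrow> i \<noteq> j \<Longrightarrow> cj P t $ i $ j = 0"
begin

lemma algA: "algebraic_group A"
  using conA by (simp add: connected_algebraic_group_def)

definition ev :: "complex^'n^'n \<Rightarrow> 'n \<Rightarrow> complex" where
  "ev X i = cj P X $ i $ i"

lemma A_dg: "t \<in> A \<Longrightarrow> t = dg P (ev t)"
  unfolding ev_def using cj_diag_imp_dg[OF P] diag by blast

lemma lieA_dg: "H \<in> lie A \<Longrightarrow> H = dg P (ev H)"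
proof -
  assume H: "H \<in> lie A"
  have "cj P H $ i $ j = 0" if "i \<noteq> j" for i j
  proof -
    have "(\<lambda>g. cj P g $ i $ j) \<in> van A" using diag that poly_fun_cj by (auto simp: van_def)
    then have "dd (\<lambda>g. cj P g $ i $ j) (mat 1) H = 0" using H unfolding lie_iff by blast
    then show ?thesis by (simp add: cj_def dd_entry)
  qed
  then show ?thesis unfolding ev_def using cj_diag_imp_dg[OF P] by blast
qed

lemma ev_dg [simp]: "ev (dg P d) = d"
  by (simp add: ev_def fun_eq_iff diagm_nth P)

lemma ev_mult: "s \<in> A \<Longrightarrow> t \<in> A \<Longrightarrow> ev (s ** t) i = ev s i * ev t i"
  using A_dg[of s] A_dg[of t] dg_mult[OF P, of "ev s" "ev t"] by (metis ev_dg)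

lemma ev_one: "ev (mat 1) i = 1"
  using dg_one[OF P] ev_dg by metis

lemma ev_nonzero: "t \<in> A \<Longrightarrow> ev t i \<noteq> 0"
proof -
  assume t: "t \<in> A"
  then have "matrix_inv t \<in> A" "t ** matrix_inv t = mat 1"
    using algebraic_groupD[OF algA] matrix_inv_right by blast+
  then have "ev t i * ev (matrix_inv t) i = 1" using t by (metis ev_mult ev_one)
  then show ?thesis by auto
qed

definition mono :: "('n \<Rightarrow> nat) \<Rightarrow> ('n \<Rightarrow> complex) \<Rightarrow> complex" where
  "mono m x = (\<Prod>i\<in>UNIV. x i ^ m i)"

lemma mono_add: "mono (m + k) x = mono m x * mono k x"
  by (simp add: mono_def power_add prod.distrib)

lemma mono_zero: "mono 0 x = 1"
  by (simp add: mono_def)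

lemma mono_exp: "mono m (\<lambda>i. exp (s * h i)) = exp (s * (\<Sum>i\<in>UNIV. of_nat (m i) * h i))"
  by (simp add: mono_def exp_sum sum_distrib_left exp_of_nat_mult[symmetric] mult_ac)

lemma mono_ev_mult: "s \<in> A \<Longrightarrow> t \<in> A \<Longrightarrow> mono m (ev (s ** t)) = mono m (ev s) * mono m (ev t)"
  by (simp add: mono_def ev_mult power_mult_distrib prod.distrib)

lemma mono_ev_nonzero: "t \<in> A \<Longrightarrow> mono m (ev t) \<noteq> 0"
  by (simp add: mono_def ev_nonzero)

definition eqv :: "('n \<Rightarrow> nat) \<Rightarrow> ('n \<Rightarrow> nat) \<Rightarrow> bool" where
  "eqv m k \<longleftrightarrow> (\<forall>t\<in>A. mono m (ev t) = mono k (ev t))"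

text \<open>Reuses \<open>poly_fun_exp_poly\<close> with exponent vectors in place of eigenvalues:
  \<open>\<lambda>m. mono m x\<close> is a character of the monoid of exponents, and the polynomial
  variable is set to 0.\<close>

lemma poly_fun_dg:
  assumes "f \<in> poly_fun"
  shows "\<exists>M c. finite M \<and> (\<forall>x. f (dg P x) = (\<Sum>\<mu>\<in>M. c \<mu> * mono \<mu> x))"
proof -
  \<comment> \<open>Unit exponent vectors: \<open>mono (e i) x\<close> is the coordinate
    \<open>x i\<close>.\<close>
  define e where "e = (\<lambda>i j :: 'n. if i = j then 1 else 0 :: nat)"
  have inj: "inj e" by (auto simp: inj_def e_def fun_eq_iff split: if_splits)
  define C :: "'n \<Rightarrow> 'n \<Rightarrow> ('n \<Rightarrow> nat) \<Rightarrow> complex poly"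
    where "C = (\<lambda>a b u. [:P $ a $ (the_inv e u) * matrix_inv P $ (the_inv e u) $ b:])"
  have ent: "dg P x = (\<chi> a b. \<Sum>u\<in>range e. mono u x * poly (C a b u) 0)" for x
  proof -
    have mono_e: "mono (e i) x = x i" for i
    proof -
      have "x j ^ e i j = (if j = i then x i else 1)" for j by (simp add: e_def)
      then show ?thesis by (simp add: mono_def)
    qed
    have "dg P x $ a $ b = (\<Sum>i\<in>UNIV. x i * (P $ a $ i * matrix_inv P $ i $ b))" for a b
    proof -
      have "dg P x $ a $ b = (\<Sum>i\<in>UNIV. (P ** diagm x) $ a $ i * matrix_inv P $ i $ b)"
        by (simp add: dg_def uncj_def matrix_matrix_mult_def[of _ "matrix_inv P"])
      then show ?thesis by (simp add: mult_ac)
    qed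
    then show ?thesis using inj
      by (simp add: vec_eq_iff sum.reindex C_def mono_e the_inv_f_f)
  qed
  obtain M q where M: "finite M" "\<And>\<psi> t. ehom \<psi> \<Longrightarrow>
     f (\<chi> i j. \<Sum>x\<in>range e. \<psi> x * poly (C i j x) t) = (\<Sum>\<mu>\<in>M. \<psi> \<mu> * poly (q \<mu>) t)"
    using poly_fun_exp_poly[OF assms, of "range e" C] by auto
  have "f (dg P x) = (\<Sum>\<mu>\<in>M. poly (q \<mu>) 0 * mono \<mu> x)" for x
    unfolding ent using M(2)[of "\<lambda>m. mono m x" 0] by (simp add: ehom_def mono_add mono_zero mult.commute)
  then show ?thesis using M(1) by (intro exI[of _ M] exI[of _ "\<lambda>\<mu>. poly (q \<mu>) 0"]) simp
qed

text \<open>\<open>A\<close> is cut out by equalities of monomials, because distinct characters are linearly independent.\<close>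

lemma compatible_in_A:
  assumes h: "\<And>m k. eqv m k \<Longrightarrow> mono m x = mono k x" and nz: "\<And>i. x i \<noteq> 0"
  shows "dg P x \<in> A"
proof (rule mem_closedin_zariski[OF algebraic_groupD(1)[OF algA]])
  have "dg P x ** dg P (\<lambda>i. inverse (x i)) = mat 1"
    using nz by (simp add: dg_mult[OF P] dg_one[OF P])
  then show "invertible (dg P x)" using invertible_right_inverse by blast
  fix f assume f: "f \<in> van A"
  then have "f \<in> poly_fun" by (simp add: van_def)
  then obtain M c where M: "finite M" and c: "\<And>x. f (dg P x) = (\<Sum>\<mu>\<in>M. c \<mu> * mono \<mu> x)"
    using poly_fun_dg by blast
  \<comment> \<open>Extension by 0 outside \<open>A\<close> makes two restricted monomials equal as
    functions exactly when they agree on \<open>A\<close>.\<close>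
  define res where "res = (\<lambda>m t. if t \<in> A then mono m (ev t) else 0)"
  \<comment> \<open>Coefficients of monomials that restrict to the same character are added up; only
    these sums are forced to vanish.\<close>
  define b where "b = (\<lambda>\<phi>. \<Sum>\<mu> | \<mu> \<in> M \<and> res \<mu> = \<phi>. c \<mu>)"
  have res_eq: "res m = res k \<longleftrightarrow> eqv m k" for m k
    by (auto simp: res_def eqv_def fun_eq_iff)
  have bsum: "(\<Sum>\<phi>\<in>res ` M. b \<phi> * \<phi> t) = 0" if t: "t \<in> A" for t
  proof -
    have "0 = f (dg P (ev t))" using f t A_dg by (simp add: van_def)
    also have "\<dots> = (\<Sum>\<mu>\<in>M. c \<mu> * res \<mu> t)" using t by (simp add: c res_def)
    also have "\<dots> = (\<Sum>\<phi>\<in>res ` M. \<Sum>\<mu> | \<mu> \<in> M \<and> res \<mu> = \<phi>. c \<mu> * res \<mu> t)"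
      by (rule sum.image_gen[OF M])
    also have "\<dots> = (\<Sum>\<phi>\<in>res ` M. b \<phi> * \<phi> t)"
      unfolding b_def sum_distrib_right by (intro sum.cong refl) auto
    finally show ?thesis by simp
  qed
  have b0: "b \<phi> = 0" if "\<phi> \<in> res ` M" for \<phi>
  proof (rule dedekind_independence[where S=A and op="(**)" and \<Phi>="res ` M" and b=b, OF finite_imageI[OF M]])
    show "s ** t \<in> A" if "s \<in> A" "t \<in> A" for s t using algebraic_groupD(4)[OF algA] that by blast
    show "\<phi> (s ** t) = \<phi> s * \<phi> t" if "\<phi> \<in> res ` M" "s \<in> A" "t \<in> A" for \<phi> s t
      using that algebraic_groupD(4)[OF algA] by (auto simp: res_def mono_ev_mult)
    show "\<exists>s\<in>A. \<phi> s \<noteq> 0" if "\<phi> \<in> res ` M" for \<phi>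
      using that algebraic_groupD(3)[OF algA] mono_ev_nonzero by (auto simp: res_def)
    show "\<phi> = \<kappa>" if "\<phi> \<in> res ` M" "\<kappa> \<in> res ` M" "\<forall>s\<in>A. \<phi> s = \<kappa> s" for \<phi> \<kappa>
      using that by (auto simp: res_def fun_eq_iff)
  qed (use that bsum in auto)
  have "f (dg P x) = (\<Sum>\<phi>\<in>res ` M. \<Sum>\<mu> | \<mu> \<in> M \<and> res \<mu> = \<phi>. c \<mu> * mono \<mu> x)"
    unfolding c by (rule sum.image_gen[OF M])
  also have "\<dots> = 0"
  proof (rule sum.neutral, rule ballI)
    fix \<phi> assume \<phi>: "\<phi> \<in> res ` M"
    then obtain \<nu> where \<nu>: "\<nu> \<in> M" "\<phi> = res \<nu>" by blast
    have "(\<Sum>\<mu> | \<mu> \<in> M \<and> res \<mu> = \<phi>. c \<mu> * mono \<mu> x) = b \<phi> * mono \<nu> x"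
      unfolding b_def sum_distrib_right using \<nu> by (intro sum.cong refl) (auto simp: res_eq dest: h)
    then show "(\<Sum>\<mu> | \<mu> \<in> M \<and> res \<mu> = \<phi>. c \<mu> * mono \<mu> x) = 0" using b0[OF \<phi>] by simp
  qed
  finally show "f (dg P x) = 0" .
qed

text \<open>The curve exp(s h) satisfies every monomial relation of \<open>A\<close> as soon as
  \<open>h\<close> satisfies the linearized ones.\<close>

lemma compatible_in_lieA:
  assumes "\<And>m k. eqv m k \<Longrightarrow> (\<Sum>i\<in>UNIV. of_nat (m i) * h i) = (\<Sum>i\<in>UNIV. of_nat (k i) * h i)"
  shows "dg P h \<in> lie A"
proof (rule lie_curve)
  show "dg P (\<lambda>i. exp (s * h i)) \<in> A" for s
    using assms by (intro compatible_in_A) (simp_all add: mono_exp)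
  show "mderiv (\<lambda>s. dg P (\<lambda>i. exp (s * h i))) (dg P h) 0"
    by (rule mderiv_dg) (auto intro!: derivative_eq_intros)
qed (simp add: dg_one[OF P])

lemma eqv_add: "eqv m k \<Longrightarrow> eqv m' k' \<Longrightarrow> eqv (m + m') (k + k')"
  by (simp add: eqv_def mono_add)

lemma eqv_sym: "eqv m k \<Longrightarrow> eqv k m"
  by (simp add: eqv_def)

lemma eqv_refl: "eqv m m"
  by (simp add: eqv_def)

text \<open>Exponent vectors of the Laurent monomials that are trivial on \<open>A\<close>, placed
  in a rational vector space, where a vector of the span has a positive multiple that is a
  relation.\<close>

definition rel :: "(rat^'n) set" where
  "rel = {(\<chi> i. of_nat (m i) - of_nat (k i)) |m k. eqv m k}"

lemma rel_zero: "0 \<in> rel"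
  unfolding rel_def by (intro CollectI exI[of _ "0"] exI[of _ "0"]) (simp add: eqv_refl vec_eq_iff)

lemma rel_add: "a \<in> rel \<Longrightarrow> b \<in> rel \<Longrightarrow> a + b \<in> rel"
proof -
  assume "a \<in> rel" "b \<in> rel"
  then obtain m k m' k' where *: "eqv m k" "eqv m' k'" "a = (\<chi> i. of_nat (m i) - of_nat (k i))"
    "b = (\<chi> i. of_nat (m' i) - of_nat (k' i))" unfolding rel_def by blast
  have "a + b = (\<chi> i. of_nat ((m + m') i) - of_nat ((k + k') i))" by (simp add: * vec_eq_iff)
  then show ?thesis using eqv_add[OF *(1,2)] unfolding rel_def by blast
qed

lemma rel_minus: "a \<in> rel \<Longrightarrow> - a \<in> rel"
proof -
  assume "a \<in> rel"
  then obtain m k where *: "eqv m k" "a = (\<chi> i. of_nat (m i) - of_nat (k i))" unfolding rel_def by blast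
  have "- a = (\<chi> i. of_nat (k i) - of_nat (m i))" by (simp add: * vec_eq_iff)
  then show ?thesis using eqv_sym[OF *(1)] unfolding rel_def by blast
qed

lemma rel_nat: "a \<in> rel \<Longrightarrow> of_nat n *s a \<in> rel"
  by (induction n) (simp_all add: rel_zero rel_add vec.scale_left_distrib)

lemma rel_int: "a \<in> rel \<Longrightarrow> of_int n *s a \<in> rel"
  by (cases n rule: int_cases2) (use rel_nat rel_minus in \<open>auto simp: vec.scale_minus_left\<close>)

lemma span_rel:
  assumes "w \<in> vec.span rel" obtains k :: nat where "k > 0" "of_nat k *s w \<in> rel"
proof -
  have "\<exists>k::nat. k > 0 \<and> of_nat k *s w \<in> rel"
    using assms
  proof (induction rule: vec.span_induct_alt)
    case base
    show ?case by (intro exI[of _ 1]) (simp add: rel_zero)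
  next
    case (step c x y)
    then obtain k :: nat where k: "k > 0" "of_nat k *s y \<in> rel" by blast
    \<comment> \<open>With c = a / b, the multiplier k b clears both denominators.\<close>
    obtain a b where ab: "quotient_of c = (a, b)" by (cases "quotient_of c")
    have b: "b > 0" "c = of_int a / of_int b" using quotient_of_denom_pos[OF ab] quotient_of_div[OF ab] by auto
    have "of_int (a * int k) *s x + of_int b *s (of_nat k *s y) \<in> rel"
      by (intro rel_add rel_int step k)
    moreover have "of_int (a * int k) *s x + of_int b *s (of_nat k *s y) = of_nat (k * nat b) *s (c *s x + y)"
      using b by (simp add: vec_eq_iff field_simps)
    ultimately show ?case using k b by (intro exI[of _ "k * nat b"]) auto
  qed
  then show ?thesis using that by blast
qed

text \<open>If \<open>e\<^sub>i - e\<^sub>j\<close> is not a rational combination of the relations, a rational functional separates it from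
  them and yields an element of \<open>lie A\<close>; otherwise \<open>ev _ i / ev _ j\<close> has finite order, and \<open>A\<close> is connected.\<close>

lemma char_eq:
  assumes eq: "\<And>H. H \<in> lie A \<Longrightarrow> ev H i = ev H j" and t: "t \<in> A"
  shows "ev t i = ev t j"
proof -
  define v :: "rat^'n" where "v = axis i 1 - axis j 1"
  have "v \<in> vec.span rel"
  proof (rule ccontr)
    assume v: "v \<notin> vec.span rel"
    obtain B where B: "B \<subseteq> rel" "vec.independent B" "rel \<subseteq> vec.span B"
      using vec.maximal_independent_subset by blast
    have spB: "vec.span B = vec.span rel"
      using B by (metis vec.span_mono vec.span_span subset_antisym)
    then have ind: "vec.independent (insert v B)" using B(2) v by (simp add: vec.independent_insert)
    \<comment> \<open>The separating functional is coordinate \<open>i\<close> of an endomorphism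
      that sends \<open>v\<close> to \<open>axis i 1\<close> and a basis of the relations to
      0.\<close>
    obtain g :: "rat^'n \<Rightarrow> rat^'n" where g: "Vector_Spaces.linear (*s) (*s) g"
      "\<And>x. x \<in> insert v B \<Longrightarrow> g x = (if x = v then axis i 1 else 0)"
      using vec.linear_independent_extend[OF ind, of "\<lambda>x. if x = v then axis i 1 else 0"] by blast
    define h where "h = (\<lambda>k. g (axis k 1) $ i)"
    have gx: "g x $ i = (\<Sum>k\<in>UNIV. x $ k * h k)" for x
      using linear_componentwise[OF g(1), of x i] by (simp add: h_def)
    have "v \<notin> B" using v spB vec.span_base by blast
    then have "g x = 0" if "x \<in> B" for x using g(2) that by auto
    then have "g x = 0" if "x \<in> vec.span B" for x
      using that g(1) by (metis vec.linear_eq_0_on_span)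
    then have g0: "g x = 0" if "x \<in> rel" for x using that B by blast
    have "dg P (\<lambda>k. of_rat (h k)) \<in> lie A"
    proof (rule compatible_in_lieA)
      fix m k assume "eqv m k"
      then have "(\<chi> l. of_nat (m l) - of_nat (k l)) \<in> rel" unfolding rel_def by blast
      then have "(\<Sum>l\<in>UNIV. (of_nat (m l) - of_nat (k l)) * h l) = 0"
        using g0 gx[of "\<chi> l. of_nat (m l) - of_nat (k l)"] by simp
      then have "(\<Sum>l\<in>UNIV. of_nat (m l) * h l) = (\<Sum>l\<in>UNIV. of_nat (k l) * h l)"
        by (simp add: left_diff_distrib sum_subtractf)
      then have "of_rat (\<Sum>l\<in>UNIV. of_nat (m l) * h l) = (of_rat (\<Sum>l\<in>UNIV. of_nat (k l) * h l) :: complex)"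
        by simp
      then show "(\<Sum>l\<in>UNIV. of_nat (m l) * of_rat (h l)) = (\<Sum>l\<in>UNIV. of_nat (k l) * (of_rat (h l) :: complex))"
        by (simp add: of_rat_sum of_rat_mult)
    qed
    then have "h i = h j" using eq by (metis ev_dg of_rat_eq_iff)
    moreover have "v $ k * h k = (if k = i then h i else 0) - (if k = j then h j else 0)" for k
      by (simp add: v_def axis_def)
    ultimately have "g v $ i = 0" by (simp add: gx sum_subtractf)
    then show False using g(2)[of v] by (simp add: axis_def)
  qed
  then obtain k :: nat where k: "k > 0" "of_nat k *s v \<in> rel" using span_rel by metis
  show ?thesis
  proof (cases "i = j")
    case False
  obtain m l where ml: "eqv m l" "of_nat k *s v = (\<chi> a. of_nat (m a) - of_nat (l a))"
    using k(2) unfolding rel_def by blast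
  \<comment> \<open>Here \<open>e i\<close> is \<open>k\<close> times a unit vector; moving negative
    parts across turns the relation \<open>of_nat k *s v\<close> into an identity of natural
    exponents.\<close>
  define e where "e = (\<lambda>i j :: 'n. if j = i then k else 0)"
  have "m + e j = l + e i"
  proof
    fix a
    have "(of_nat k *s v) $ a = of_nat (m a) - of_nat (l a)" using ml(2) by simp
    then have "(of_nat (m a + e j a) :: rat) = of_nat (l a + e i a)"
      using False by (auto simp: v_def axis_def e_def split: if_splits)
    then show "(m + e j) a = (l + e i) a" by (simp only: of_nat_eq_iff plus_fun_def)
  qed
  moreover have me: "mono (e i) x = x i ^ k" for i x
  proof -
    have "x j ^ e i j = (if j = i then x i ^ k else 1)" for j by (simp add: e_def)
    then show ?thesis by (simp add: mono_def)
  qed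
  ultimately have "mono m (ev t) * ev t j ^ k = mono l (ev t) * ev t i ^ k" for t
    by (metis mono_add)
  then have pw: "ev t i ^ k = ev t j ^ k" if "t \<in> A" for t
    using ml(1) that mono_ev_nonzero[OF that, of l] by (metis eqv_def mult_left_cancel)
  \<comment> \<open>This is the quotient (x^k - y^k) / (x - y) at the two eigenvalues. Its zero set
    and the set x = y cover \<open>A\<close>, and they are disjoint on \<open>A\<close> because
    \<open>s\<close> becomes k x^(k-1) where x = y.\<close>
  define s where "s = (\<lambda>g. \<Sum>a<k. ev g j ^ (k - Suc a) * ev g i ^ a)"
  have pf: "(\<lambda>g. ev g a) \<in> poly_fun" for a unfolding ev_def by (rule poly_fun_cj)
  have "s \<in> poly_fun" unfolding s_def by (intro poly_fun_sum poly_fun.mult poly_fun_power pf)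
  then have cl2: "closedin zariski {g. invertible g \<and> (\<forall>f\<in>{s}. f g = 0)}" by (intro closedin_zeros) simp
  have cl1: "closedin zariski {g. invertible g \<and> (\<forall>f\<in>{\<lambda>g. ev g i - ev g j}. f g = 0)}"
    by (intro closedin_zeros) (simp add: poly_fun_diff pf)
  have split: "(ev t i - ev t j) * s t = 0" if "t \<in> A" for t
    using pw[OF that] power_diff_sumr2[of "ev t i" k "ev t j"] by (simp add: s_def)
  have disj: "s t \<noteq> 0" if "t \<in> A" "ev t i = ev t j" for t
  proof -
    have "s t = (\<Sum>a<k. ev t j ^ (k - 1))"
      unfolding s_def that(2) by (intro sum.cong refl) (auto simp: power_add[symmetric])
    then show ?thesis using k(1) ev_nonzero[OF that(1)] by simp
  qed
  have con: "connectedin zariski A" using conA by (simp add: connected_algebraic_group_def)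
  show ?thesis
  proof (rule ccontr)
    assume "ev t i \<noteq> ev t j"
    then have "s t = 0" using split[OF t] by simp
    let ?E1 = "{g. invertible g \<and> (\<forall>f\<in>{\<lambda>g. ev g i - ev g j}. f g = 0)}"
    let ?E2 = "{g. invertible g \<and> (\<forall>f\<in>{s}. f g = 0)}"
    have "A \<subseteq> ?E1 \<union> ?E2" using split algebraic_groupD(2)[OF algA] by auto
    moreover have "?E1 \<inter> ?E2 \<inter> A = {}" using disj by auto
    moreover have "mat 1 \<in> ?E1 \<inter> A"
      using algebraic_groupD(2,3)[OF algA] by (auto simp: ev_one)
    moreover have "t \<in> ?E2 \<inter> A" using \<open>s t = 0\<close> t algebraic_groupD(2)[OF algA] by auto
    ultimately show False using con cl1 cl2 unfolding connectedin_closedin by blast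
  qed
  qed simp
qed

text \<open>A nonzero entry (i, j) of X in the eigenbasis forces the eigenvalues i and j to agree on
  \<open>lie A\<close>; by \<open>char_eq\<close> they agree on \<open>A\<close> as well.\<close>

lemma centralizer_lieA_commutes:
  assumes "\<And>H. H \<in> lie A \<Longrightarrow> bracket H X = 0" and t: "t \<in> A"
  shows "t ** X = X ** t"
proof -
  have "cj P X $ i $ j = 0 \<or> ev t i = ev t j" for i j
  proof (cases "cj P X $ i $ j = 0")
    case False
    have "ev H i = ev H j" if H: "H \<in> lie A" for H
    proof -
      have "H ** X = X ** H" using assms(1)[OF H] by (simp add: bracket_eq_0_iff)
      then have "diagm (ev H) ** cj P X = cj P X ** diagm (ev H)"
        by (metis P cj_dg cj_mult lieA_dg[OF H])
      then have "ev H i * cj P X $ i $ j = cj P X $ i $ j * ev H j"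
        by (metis diagm_mult_nth mult_diagm_nth)
      then show ?thesis using False by simp
    qed
    then show ?thesis using char_eq[OF _ t] by blast
  qed simp
  then have "ev t i * cj P X $ i $ j = cj P X $ i $ j * ev t j" for i j
    by (metis mult.commute mult_zero_left)
  then have "diagm (ev t) ** cj P X = cj P X ** diagm (ev t)" by (simp add: vec_eq_iff)
  then have "cj P (t ** X) = cj P (X ** t)"
    by (metis P cj_dg cj_mult A_dg[OF t])
  then show ?thesis using P by (simp add: cj_eq_iff)
qed

end

section \<open>Weights of a maximal torus\<close>

lemma sum_mult_vec: "(\<Sum>x\<in>L. E x) *v w = (\<Sum>x\<in>L. E x *v (w :: complex^'n))"
  by (induction L rule: infinite_finite_induct) (simp_all add: matrix_vector_mult_add_rdistrib)

lemma diagm_mult_vec_nth: "(diagm d *v x) $ i = d i * x $ i"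
proof -
  have "(if i = j then d i else 0) * x $ j = (if j = i then d i * x $ i else 0)" for j by simp
  then show ?thesis by (simp add: diagm_def matrix_vector_mult_def)
qed

locale ss_torus = diag_torus A P for A :: "(complex^'n^'n) set" and P +
  fixes G :: "(complex^'n^'n) set"
  assumes ss: "semisimple_group G" and mt: "maximal_torus G A"
begin

lemma algG: "algebraic_group G"
  using ss by (simp add: semisimple_group_def connected_algebraic_group_def)

lemma A_sub_G: "A \<subseteq> G"
  using mt by (simp add: maximal_torus_def)

lemma lieA_sub: "lie A \<subseteq> lie G"
  using A_sub_G by (rule lie_mono)

text \<open>\<open>A\<close> and the one-parameter group have a common eigenbasis, so the closure of
  the group they generate is a torus in \<open>G\<close>. Maximality makes it equal to
  \<open>A\<close>; the curve then runs in \<open>A\<close>, and its tangent vector lies in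
  \<open>lie A\<close>.\<close>

lemma torus_extend:
  assumes Q: "invertible Q" and comm: "\<And>t. t \<in> A \<Longrightarrow> dg Q d ** t = t ** dg Q d"
    and exps: "\<And>s. dg Q (\<lambda>i. exp (s * d i)) \<in> G"
  shows "dg Q d \<in> lie A"
proof -
  define E where "E = (\<lambda>x. dg Q (\<lambda>i. if d i = x then 1 else 0))"
  define \<gamma> where "\<gamma> = (\<lambda>s. dg Q (\<lambda>i. exp (s * d i)))"
  define U where "U = A \<union> range \<gamma>"
  have E_eq: "E x = dg Q ((\<lambda>y. if y = x then 1 else 0) \<circ> d)" for x by (simp add: E_def comp_def)
  have \<gamma>_eq: "\<gamma> s = dg Q ((\<lambda>y. exp (s * y)) \<circ> d)" for s by (simp add: \<gamma>_def comp_def)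
  have EA: "E x ** t = t ** E x" if "t \<in> A" for x t
    unfolding E_eq by (rule dg_commute_comp[OF Q comm[OF that]])
  have \<gamma>A: "\<gamma> s ** t = t ** \<gamma> s" if "t \<in> A" for s t
    unfolding \<gamma>_eq by (rule dg_commute_comp[OF Q comm[OF that]])
  have E1: "(\<Sum>x\<in>range d. E x) = mat 1"
    unfolding E_def dg_sum[symmetric] by (simp add: dg_one[OF Q])
  have \<gamma>E: "\<gamma> s ** E x = msmult (exp (s * x)) (E x)" for s x
  proof -
    have "(\<lambda>i. exp (s * d i) * (if d i = x then 1 else 0)) = (\<lambda>i. exp (s * x) * (if d i = x then 1 else 0))"
      by auto
    then show ?thesis unfolding \<gamma>_def E_def dg_mult[OF Q] by (simp only: dg_scale)
  qed
  have \<gamma>mult: "\<gamma> s ** \<gamma> t = \<gamma> (s + t)" for s t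
    by (simp add: \<gamma>_def dg_mult[OF Q] exp_add[symmetric] distrib_right)
  have \<gamma>0: "\<gamma> 0 = mat 1" by (simp add: \<gamma>_def dg_one[OF Q])
  have \<gamma>inv: "invertible (\<gamma> s)" "matrix_inv (\<gamma> s) = \<gamma> (- s)" for s
    using \<gamma>mult[of s "- s"] \<gamma>0 invertible_right_inverse matrix_inv_unique by fastforce+
  have \<gamma>deriv: "mderiv \<gamma> (dg Q (\<lambda>i. d i * exp (s * d i))) s" for s
    unfolding \<gamma>_def by (rule mderiv_dg) (auto intro!: derivative_eq_intros)
  \<comment> \<open>The spectral projections \<open>E x\<close> commute with \<open>A\<close>, so
    they map the eigenvectors \<open>P *v axis j 1\<close> of \<open>A\<close> to common
    eigenvectors or to 0.\<close>
  define V where "V = {E x *v (P *v axis j 1) |x j. x \<in> range d}"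
  have "w \<in> vec.span V" for w
  proof -
    have w: "w = (\<Sum>j\<in>UNIV. (matrix_inv P *v w) $ j *s (P *v axis j 1))"
    proof -
      have "w = P *v (matrix_inv P *v w)" by (simp add: matrix_vector_mul_assoc matrix_inv_right P)
      also have "\<dots> = P *v (\<Sum>j\<in>UNIV. (matrix_inv P *v w) $ j *s axis j 1)" by (simp only: basis_expansion)
      finally show ?thesis by (simp only: vec.sum vec.scale)
    qed
    have "w = (\<Sum>x\<in>range d. E x) *v w" by (simp add: E1)
    also have "\<dots> = (\<Sum>x\<in>range d. E x *v w)"
      by (rule sum_mult_vec)
    also have "\<dots> = (\<Sum>x\<in>range d. \<Sum>j\<in>UNIV. (matrix_inv P *v w) $ j *s (E x *v (P *v axis j 1)))"
      by (subst (1) w) (simp only: vec.sum vec.scale)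
    also have "\<dots> \<in> vec.span V"
      by (intro vec.span_sum vec.span_scale vec.span_base) (auto simp: V_def)
    finally show ?thesis .
  qed
  then have "vec.span V = UNIV" by auto
  moreover have "\<exists>c. u *v v = c *s v" if u: "u \<in> U" and v: "v \<in> V" for u v
  proof -
    obtain x j where xj: "v = E x *v (P *v axis j 1)" using v unfolding V_def by blast
    show ?thesis
    proof (cases "u \<in> A")
      case True
      have "u ** P = P ** diagm (ev u)"
      proof -
        have "u ** P = dg P (ev u) ** P" using A_dg[OF True] by simp
        also have "\<dots> = P ** diagm (ev u) ** (matrix_inv P ** P)"
          by (simp add: dg_def uncj_def matrix_mul_assoc)
        finally show ?thesis by (simp add: matrix_inv_left P)
      qed
      then have "u *v (P *v axis j 1) = P *v (diagm (ev u) *v axis j 1)"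
        by (simp add: matrix_vector_mul_assoc)
      also have "diagm (ev u) *v axis j 1 = ev u j *s axis j 1"
      proof -
        have "(diagm (ev u) *v axis j 1) $ i = (ev u j *s axis j 1) $ i" for i
          unfolding diagm_mult_vec_nth by (simp add: axis_def)
        then show ?thesis by (simp add: vec_eq_iff)
      qed
      finally have "u *v (P *v axis j 1) = ev u j *s (P *v axis j 1)" by (simp only: vec.scale)
      then have "u *v v = ev u j *s v"
        using EA[OF True, of x] unfolding xj
        by (metis matrix_vector_mul_assoc vec.scale)
      then show ?thesis by blast
    next
      case False
      then obtain s where s: "u = \<gamma> s" using u unfolding U_def by blast
      have "u *v v = (\<gamma> s ** E x) *v (P *v axis j 1)"
        unfolding xj s by (simp only: matrix_vector_mul_assoc matrix_mul_assoc)
      also have "\<dots> = msmult (exp (s * x)) (E x) *v (P *v axis j 1)" by (simp only: \<gamma>E)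
      also have "\<dots> = exp (s * x) *s v"
        unfolding xj by (simp add: vec_eq_iff matrix_vector_mult_def sum_distrib_left mult_ac)
      finally show ?thesis by blast
    qed
  qed
  ultimately have "\<exists>P'::complex^'n^'n. invertible P' \<and> (\<forall>u\<in>U. \<exists>e. u = dg P' e)"
    using simultaneous_diag[of V U] by metis
  then obtain P' :: "complex^'n^'n" where P': "invertible P'" "\<And>u. u \<in> U \<Longrightarrow> \<exists>e. u = dg P' e" by blast
  define W where "W = {wprod us |us. set us \<subseteq> U}"
  have invU: "invertible u" if "u \<in> U" for u
    using that algebraic_groupD(2)[OF algA] \<gamma>inv by (auto simp: U_def)
  have minvU: "matrix_inv u \<in> U" if "u \<in> U" for u
    using that algebraic_groupD(5)[OF algA] \<gamma>inv by (auto simp: U_def)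
  have conU: "\<exists>C. C \<subseteq> U \<and> connectedin zariski C \<and> mat 1 \<in> C \<and> u \<in> C" if "u \<in> U" for u
  proof (cases "u \<in> A")
    case True
    then show ?thesis using conA algebraic_groupD(3)[OF algA]
      by (intro exI[of _ A]) (auto simp: U_def connected_algebraic_group_def)
  next
    case False
    have "connectedin zariski (range \<gamma>)"
      using \<gamma>inv(1) \<gamma>deriv
      by (intro connected_curve) (auto simp: mderiv_def intro!: continuous_at_imp_continuous_on DERIV_isCont)
    moreover have "mat 1 \<in> range \<gamma>" using \<gamma>0 by (metis rangeI)
    ultimately show ?thesis using that False by (intro exI[of _ "range \<gamma>"]) (auto simp: U_def)
  qed
  note words = words_group[of U, OF invU minvU conU, folded W_def]
  define T where "T = zcl W"
  have conT: "connected_algebraic_group T"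
    unfolding T_def using words(1,2) by (rule algebraic_group_zcl)
  have WT: "W \<subseteq> T"
    unfolding T_def using words(1) by (intro zcl_base) (simp add: subgroup_GL_iff)
  have "wprod us \<in> G" if "set us \<subseteq> U" for us
    using that
  proof (induction us)
    case (Cons u us)
    have "u \<in> G" using Cons.prems A_sub_G exps by (auto simp: U_def \<gamma>_def)
    then show ?case using Cons algebraic_groupD(4)[OF algG] by simp
  qed (simp add: algebraic_groupD(3)[OF algG])
  then have "T \<subseteq> G" unfolding T_def
    by (intro zcl_subset algebraic_groupD(1)[OF algG]) (auto simp: W_def)
  have wd: "\<exists>e. wprod us = dg P' e" if "set us \<subseteq> U" for us
    using that
  proof (induction us)
    case Nil
    show ?case using dg_one[OF P'(1)] by (metis wprod_simps(1))
  next
    case (Cons u us)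
    then obtain e where "wprod us = dg P' e" by auto
    moreover obtain e' where "u = dg P' e'" using P'(2) Cons.prems by auto
    ultimately show ?case using dg_mult[OF P'(1)] by auto
  qed
  have "cj P' g $ i $ j = 0" if "g \<in> T" "i \<noteq> j" for g i j
  proof -
    have "cj P' g $ i $ j = 0" if "g \<in> W" for g
      using that wd \<open>i \<noteq> j\<close> P'(1) unfolding W_def by (auto simp: cj_dg_nth) (metis cj_dg_nth)
    then have "(\<lambda>g. cj P' g $ i $ j) \<in> van W" using poly_fun_cj by (simp add: van_def)
    then show ?thesis using \<open>g \<in> T\<close> by (auto simp: T_def zcl_def)
  qed
  then have "torus T"
    unfolding torus_def using conT P'(1) by (auto simp: cj_def)
  moreover have "A \<subseteq> T" using words(3) WT by (auto simp: U_def)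
  ultimately have "T = A" using mt \<open>T \<subseteq> G\<close> unfolding maximal_torus_def by blast
  then have "\<gamma> s \<in> A" for s using words(3) WT by (auto simp: U_def)
  moreover have "mderiv \<gamma> (dg Q d) 0" using \<gamma>deriv[of 0] by simp
  ultimately show ?thesis using \<gamma>0 by (intro lie_curve[of \<gamma>])
qed

lemma semisimple_part_in_lieA:
  assumes X: "X \<in> lie G" "\<And>H. H \<in> lie A \<Longrightarrow> bracket H X = 0" and J: "jordan Q d N X m"
  shows "dg Q d \<in> lie A"
proof (rule torus_extend[OF jordan.P[OF J]])
  show "dg Q d ** t = t ** dg Q d" if "t \<in> A" for t
    using jordan.comm[OF J] centralizer_lieA_commutes[OF X(2) that] by simp
  show "dg Q (\<lambda>i. exp (s * d i)) \<in> G" for s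
    using jordan.replica_group[OF J algG X(1) ehom_exp[of "\<lambda>a. a" s]] by (simp add: comp_def)
qed

lemma bracket_lieA_nth:
  "H \<in> lie A \<Longrightarrow> cj P (bracket H X) $ i $ j = (ev H i - ev H j) * cj P X $ i $ j"
proof -
  assume "H \<in> lie A"
  then have "cj P H = diagm (ev H)" using lieA_dg P by (metis cj_dg)
  then show ?thesis unfolding cj_bracket[OF P] by (simp add: bracket_def algebra_simps)
qed

section \<open>Weight components\<close>

definition wt :: "'n \<Rightarrow> 'n \<Rightarrow> (complex^'n^'n \<Rightarrow> complex) \<Rightarrow> bool" where
  "wt i j \<alpha> \<longleftrightarrow> (\<forall>H\<in>lie A. ev H i - ev H j = \<alpha> H)"

definition wcomp :: "(complex^'n^'n \<Rightarrow> complex) \<Rightarrow> complex^'n^'n \<Rightarrow> complex^'n^'n" where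
  "wcomp \<alpha> X = uncj P (\<chi> i j. if wt i j \<alpha> then cj P X $ i $ j else 0)"

text \<open>The product of the operators \<open>(ad H - c) / (\<alpha> H - c)\<close>, one for each other weight, projects onto the
  weight space of \<open>\<alpha>\<close>.\<close>

lemma wcomp_in_lie:
  assumes "X \<in> lie G" shows "wcomp \<alpha> X \<in> lie G"
proof -
  have "\<exists>\<kappa>. (\<forall>i j. wt i j \<alpha> \<longrightarrow> \<kappa> i j = 1) \<and> (\<forall>(i, j)\<in>B. \<kappa> i j = 0) \<and>
      (\<forall>X\<in>lie G. uncj P (\<chi> i j. \<kappa> i j * cj P X $ i $ j) \<in> lie G)"
    if "finite B" "\<forall>(i, j)\<in>B. \<not> wt i j \<alpha>" for B
    using that
  proof (induction B rule: finite_induct)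
    case empty
    show ?case using P by (intro exI[of _ "\<lambda>_ _. 1"]) simp
  next
    case (insert b B)
    then obtain \<kappa> where *: "\<forall>i j. wt i j \<alpha> \<longrightarrow> \<kappa> i j = 1" "\<forall>(i, j)\<in>B. \<kappa> i j = 0"
      "\<forall>X\<in>lie G. uncj P (\<chi> i j. \<kappa> i j * cj P X $ i $ j) \<in> lie G" by auto
    note \<kappa> = *(1)[rule_format] *(2) *(3)[rule_format]
    obtain i0 j0 where b: "b = (i0, j0)" by (cases b)
    then obtain H where H: "H \<in> lie A" "ev H i0 - ev H j0 \<noteq> \<alpha> H"
      using insert.prems by (auto simp: wt_def)
    define c where "c = ev H i0 - ev H j0"
    define \<kappa>' where "\<kappa>' = (\<lambda>i j. (ev H i - ev H j - c) / (\<alpha> H - c) * \<kappa> i j)"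
    have "uncj P (\<chi> i j. \<kappa>' i j * cj P X $ i $ j) \<in> lie G" if X: "X \<in> lie G" for X
    proof -
      define Y where "Y = uncj P (\<chi> i j. \<kappa> i j * cj P X $ i $ j)"
      have Y: "Y \<in> lie G" using \<kappa>(3)[OF X] by (simp add: Y_def)
      have cY: "cj P Y $ i $ j = \<kappa> i j * cj P X $ i $ j" for i j by (simp add: Y_def P)
      have "cj P (uncj P (\<chi> i j. \<kappa>' i j * cj P X $ i $ j)) =
          cj P (msmult (1 / (\<alpha> H - c)) (bracket H Y - msmult c Y))"
        by (simp add: P vec_eq_iff cj_msmult cj_diff bracket_lieA_nth[OF H(1)] cY \<kappa>'_def algebra_simps
            diff_divide_distrib add_divide_distrib)
      then have "uncj P (\<chi> i j. \<kappa>' i j * cj P X $ i $ j) = msmult (1 / (\<alpha> H - c)) (bracket H Y - msmult c Y)"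
        by (simp only: cj_eq_iff[OF P])
      also have "\<dots> \<in> lie G"
        using Y H lieA_sub by (intro lie_msmult lie_diff lie_bracket[OF algG]) auto
      finally show ?thesis .
    qed
    moreover have "\<kappa>' i j = 1" if "wt i j \<alpha>" for i j
      using \<kappa>(1)[OF that] that H by (simp add: \<kappa>'_def wt_def c_def)
    moreover have "\<forall>(i, j)\<in>insert b B. \<kappa>' i j = 0"
      using \<kappa>(2) by (auto simp: \<kappa>'_def b c_def)
    ultimately show ?case by blast
  qed
  from this[of "{(i, j). \<not> wt i j \<alpha>}"]
  obtain \<kappa> where \<kappa>: "\<forall>i j. wt i j \<alpha> \<longrightarrow> \<kappa> i j = 1" "\<forall>i j. \<not> wt i j \<alpha> \<longrightarrow> \<kappa> i j = 0"
      "\<forall>X\<in>lie G. uncj P (\<chi> i j. \<kappa> i j * cj P X $ i $ j) \<in> lie G" by auto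
  have "(\<chi> i j. \<kappa> i j * cj P X $ i $ j) = (\<chi> i j. if wt i j \<alpha> then cj P X $ i $ j else 0)"
    using \<kappa>(1,2) by (simp add: vec_eq_iff)
  then show ?thesis using \<kappa>(3)[rule_format, OF assms] unfolding wcomp_def by simp
qed

lemma wcomp_root_space:
  assumes "X \<in> lie G" shows "wcomp \<alpha> X \<in> root_space G A \<alpha>"
  unfolding root_space_def
proof (intro CollectI conjI ballI wcomp_in_lie[OF assms])
  fix H assume H: "H \<in> lie A"
  have "cj P (bracket H (wcomp \<alpha> X)) = cj P (msmult (\<alpha> H) (wcomp \<alpha> X))"
    using H by (auto simp: vec_eq_iff bracket_lieA_nth[OF H] cj_msmult wcomp_def P wt_def)
  then show "bracket H (wcomp \<alpha> X) = msmult (\<alpha> H) (wcomp \<alpha> X)" by (simp only: cj_eq_iff[OF P])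
qed

lemma root_space_entry:
  assumes "X \<in> root_space G A \<alpha>" "cj P X $ i $ j \<noteq> 0" shows "wt i j \<alpha>"
  unfolding wt_def
proof
  fix H assume H: "H \<in> lie A"
  have "cj P (bracket H X) $ i $ j = \<alpha> H * cj P X $ i $ j"
    using assms(1) H by (simp add: root_space_def cj_msmult)
  then show "ev H i - ev H j = \<alpha> H" using assms(2) bracket_lieA_nth[OF H] by simp
qed

text \<open>The trace pairs entry (i, j) with entry (j, i), which carries the opposite weight. Only
  values on \<open>lie A\<close> are compared, so the lemma serves for \<open>- \<alpha>\<close> and
  for the zero weight alike.\<close>

lemma trace_wcomp:
  assumes "X \<in> root_space G A \<alpha>" and "\<And>H. H \<in> lie A \<Longrightarrow> \<beta> H = - \<alpha> H"
  shows "trace (X ** Y) = trace (X ** wcomp \<beta> Y)"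
proof -
  have *: "cj P X $ i $ j * cj P Y $ j $ i = cj P X $ i $ j * cj P (wcomp \<beta> Y) $ j $ i" for i j
  proof (cases "cj P X $ i $ j = 0")
    case False
    then have "wt i j \<alpha>" by (rule root_space_entry[OF assms(1)])
    then have "wt j i \<beta>" using assms(2) by (auto simp: wt_def algebra_simps)
    then show ?thesis by (simp add: wcomp_def P)
  qed simp
  have "trace (cj P X ** cj P Y) = trace (cj P X ** cj P (wcomp \<beta> Y))"
    by (simp only: trace_def matrix_matrix_mult_def vec_lambda_beta *)
  then show ?thesis using P by (simp add: cj_mult[symmetric] trace_cj)
qed

end

section \<open>The trace form\<close>

text \<open>Extend \<open>c\<close> to a basis of the complex numbers over the rationals. Such a
  functional detects a nonzero eigenvalue, and the squares of its values are nonnegative.\<close>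

lemma rational_functional_exists:
  fixes c :: complex
  assumes "c \<noteq> 0"
  obtains \<phi> :: "complex \<Rightarrow> rat" where "\<And>a b. \<phi> (a + b) = \<phi> a + \<phi> b"
    "\<And>q a. \<phi> (of_rat q * a) = q * \<phi> a" "\<phi> c = 1"
proof -
  interpret vector_space_pair "\<lambda>(q::rat) (z::complex). of_rat q * z" "(*) :: rat \<Rightarrow> rat \<Rightarrow> rat"
    by unfold_locales (simp_all add: algebra_simps of_rat_add of_rat_mult)
  have "vs1.independent {c}"
    using assms by (simp add: vs1.dependent_single)
  then obtain g where g: "Vector_Spaces.linear (\<lambda>(q::rat) (z::complex). of_rat q * z) (*) g" "g c = (1 :: rat)"
    using linear_independent_extend[of "{c}" "\<lambda>_. 1"] by auto
  interpret g: Vector_Spaces.linear "\<lambda>(q::rat) (z::complex). of_rat q * z" "(*) :: rat \<Rightarrow> rat \<Rightarrow> rat" g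
    by (rule g(1))
  show ?thesis by (rule that[of g]) (simp_all add: g.add g.scale g)
qed

lemma bracket_eq_0D: "bracket X Y = 0 \<Longrightarrow> X ** Y = Y ** X" for X :: "'a::comm_ring_1^'n^'n"
  by (rule bracket_eq_0_iff[THEN iffD1])

lemma nilp_zero [simp]: "nilp 0"
  by (auto simp: nilp_def intro: exI[of _ "1::nat"])

lemma mpow_scaleR: "mpow (c *\<^sub>R X) k = (c ^ k) *\<^sub>R mpow X k" for X :: "complex^'n^'n"
  by (induction k) (simp_all add: matrix_scalar_ac scalar_matrix_assoc mult.commute)

lemma nilp_scaleR: "nilp X \<Longrightarrow> nilp (c *\<^sub>R X)"
  by (auto simp: nilp_def mpow_scaleR)

lemma scaleR_eq_msmult: "c *\<^sub>R X = msmult (of_real c) X" for X :: "complex^'n^'n"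
  by (simp add: vec_eq_iff scaleR_conv_of_real[where 'a=complex])

lemma wnil_nilp_mult:
  assumes "wnil S" "X \<in> S" "Y \<in> S" shows "nilp (X ** Y)"
proof -
  obtain N where N: "\<And>us. set us \<subseteq> S \<Longrightarrow> N \<le> length us \<Longrightarrow> wprod us = 0"
    using assms(1) unfolding wnil_def by blast
  have "wprod (concat (replicate k [X, Y])) = mpow (X ** Y) k" for k
    by (induction k) (simp_all add: matrix_mul_assoc)
  moreover have "length (concat (replicate k [X, Y])) = 2 * k" for k by (induction k) auto
  moreover have "set (concat (replicate N [X, Y])) \<subseteq> S" using assms by auto
  ultimately have "mpow (X ** Y) N = 0" using N[of "concat (replicate N [X, Y])"] by simp
  then show ?thesis by (auto simp: nilp_def)
qed

lemma matrix_inv_inv: "invertible g \<Longrightarrow> matrix_inv (matrix_inv g) = g" for g :: "complex^'n^'n"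
  by (intro matrix_inv_unique matrix_inv_left)

lemma is_exp_conj:
  fixes g :: "complex^'n^'n"
  assumes "is_exp X \<gamma>" and g: "invertible g"
  shows "is_exp (g ** X ** matrix_inv g) (\<lambda>t. g ** \<gamma> t ** matrix_inv g)"
proof -
  note E = is_expD[OF assms(1)]
  have c: "(g ** Y ** matrix_inv g) ** (g ** Z ** matrix_inv g) = g ** (Y ** Z) ** matrix_inv g" for Y Z
  proof -
    have "(g ** Y ** matrix_inv g) ** (g ** Z ** matrix_inv g) = g ** Y ** (matrix_inv g ** g) ** Z ** matrix_inv g"
      by (simp only: matrix_mul_assoc)
    then show ?thesis by (simp add: matrix_inv_left[OF g] matrix_mul_assoc)
  qed
  have conj_back: "g ** (matrix_inv g ** Y ** g) ** matrix_inv g = Y" for Y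
    using uncj_cj[OF g, of Y] by (simp add: cj_def uncj_def)
  show ?thesis
    unfolding is_exp_def
  proof (intro conjI allI impI)
    show "mderiv (\<lambda>t. g ** \<gamma> t ** matrix_inv g) (g ** \<gamma> t ** matrix_inv g ** (g ** X ** matrix_inv g)) t" for t
      unfolding c by (intro mderiv_const_mult mderiv_mult_const E)
    show "g ** \<gamma> 0 ** matrix_inv g = mat 1" by (simp add: E(2) matrix_inv_right[OF g])
    show "g ** \<gamma> t ** matrix_inv g ** (g ** \<gamma> (- t) ** matrix_inv g) = mat 1" for t
      unfolding c by (simp add: E(3) matrix_inv_right[OF g])
    fix t Y assume Y: "g ** X ** matrix_inv g ** Y = Y ** (g ** X ** matrix_inv g)"
    define Z where "Z = matrix_inv g ** Y ** g"
    have YZ: "Y = g ** Z ** matrix_inv g" by (simp add: Z_def conj_back)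
    have "g ** (X ** Z) ** matrix_inv g = g ** (Z ** X) ** matrix_inv g"
      using Y by (simp only: YZ c)
    then have "X ** Z = Z ** X" using cj_uncj[OF g] unfolding uncj_def by metis
    then have "\<gamma> t ** Z = Z ** \<gamma> t" by (rule E(6))
    then show "g ** \<gamma> t ** matrix_inv g ** Y = Y ** (g ** \<gamma> t ** matrix_inv g)"
      unfolding YZ c by simp
  qed
qed

section \<open>The radical of the trace form\<close>

context ss_torus
begin

definition rad :: "(complex^'n^'n) set" where
  "rad = {X \<in> lie G. \<forall>Y\<in>lie G. trace (X ** Y) = 0}"

text \<open>The nilpotent part commutes with every replica, so it contributes a nilpotent product of
  trace 0. Rational functionals and complex conjugation are both inserted for \<phi> later.\<close>

lemma trace_jordan_replica:
  assumes J: "jordan Q d N X m"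
  shows "trace (X ** dg Q (\<phi> \<circ> d)) = (\<Sum>i\<in>UNIV. d i * \<phi> (d i))"
proof -
  have "N ** dg Q d = dg Q d ** N"
    using jordan.commute_N[OF J, of "dg Q d"] jordan.comm[OF J, of X] by simp
  then have "N ** dg Q (\<phi> \<circ> d) = dg Q (\<phi> \<circ> d) ** N"
    using dg_commute_comp[OF jordan.P[OF J], of d N \<phi>] by simp
  moreover have "nilp N" using jordan.N[OF J] by (auto simp: nilp_def)
  ultimately have "trace (N ** dg Q (\<phi> \<circ> d)) = 0" by (intro trace_nilp_commute)
  then show ?thesis
    unfolding jordan.X[OF J]
    by (simp add: matrix_ring_simps trace_add dg_mult trace_dg jordan.P[OF J])
qed

lemma rad_nilp:
  assumes X: "X \<in> rad" shows "nilp X"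
proof -
  obtain Q d N m where J: "jordan Q d N X m" by (rule jordan_exists)
  have "d i = 0" for i
  proof (rule ccontr)
    assume "d i \<noteq> 0"
    then obtain \<phi> :: "complex \<Rightarrow> rat" where \<phi>: "\<And>a b. \<phi> (a + b) = \<phi> a + \<phi> b"
      "\<And>q a. \<phi> (of_rat q * a) = q * \<phi> a" "\<phi> (d i) = 1" using rational_functional_exists by metis
    have "dg Q ((\<lambda>a. of_rat (\<phi> a)) \<circ> d) \<in> lie G"
      using X \<phi>(1) by (intro jordan.replica_lie[OF J algG]) (simp_all add: rad_def of_rat_add)
    then have "(\<Sum>i\<in>UNIV. d i * of_rat (\<phi> (d i))) = 0"
      using X trace_jordan_replica[OF J, of "\<lambda>a. of_rat (\<phi> a)"] by (simp add: rad_def)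
    \<comment> \<open>Applying \<phi> once more turns the vanishing trace into a vanishing sum of
      rational squares.\<close>
    then have "\<phi> (\<Sum>i\<in>UNIV. of_rat (\<phi> (d i)) * d i) = \<phi> 0" by (simp add: mult.commute)
    moreover have "\<phi> (\<Sum>i\<in>I. of_rat (\<phi> (d i)) * d i) = (\<Sum>i\<in>I. \<phi> (d i) * \<phi> (d i))" for I
      using \<phi>(1)[of 0 0] by (induction I rule: infinite_finite_induct) (simp_all add: \<phi>(1,2))
    moreover have "\<phi> 0 = 0" using \<phi>(1)[of 0 0] by simp
    ultimately have "(\<Sum>i\<in>UNIV. \<phi> (d i) * \<phi> (d i)) = 0" by simp
    then have "\<phi> (d i) * \<phi> (d i) = 0" by (subst (asm) sum_nonneg_eq_0_iff) auto
    then show False using \<phi>(3) by simp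
  qed
  then have "d = (\<lambda>_. 0)" by auto
  then have "X = N" using jordan.X[OF J] by (simp add: dg_zero)
  then show ?thesis using jordan.N[OF J] by (auto simp: nilp_def)
qed

lemma rad_lie: "X \<in> rad \<Longrightarrow> X \<in> lie G"
  by (simp add: rad_def)

lemma rad_ideal: "X \<in> rad \<Longrightarrow> Y \<in> lie G \<Longrightarrow> bracket X Y \<in> rad"
  unfolding rad_def by (auto intro: lie_bracket[OF algG] simp: trace_bracket)

lemma subspace_rad: "subspace rad"
  unfolding subspace_def rad_def
  by (auto intro: lie_add lie_msmult simp: matrix_ring_simps trace_add scaleR_eq_msmult msmult_mult trace_msmult)

lemma conj_trace: "trace (g ** X ** matrix_inv g ** Y) = trace (X ** (matrix_inv g ** Y ** g))"
  for g X Y :: "complex^'n^'n"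
  using trace_mul_sym[of g "X ** matrix_inv g ** Y"] by (simp add: matrix_mul_assoc)

lemma rad_conj:
  assumes "X \<in> rad" "g \<in> G" shows "g ** X ** matrix_inv g \<in> rad"
  unfolding rad_def
proof (intro CollectI conjI ballI)
  have g: "invertible g" "matrix_inv g \<in> G" using algebraic_groupD[OF algG] assms(2) by auto
  show "g ** X ** matrix_inv g \<in> lie G" using assms by (auto simp: rad_def intro: lie_conj[OF algG])
  fix Y assume "Y \<in> lie G"
  then have "matrix_inv g ** Y ** g \<in> lie G" using lie_conj[OF algG g(2)] matrix_inv_inv[OF g(1)] by metis
  then show "trace (g ** X ** matrix_inv g ** Y) = 0" using assms(1) conj_trace[of g X Y] by (simp add: rad_def)
qed

lemma wnil_rad: "wnil rad"
  using subspace_rad rad_nilp by (rule engel) (auto simp: rad_def intro: lie_bracket[OF algG] simp: trace_bracket)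

definition radc :: "(complex^'n^'n) set" where
  "radc = {X \<in> rad. \<forall>Y\<in>rad. bracket Y X = 0}"

text \<open>The value of a longest nonvanishing iterated bracket on \<open>X0\<close> is central;
  lengths are bounded since the radical is uniformly nilpotent.\<close>

lemma radc_nonzero:
  assumes "X0 \<in> rad" "X0 \<noteq> 0" shows "\<exists>X\<in>radc. X \<noteq> 0"
proof -
  obtain N where N: "\<And>ss w. set ss \<subseteq> rad \<Longrightarrow> N \<le> length ss \<Longrightarrow> foldr bracket ss w = 0"
    using foldr_bracket_zero[OF wnil_rad] by blast
  define Q where "Q = (\<lambda>ss. set ss \<subseteq> rad \<and> foldr bracket ss X0 \<noteq> 0)"
  have "Q []" using assms by (simp add: Q_def)
  moreover have "\<forall>ss. Q ss \<longrightarrow> length ss < N" using N unfolding Q_def by (metis not_le)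
  ultimately obtain ss where ss: "Q ss" "\<And>ts. Q ts \<Longrightarrow> length ts \<le> length ss"
    using ex_has_greatest_nat[of Q "[]" length] by blast
  have "set ss \<subseteq> rad \<Longrightarrow> foldr bracket ss X0 \<in> rad"
    by (induction ss) (auto simp: assms rad_ideal rad_lie)
  moreover have "bracket Y (foldr bracket ss X0) = 0" if "Y \<in> rad" for Y
    using ss(2)[of "Y # ss"] ss(1) that by (auto simp: Q_def)
  ultimately show ?thesis using ss(1) by (intro bexI[of _ "foldr bracket ss X0"]) (auto simp: radc_def Q_def)
qed

lemma radc_conj:
  assumes "X \<in> radc" "g \<in> G" shows "g ** X ** matrix_inv g \<in> radc"
  unfolding radc_def
proof (intro CollectI conjI ballI)
  have g: "invertible g" "matrix_inv g \<in> G" using algebraic_groupD[OF algG] assms(2) by auto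
  show "g ** X ** matrix_inv g \<in> rad" using assms by (auto simp: radc_def intro: rad_conj)
  fix Y assume "Y \<in> rad"
  then have Z: "cj g Y \<in> rad" using rad_conj[OF _ g(2)] matrix_inv_inv[OF g(1)] unfolding cj_def by metis
  have "cj g (bracket Y (uncj g X)) = bracket (cj g Y) X" by (simp add: cj_bracket g(1))
  also have "\<dots> = 0" using assms(1) Z by (simp add: radc_def)
  finally have "bracket Y (uncj g X) = 0" using g(1) by (metis cj_eq_iff cj_zero)
  then show "bracket Y (g ** X ** matrix_inv g) = 0" by (simp add: uncj_def)
qed

text \<open>Exponentials of the centre of the radical generate a commutative normal subgroup; so does its closure.\<close>

theorem rad_trivial:
  assumes "X \<in> rad" shows "X = 0"
proof -
  define U where "U = {\<gamma> t |X \<gamma> t. X \<in> radc \<and> is_exp X \<gamma>}"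
  have invU: "invertible u" if "u \<in> U" for u using that is_expD(4) by (auto simp: U_def)
  have minvU: "matrix_inv u \<in> U" if uU: "u \<in> U" for u
  proof -
    obtain X \<gamma> t where u: "X \<in> radc" "is_exp X \<gamma>" "u = \<gamma> t" using uU by (auto simp: U_def)
    then show ?thesis using is_expD(5)[OF u(2), of t] unfolding U_def by blast
  qed
  have conU: "\<exists>C. C \<subseteq> U \<and> connectedin zariski C \<and> mat 1 \<in> C \<and> u \<in> C" if uU: "u \<in> U" for u
  proof -
    obtain X \<gamma> t where u: "X \<in> radc" "is_exp X \<gamma>" "u = \<gamma> t" using uU by (auto simp: U_def)
    note E = is_expD[OF u(2)]
    have "connectedin zariski (range \<gamma>)" by (intro connected_curve E)
    moreover have "mat 1 \<in> range \<gamma>" using E(2) by (metis rangeI)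
    moreover have "range \<gamma> \<subseteq> U" using u by (auto simp: U_def)
    ultimately show ?thesis using u(3) by blast
  qed
  have commU: "u ** v = v ** u" if uv: "u \<in> U" "v \<in> U" for u v
  proof -
    obtain X \<gamma> t where u: "X \<in> radc" "is_exp X \<gamma>" "u = \<gamma> t" using uv(1) by (auto simp: U_def)
    obtain Y \<delta> s where v: "Y \<in> radc" "is_exp Y \<delta>" "v = \<delta> s" using uv(2) by (auto simp: U_def)
    have "bracket X Y = 0" using u(1) v(1) by (simp add: radc_def)
    then have "X ** Y = Y ** X" by (rule bracket_eq_0D)
    then have "\<gamma> t ** Y = Y ** \<gamma> t" by (rule is_expD(6)[OF u(2)])
    then have "Y ** \<gamma> t = \<gamma> t ** Y" by (rule sym)
    then have "\<delta> s ** \<gamma> t = \<gamma> t ** \<delta> s" by (rule is_expD(6)[OF v(2)])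
    then show ?thesis using u v by simp
  qed
  define W where "W = {wprod us |us. set us \<subseteq> U}"
  note words = words_group[of U, OF invU minvU conU, folded W_def]
  have WT: "W \<subseteq> zcl W"
    using words(1) by (intro zcl_base) (simp add: subgroup_GL_iff)
  have UG: "U \<subseteq> G"
    using is_exp_in_group[OF algG] by (auto simp: U_def radc_def rad_def)
  have "wprod us \<in> G" if "set us \<subseteq> U" for us
    using that UG by (induction us) (auto simp: algebraic_groupD[OF algG])
  then have NG: "zcl W \<subseteq> G" by (intro zcl_subset algebraic_groupD(1)[OF algG]) (auto simp: W_def)
  have con: "connected_algebraic_group (zcl W)" using words(1,2) by (rule algebraic_group_zcl)
  have comm: "g ** h = h ** g" if "g \<in> zcl W" "h \<in> zcl W" for g h
  proof (rule zcl_commute[OF _ that])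
    show "g ** h = h ** g" if "g \<in> W" "h \<in> W" for g h
      using that words_commute[of U, OF commU] by (auto simp: W_def)
  qed
  have norU: "uncj g u \<in> U" if g: "g \<in> G" and uU: "u \<in> U" for g u
  proof -
    obtain X \<gamma> t where u: "X \<in> radc" "is_exp X \<gamma>" "u = \<gamma> t" using uU by (auto simp: U_def)
    have "invertible g" using algebraic_groupD(2)[OF algG] g by blast
    from is_exp_conj[OF u(2) this] radc_conj[OF u(1) g] show ?thesis
      unfolding U_def uncj_def u(3)
      by (intro CollectI exI[of _ "g ** X ** matrix_inv g"] exI[of _ "\<lambda>t. g ** \<gamma> t ** matrix_inv g"]
          exI[of _ t]) simp
  qed
  have norW: "uncj g h \<in> W" if g: "g \<in> G" and h: "h \<in> W" for g h
  proof -
    have ig: "invertible g" using algebraic_groupD(2)[OF algG] g by blast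
    obtain us where us: "set us \<subseteq> U" "h = wprod us" using h by (auto simp: W_def)
    have "uncj g (wprod us) = wprod (map (uncj g) us)" for us
    proof (induction us)
      case Nil
      show ?case by (simp add: uncj_def matrix_inv_right[OF ig])
    next
      case (Cons u us)
      have "cj g (uncj g (u ** wprod us)) = cj g (uncj g u ** uncj g (wprod us))"
        by (simp add: ig cj_mult)
      then show ?case using Cons by (simp add: cj_eq_iff[OF ig])
    qed
    moreover have "set (map (uncj g) us) \<subseteq> U" using us norU[OF g] by auto
    ultimately show ?thesis unfolding W_def us(2) by blast
  qed
  have nor: "g ** h ** matrix_inv g \<in> zcl W" if g: "g \<in> G" and h: "h \<in> zcl W" for g h
  proof (rule zcl_translate[OF _ _ _ h])
    have "invertible g" "matrix_inv g \<in> G" using algebraic_groupD[OF algG] g by auto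
    then show "invertible g" "invertible (matrix_inv g)" using algebraic_groupD(2)[OF algG] by auto
    show "g ** h ** matrix_inv g \<in> zcl W" if "h \<in> W" for h
      using norW[OF g that] WT by (auto simp: uncj_def)
  qed
  have "zcl W = {mat 1}"
    using semisimple_no_abelian_normal[OF ss con NG comm nor] .
  then have U1: "U \<subseteq> {mat 1}" using words(3) WT by auto
  have "Z = 0" if Z: "Z \<in> radc" for Z
  proof -
    obtain \<gamma> where \<gamma>: "is_exp Z \<gamma>" by (rule is_exp_exists)
    \<comment> \<open>The generated group is trivial, so the exponential curve is constant and its
      derivative \<open>Z\<close> at 0 vanishes.\<close>
    then have "\<gamma> = (\<lambda>_. mat 1)" using U1 Z unfolding U_def by blast
    then have "mderiv (\<lambda>_. mat 1) Z 0" using is_expD(7)[OF \<gamma>] by simp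
    then have "Z $ i $ j = 0" for i j
      unfolding mderiv_def using DERIV_unique DERIV_const by blast
    then show ?thesis by (simp add: vec_eq_iff)
  qed
  then show ?thesis using radc_nonzero assms by blast
qed

section \<open>The centralizer of the torus\<close>

definition cent :: "(complex^'n^'n) set" where
  "cent = {X \<in> lie G. \<forall>H\<in>lie A. bracket H X = 0}"

lemma lieA_abelian: "H \<in> lie A \<Longrightarrow> K \<in> lie A \<Longrightarrow> bracket H K = 0"
  using lieA_dg[of H] lieA_dg[of K] dg_mult[OF P]
  by (metis (no_types, lifting) bracket_eq_0_iff mult.commute ext)

lemma lieA_sub_cent: "lie A \<subseteq> cent"
  using lieA_sub lieA_abelian by (auto simp: cent_def)

lemma cent_bracket: "X \<in> cent \<Longrightarrow> Y \<in> cent \<Longrightarrow> bracket X Y \<in> cent"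
proof -
  assume XY: "X \<in> cent" "Y \<in> cent"
  have "bracket H (bracket X Y) = 0" if "H \<in> lie A" for H
    using jacobi[of H X Y] XY that by (simp add: cent_def)
  then show ?thesis using XY by (simp add: cent_def lie_bracket[OF algG])
qed

lemma cent_add: "X \<in> cent \<Longrightarrow> Y \<in> cent \<Longrightarrow> X + Y \<in> cent"
  by (auto simp: cent_def bracket_add_right intro: lie_add)

lemma cent_msmult: "X \<in> cent \<Longrightarrow> msmult c X \<in> cent"
  by (auto simp: cent_def bracket_msmult_right intro: lie_msmult)

lemma cent_jordan:
  assumes "X \<in> cent" and J: "jordan Q d N X m"
  shows "dg Q d \<in> lie A" "N \<in> cent" "nilp N"
proof -
  show 1: "dg Q d \<in> lie A"
    using assms(1) by (intro semisimple_part_in_lieA[OF _ _ J]) (auto simp: cent_def)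
  have "N = X + msmult (-1) (dg Q d)" using jordan.X[OF J] by (simp add: msmult_minus)
  then show "N \<in> cent" using 1 lieA_sub_cent assms(1) cent_add cent_msmult by (metis subsetD)
  show "nilp N" using jordan.N[OF J] by (auto simp: nilp_def)
qed

text \<open>For B obtained by conjugating the eigenvalues, tr(X B) is the sum of |d_i|^2. This B
  need not lie in \<open>lie G\<close>; it commutes with \<open>cent\<close> because the semisimple
  part of X lies in \<open>lie A\<close>.\<close>

lemma cent_nilp_crit:
  assumes X: "X \<in> cent" and tr: "\<And>B. (\<And>Y. Y \<in> cent \<Longrightarrow> Y ** B = B ** Y) \<Longrightarrow> trace (X ** B) = 0"
  shows "nilp X"
proof -
  obtain Q d N m where J: "jordan Q d N X m" by (rule jordan_exists)
  have "Y ** dg Q (cnj \<circ> d) = dg Q (cnj \<circ> d) ** Y" if "Y \<in> cent" for Y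
  proof -
    have "bracket (dg Q d) Y = 0" using cent_jordan(1)[OF X J] that by (simp add: cent_def)
    from dg_commute_comp[OF jordan.P[OF J] bracket_eq_0D[OF this], of cnj] show ?thesis by (rule sym)
  qed
  then have "(\<Sum>i\<in>UNIV. d i * cnj (d i)) = 0" using tr trace_jordan_replica[OF J, of cnj] by metis
  then have "of_real (\<Sum>i\<in>UNIV. (cmod (d i))\<^sup>2) = (0::complex)" by (simp only: of_real_sum complex_norm_square)
  then have "(\<Sum>i\<in>UNIV. (cmod (d i))\<^sup>2) = 0" by (simp only: of_real_eq_0_iff)
  then have "d i = 0" for i by (subst (asm) sum_nonneg_eq_0_iff) auto
  then have "d = (\<lambda>_. 0)" by auto
  then have "X = N" using jordan.X[OF J] by (simp add: dg_zero)
  then show ?thesis using cent_jordan(3)[OF X J] by simp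
qed

text \<open>The trace criterion is additive in X, which makes the nilpotent elements a subspace;
  brackets satisfy it because tr([X, Y] B) = tr(X [Y, B]) and Y commutes with B.\<close>

lemma wnil_cent_nilp: "wnil {X \<in> cent. nilp X}"
proof (rule engel)
  have tr: "trace (X ** B) = 0" if "X \<in> cent" "nilp X" "\<And>Y. Y \<in> cent \<Longrightarrow> Y ** B = B ** Y" for X B
    using that by (intro trace_nilp_commute) auto
  show "subspace {X \<in> cent. nilp X}"
    unfolding subspace_def
  proof (intro conjI ballI allI)
    show "0 \<in> {X \<in> cent. nilp X}" by (simp add: cent_def)
    show "X + Y \<in> {X \<in> cent. nilp X}" if XY: "X \<in> {X \<in> cent. nilp X}" "Y \<in> {X \<in> cent. nilp X}" for X Y
    proof (intro CollectI conjI cent_nilp_crit)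
      show "X + Y \<in> cent" "X + Y \<in> cent" using XY cent_add by auto
      fix B assume B: "\<And>Y. Y \<in> cent \<Longrightarrow> Y ** B = B ** Y"
      have "trace (X ** B) = 0" "trace (Y ** B) = 0" using XY tr[OF _ _ B] by auto
      then show "trace ((X + Y) ** B) = 0" by (simp add: matrix_add_rdist trace_add)
    qed
    show "c *\<^sub>R X \<in> {X \<in> cent. nilp X}" if "X \<in> {X \<in> cent. nilp X}" for c X
      using that nilp_scaleR[of X c] cent_msmult[of X "of_real c"] by (simp add: scaleR_eq_msmult)
  qed
  show "nilp X" if "X \<in> {X \<in> cent. nilp X}" for X using that by simp
  show "bracket X Y \<in> {X \<in> cent. nilp X}" if XY: "X \<in> {X \<in> cent. nilp X}" "Y \<in> {X \<in> cent. nilp X}" for X Y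
  proof (intro CollectI conjI cent_nilp_crit)
    show "bracket X Y \<in> cent" "bracket X Y \<in> cent" using XY cent_bracket by auto
    fix B assume "\<And>Y. Y \<in> cent \<Longrightarrow> Y ** B = B ** Y"
    then have "Y ** B = B ** Y" using XY by simp
    then have "bracket Y B = 0" by (rule bracket_eq_0_iff[THEN iffD2])
    then show "trace (bracket X Y ** B) = 0" by (simp add: trace_bracket)
  qed
qed

lemma cent_root_space: "X \<in> cent \<longleftrightarrow> X \<in> root_space G A (\<lambda>_. 0)"
  by (auto simp: cent_def root_space_def)

text \<open>A nilpotent X in \<open>cent\<close> is orthogonal to all of \<open>cent\<close>: its
  product with a semisimple part is nilpotent because the two commute, that with a nilpotent part by
  Engel's theorem. Nonzero weights are orthogonal to X anyway, so X lies in the radical of the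
  form.\<close>

theorem centralizer_lieA: "cent = lie A"
proof
  have nil0: "X = 0" if X: "X \<in> cent" "nilp X" for X
  proof (rule rad_trivial)
    have "trace (X ** Z) = 0" if Z: "Z \<in> cent" for Z
    proof -
      obtain Q d N m where J: "jordan Q d N Z m" by (rule jordan_exists)
      note CJ = cent_jordan[OF Z J]
      have "bracket (dg Q d) X = 0" using X(1) CJ(1) by (simp add: cent_def)
      then have "X ** dg Q d = dg Q d ** X" by (rule bracket_eq_0D[THEN sym])
      then have "trace (X ** dg Q d) = 0" using X(2) by (intro trace_nilp_commute)
      moreover have "trace (X ** N) = 0"
        using X CJ by (intro trace_nilp wnil_nilp_mult[OF wnil_cent_nilp]) auto
      ultimately show ?thesis unfolding jordan.X[OF J] by (simp add: matrix_ring_simps trace_add)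
    qed
    moreover have "trace (X ** Y) = trace (X ** wcomp (\<lambda>_. 0) Y)" for Y
      using X(1) unfolding cent_root_space by (rule trace_wcomp) simp
    moreover have "wcomp (\<lambda>_. 0) Y \<in> cent" if "Y \<in> lie G" for Y
      unfolding cent_root_space using that by (rule wcomp_root_space)
    ultimately have "trace (X ** Y) = 0" if "Y \<in> lie G" for Y using that by metis
    then show "X \<in> rad" using X(1) by (simp add: rad_def cent_def)
  qed
  show "cent \<subseteq> lie A"
  proof
    fix X assume X: "X \<in> cent"
    obtain Q d N m where J: "jordan Q d N X m" by (rule jordan_exists)
    note CJ = cent_jordan[OF X J]
    then have "X = dg Q d" using nil0[of N] jordan.X[OF J] by simp
    then show "X \<in> lie A" using CJ(1) by simp
  qed
qed (rule lieA_sub_cent)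

end

section \<open>Roots\<close>

text \<open>If F^(j+1) is the first power that kills v, then E F^(j+1) v = (j + 1)(m - j) F^j v
  gives m = j. The space is abstract because both the natural representation and the adjoint action
  occur.\<close>

lemma sl2_highest_weight:
  fixes sc :: "complex \<Rightarrow> 'v::ab_group_add \<Rightarrow> 'v" and m :: complex
  assumes "vector_space sc"
    and E: "\<And>c v. E (sc c v) = sc c (E v)" and F: "\<And>c v. F (sc c v) = sc c (F v)"
    and EF: "\<And>v. E (F v) = F (E v) + H v" and HF: "\<And>v. H (F v) = F (H v) - sc 2 (F v)"
    and v: "v \<noteq> 0" "E v = 0" "H v = sc m v" and nil: "(F ^^ k) v = 0"
  shows "\<exists>n::nat. m = of_nat n"
proof -
  interpret vector_space sc by fact
  have E0: "E 0 = 0" and F0: "F 0 = 0" using E[of 0 0] F[of 0 0] by simp_all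
  have Hk: "H ((F ^^ k) v) = sc (m - 2 * of_nat k) ((F ^^ k) v)" for k
  proof (induction k)
    case (Suc k)
    have "H ((F ^^ Suc k) v) = sc (m - 2 * of_nat k) (F ((F ^^ k) v)) - sc 2 (F ((F ^^ k) v))"
      by (simp add: HF Suc F)
    also have "\<dots> = sc (m - 2 * of_nat k - 2) (F ((F ^^ k) v))" by (simp only: scale_left_diff_distrib)
    finally show ?case by (simp add: algebra_simps)
  qed (simp add: v)
  have Ek: "E ((F ^^ Suc k) v) = sc (of_nat (Suc k) * (m - of_nat k)) ((F ^^ k) v)" for k
  proof (induction k)
    case 0
    show ?case using v F0 by (simp add: EF)
  next
    case (Suc k)
    have "E ((F ^^ Suc (Suc k)) v) = F (E ((F ^^ Suc k) v)) + H ((F ^^ Suc k) v)" by (simp add: EF)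
    also have "\<dots> = sc (of_nat (Suc k) * (m - of_nat k)) ((F ^^ Suc k) v) +
        sc (m - 2 * of_nat (Suc k)) ((F ^^ Suc k) v)"
      unfolding Suc Hk by (simp add: F)
    also have "\<dots> = sc (of_nat (Suc k) * (m - of_nat k) + (m - 2 * of_nat (Suc k))) ((F ^^ Suc k) v)"
      by (simp only: scale_left_distrib)
    also have "of_nat (Suc k) * (m - of_nat k) + (m - 2 * of_nat (Suc k)) = of_nat (Suc (Suc k)) * (m - of_nat (Suc k))"
      by (simp add: algebra_simps)
    finally show ?case .
  qed
  obtain K where K: "(F ^^ K) v = 0" "\<And>j. j < K \<Longrightarrow> (F ^^ j) v \<noteq> 0"
    using exists_least_iff[of "\<lambda>k. (F ^^ k) v = 0"] nil by blast
  then obtain j where j: "K = Suc j" using v(1) by (cases K) auto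
  have "sc (of_nat (Suc j) * (m - of_nat j)) ((F ^^ j) v) = 0"
    using Ek[of j] K(1) E0 unfolding j by simp
  then have "of_nat (Suc j) * (m - of_nat j) = 0" using K(2)[of j] j by (simp only: scale_eq_0_iff) simp
  then show ?thesis by (simp del: of_nat_Suc)
qed

lemma vector_space_msmult: "vector_space (msmult :: complex \<Rightarrow> complex^'n^'n \<Rightarrow> complex^'n^'n)"
  by unfold_locales (simp_all add: msmult_add msmult_add_left msmult_msmult)

text \<open>X shifts the grading \<open>d\<close> by \<open>a\<close>, so its k-th power shifts by k
  a, while only finitely many differences of degrees occur.\<close>

lemma graded_nilp:
  assumes P: "invertible P" and "a \<noteq> 0" and "\<And>i j. cj P X $ i $ j \<noteq> 0 \<Longrightarrow> d i - d j = (a :: complex)"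
  shows "nilp X"
proof -
  have e: "mpow (cj P X) k $ i $ j = 0 \<or> d i - d j = of_nat k * a" for k i j
  proof (induction k arbitrary: i)
    case 0
    show ?case by (simp add: mat_def)
  next
    case (Suc k)
    show ?case
    proof (rule ccontr)
      assume n: "\<not> ?thesis"
      then have "(\<Sum>l\<in>UNIV. cj P X $ i $ l * mpow (cj P X) k $ l $ j) \<noteq> 0"
        by (simp add: matrix_matrix_mult_def)
      then obtain l where "cj P X $ i $ l * mpow (cj P X) k $ l $ j \<noteq> 0" by (meson sum.neutral)
      then have "d i - d l = a" "d l - d j = of_nat k * a" using Suc[of l] assms(3) by auto
      then have "(d i - d l) + (d l - d j) = a + of_nat k * a" by simp
      then show False using n by (simp add: algebra_simps)
    qed
  qed
  have "finite (range (\<lambda>(i, j). d i - d j))" by simp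
  moreover have "infinite (range (\<lambda>k::nat. of_nat k * a))"
    using assms(2) by (intro range_inj_infinite) (simp add: inj_def)
  ultimately have "\<not> range (\<lambda>k::nat. of_nat k * a) \<subseteq> range (\<lambda>(i, j). d i - d j)"
    using finite_subset by blast
  then obtain k :: nat where k: "of_nat k * a \<notin> range (\<lambda>(i, j). d i - d j)" by blast
  have "d i - d j \<in> range (\<lambda>(i, j). d i - d j)" for i j by (rule range_eqI[of _ _ "(i, j)"]) simp
  then have "d i - d j \<noteq> of_nat k * a" for i j using k by metis
  then have "mpow (cj P X) k $ i $ j = 0" for i j using e[of k i j] by simp
  then have "cj P (mpow X k) = cj P 0" using P by (simp add: cj_mpow vec_eq_iff)
  then show ?thesis unfolding nilp_def using cj_eq_iff[OF P] by blast
qed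

lemma wnil_nilp_singleton: "nilp e \<Longrightarrow> wnil {e}"
proof -
  assume "nilp e"
  then obtain k where k: "mpow e k = 0" by (auto simp: nilp_def)
  show ?thesis
  proof (rule wnilI[of _ k])
    fix ws assume "set ws \<subseteq> {e}" "length ws = k"
    then have "ws = replicate k e" by (intro replicate_eqI) auto
    moreover have "wprod (replicate l e) = mpow e l" for l by (induction l) auto
    ultimately show "wprod ws = 0" using k by simp
  qed
qed

section \<open>Root spaces\<close>

context ss_torus
begin

lemma rs_lie: "X \<in> root_space G A \<alpha> \<Longrightarrow> X \<in> lie G"
  by (simp add: root_space_def)

lemma rs_add: "X \<in> root_space G A \<alpha> \<Longrightarrow> Y \<in> root_space G A \<alpha> \<Longrightarrow> X + Y \<in> root_space G A \<alpha>"
  by (simp add: root_space_def lie_add bracket_add_right msmult_add)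

lemma rs_msmult: "X \<in> root_space G A \<alpha> \<Longrightarrow> msmult c X \<in> root_space G A \<alpha>"
  by (simp add: root_space_def lie_msmult bracket_msmult_right msmult_msmult mult.commute)

lemma rs_zero: "0 \<in> root_space G A \<alpha>"
  by (simp add: root_space_def)

lemma rs_bracket:
  assumes "X \<in> root_space G A \<alpha>" "Y \<in> root_space G A \<beta>"
  shows "bracket X Y \<in> root_space G A (\<alpha> + \<beta>)"
proof -
  have "bracket H (bracket X Y) = msmult ((\<alpha> + \<beta>) H) (bracket X Y)" if "H \<in> lie A" for H
    using assms that jacobi[of H X Y]
    by (simp add: root_space_def bracket_msmult_left bracket_msmult_right msmult_add_left algebra_simps)
  then show ?thesis using assms by (simp add: root_space_def lie_bracket[OF algG])
qed

lemma roots_outside: "\<alpha> \<in> roots G A \<Longrightarrow> H \<notin> lie A \<Longrightarrow> \<alpha> H = 0"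
  by (simp add: roots_def)

lemma roots_nonzero:
  assumes "\<alpha> \<in> roots G A" obtains H where "H \<in> lie A" "\<alpha> H \<noteq> 0"
  using assms by (auto simp: roots_def fun_eq_iff)

lemma zero_not_root: "0 \<notin> roots G A"
  by (simp add: roots_def)

lemma rs_no_root:
  assumes "\<And>H. H \<notin> lie A \<Longrightarrow> \<alpha> H = 0" "\<alpha> \<notin> roots G A \<union> {0}" "X \<in> root_space G A \<alpha>"
  shows "X = 0"
  using assms by (auto simp: roots_def)

lemma rs_bracket_zero:
  assumes "\<alpha> \<in> roots G A" "\<beta> \<in> roots G A" "\<alpha> + \<beta> \<notin> roots G A \<union> {0}"
    "X \<in> root_space G A \<alpha>" "Y \<in> root_space G A \<beta>"
  shows "bracket X Y = 0"
  using rs_no_root[OF _ assms(3) rs_bracket[OF assms(4,5)]] roots_outside[OF assms(1)] roots_outside[OF assms(2)] by simp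

lemma rs_0: "X \<in> root_space G A 0 \<Longrightarrow> X \<in> lie A"
  using centralizer_lieA cent_root_space[of X] by (simp add: zero_fun_def)

lemma root_wt:
  assumes "\<alpha> \<in> roots G A" obtains i j where "wt i j \<alpha>"
proof -
  obtain X where X: "X \<in> root_space G A \<alpha>" "X \<noteq> 0" using assms by (auto simp: roots_def)
  then have "cj P X \<noteq> cj P 0" using cj_eq_iff[OF P] by blast
  then obtain i j where "cj P X $ i $ j \<noteq> 0" by (auto simp: vec_eq_iff)
  then show ?thesis using root_space_entry[OF X(1)] that by blast
qed

lemma finite_roots: "finite (roots G A)"
proof (rule finite_subset)
  show "roots G A \<subseteq> range (\<lambda>(i, j) H. if H \<in> lie A then ev H i - ev H j else 0)"
  proof
    fix \<alpha> assume \<alpha>: "\<alpha> \<in> roots G A"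
    then obtain i j where "wt i j \<alpha>" by (rule root_wt)
    then have "\<alpha> = (\<lambda>(i, j) H. if H \<in> lie A then ev H i - ev H j else 0) (i, j)"
      using roots_outside[OF \<alpha>] by (auto simp: wt_def fun_eq_iff)
    then show "\<alpha> \<in> range (\<lambda>(i, j) H. if H \<in> lie A then ev H i - ev H j else 0)" by blast
  qed
qed simp

section \<open>Duality, coroots and sl2-triples\<close>

lemma rs_dual:
  assumes "X \<in> root_space G A \<alpha>" "X \<noteq> 0"
  obtains Y where "Y \<in> root_space G A (- \<alpha>)" "trace (X ** Y) = 1"
proof -
  have "X \<notin> rad" using rad_trivial assms(2) by blast
  then obtain Y where Y: "Y \<in> lie G" "trace (X ** Y) \<noteq> 0" using rs_lie[OF assms(1)] by (auto simp: rad_def)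
  define Z where "Z = wcomp (- \<alpha>) Y"
  have Z: "Z \<in> root_space G A (- \<alpha>)" unfolding Z_def using Y(1) by (rule wcomp_root_space)
  have tr: "trace (X ** Z) \<noteq> 0" using Y(2) trace_wcomp[OF assms(1), of "- \<alpha>" Y] by (simp add: Z_def)
  show ?thesis
    by (rule that[of "msmult (1 / trace (X ** Z)) Z"]) (simp_all add: rs_msmult Z msmult_mult trace_msmult tr)
qed

lemma roots_neg:
  assumes "\<alpha> \<in> roots G A" shows "- \<alpha> \<in> roots G A"
proof -
  obtain X where X: "X \<in> root_space G A \<alpha>" "X \<noteq> 0" using assms by (auto simp: roots_def)
  obtain Y where Y: "Y \<in> root_space G A (- \<alpha>)" "trace (X ** Y) = 1" using rs_dual[OF X] .
  then have "Y \<noteq> 0" by auto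
  moreover have "- \<alpha> \<noteq> 0" using assms zero_not_root by (metis neg_equal_0_iff_equal)
  ultimately show ?thesis using Y(1) roots_outside[OF assms] by (auto simp: roots_def)
qed

text \<open>\<open>t\<close> represents \<alpha> through the trace form. The presentation as a
  bracket of opposite root vectors is recorded because it produces the sl2-triple.\<close>

definition dual_elt :: "(complex^'n^'n \<Rightarrow> complex) \<Rightarrow> complex^'n^'n \<Rightarrow> complex^'n^'n \<Rightarrow> complex^'n^'n \<Rightarrow> bool" where
  "dual_elt \<alpha> t x y \<longleftrightarrow> x \<in> root_space G A \<alpha> \<and> y \<in> root_space G A (- \<alpha>) \<and> t = bracket x y \<and> t \<in> lie A
     \<and> (\<forall>H\<in>lie A. trace (t ** H) = \<alpha> H)"

lemma dual_elt_exists: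
  assumes "\<alpha> \<in> roots G A" shows "\<exists>t x y. dual_elt \<alpha> t x y"
proof -
  obtain x where x: "x \<in> root_space G A \<alpha>" "x \<noteq> 0" using assms by (auto simp: roots_def)
  obtain y where y: "y \<in> root_space G A (- \<alpha>)" "trace (x ** y) = 1" using rs_dual[OF x] .
  have "bracket x y \<in> lie A" using rs_bracket[OF x(1) y(1)] rs_0 by simp
  moreover have "trace (bracket x y ** H) = \<alpha> H" if H: "H \<in> lie A" for H
  proof -
    have "bracket y H = msmult (\<alpha> H) y"
      using y(1) H bracket_anti[of y H] by (simp add: root_space_def msmult_minus)
    then show ?thesis using y(2) by (simp add: trace_bracket msmult_mult trace_msmult)
  qed
  ultimately show ?thesis using x(1) y(1) by (auto simp: dual_elt_def)
qed

definition dual_vec :: "(complex^'n^'n \<Rightarrow> complex) \<Rightarrow> complex^'n^'n" where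
  "dual_vec \<alpha> = (SOME t. \<exists>x y. dual_elt \<alpha> t x y)"

lemma dual_vec:
  assumes "\<alpha> \<in> roots G A" obtains x y where "dual_elt \<alpha> (dual_vec \<alpha>) x y"
proof -
  have "\<exists>x y. dual_elt \<alpha> (dual_vec \<alpha>) x y" unfolding dual_vec_def using dual_elt_exists[OF assms] by (rule someI_ex)
  then show ?thesis using that by blast
qed

lemma dual_vec_lie: "\<alpha> \<in> roots G A \<Longrightarrow> dual_vec \<alpha> \<in> lie A"
  and dual_vec_trace: "\<alpha> \<in> roots G A \<Longrightarrow> H \<in> lie A \<Longrightarrow> trace (dual_vec \<alpha> ** H) = \<alpha> H"
  using dual_vec[of \<alpha>] unfolding dual_elt_def by metis+

lemma dual_vec_sym: "\<alpha> \<in> roots G A \<Longrightarrow> \<beta> \<in> roots G A \<Longrightarrow> \<alpha> (dual_vec \<beta>) = \<beta> (dual_vec \<alpha>)"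
  using dual_vec_trace[of \<alpha> "dual_vec \<beta>"] dual_vec_trace[of \<beta> "dual_vec \<alpha>"] dual_vec_lie trace_mul_sym[of "dual_vec \<alpha>" "dual_vec \<beta>"] by simp

text \<open>If \<alpha> vanished on t = [x, y], then t would commute with x, and so would the matrix
  B with conjugated eigenvalues. Then tr(t B) = 0, a sum of squared moduli, forces t = 0, although t
  represents a nonzero root.\<close>

lemma dual_vec_nonzero: assumes "\<alpha> \<in> roots G A" shows "\<alpha> (dual_vec \<alpha>) \<noteq> 0"
proof
  assume 0: "\<alpha> (dual_vec \<alpha>) = 0"
  obtain x y where xy: "dual_elt \<alpha> (dual_vec \<alpha>) x y" using dual_vec[OF assms] .
  define t where "t = dual_vec \<alpha>"
  have t: "t \<in> lie A" "t = bracket x y" using xy by (auto simp: dual_elt_def t_def)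
  define B where "B = dg P (cnj \<circ> ev t)"
  have "bracket t x = 0" using xy 0 t(1) by (simp add: dual_elt_def root_space_def t_def)
  then have "dg P (ev t) ** x = x ** dg P (ev t)" using lieA_dg[OF t(1)] bracket_eq_0D by metis
  then have "B ** x = x ** B" unfolding B_def by (rule dg_commute_comp[OF P])
  then have "trace (y ** x ** B) = trace (y ** B ** x)" by (metis matrix_mul_assoc)
  also have "\<dots> = trace (x ** y ** B)" by (metis matrix_mul_assoc trace_mul_sym)
  finally have "trace (t ** B) = 0" unfolding t(2) by (simp add: bracket_def matrix_ring_simps trace_sub)
  moreover have "t ** B = dg P (\<lambda>i. ev t i * cnj (ev t i))"
    using lieA_dg[OF t(1)] dg_mult[OF P, of "ev t" "cnj \<circ> ev t"] by (simp add: B_def)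
  ultimately have "(\<Sum>i\<in>UNIV. ev t i * cnj (ev t i)) = 0" by (simp add: trace_dg P)
  then have "of_real (\<Sum>i\<in>UNIV. (cmod (ev t i))\<^sup>2) = (0::complex)" by (simp only: of_real_sum complex_norm_square)
  then have "(\<Sum>i\<in>UNIV. (cmod (ev t i))\<^sup>2) = 0" by (simp only: of_real_eq_0_iff)
  then have "ev t i = 0" for i by (subst (asm) sum_nonneg_eq_0_iff) auto
  then have "ev t = (\<lambda>_. 0)" by auto
  then have "t = 0" using lieA_dg[OF t(1)] by (metis dg_zero)
  then show False using roots_nonzero[OF assms] dual_vec_trace[OF assms] by (metis matrix_mult_zero(1) t_def trace_zero)
qed

lemma root_space_nilp:
  assumes "\<alpha> \<in> roots G A" "X \<in> root_space G A \<alpha>" shows "nilp X"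
proof -
  obtain H where H: "H \<in> lie A" "\<alpha> H \<noteq> 0" using roots_nonzero[OF assms(1)] .
  then show ?thesis
    using root_space_entry[OF assms(2)] by (intro graded_nilp[OF P H(2), of X "ev H"]) (auto simp: wt_def)
qed

definition coroot :: "(complex^'n^'n \<Rightarrow> complex) \<Rightarrow> complex^'n^'n" where
  "coroot \<alpha> = msmult (2 / \<alpha> (dual_vec \<alpha>)) (dual_vec \<alpha>)"

lemma coroot_lie: "\<alpha> \<in> roots G A \<Longrightarrow> coroot \<alpha> \<in> lie A"
  by (simp add: coroot_def lie_msmult dual_vec_lie)

lemma lieA_linear:
  assumes "\<rho> \<in> roots G A" "H \<in> lie A"
  shows "\<rho> (msmult c H) = c * \<rho> H"
  using dual_vec_trace[OF assms(1), of "msmult c H"] dual_vec_trace[OF assms] assms(2)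
  by (simp add: lie_msmult msmult_mult trace_msmult)

lemma root_coroot: "\<rho> \<in> roots G A \<Longrightarrow> \<alpha> \<in> roots G A \<Longrightarrow> \<rho> (coroot \<alpha>) = 2 * \<rho> (dual_vec \<alpha>) / \<alpha> (dual_vec \<alpha>)"
  by (simp add: coroot_def lieA_linear dual_vec_lie)

lemma sl2_triple:
  assumes "\<alpha> \<in> roots G A"
  obtains e f where "e \<in> root_space G A \<alpha>" "f \<in> root_space G A (- \<alpha>)" "bracket e f = coroot \<alpha>"
    "bracket (coroot \<alpha>) e = msmult 2 e" "bracket (coroot \<alpha>) f = msmult (- 2) f" "nilp e" "nilp f"
proof -
  obtain x y where xy: "dual_elt \<alpha> (dual_vec \<alpha>) x y" using dual_vec[OF assms] .
  define f where "f = msmult (2 / \<alpha> (dual_vec \<alpha>)) y"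
  have x: "x \<in> root_space G A \<alpha>" and f: "f \<in> root_space G A (- \<alpha>)"
    using xy by (auto simp: dual_elt_def f_def rs_msmult)
  have 2: "\<alpha> (coroot \<alpha>) = 2" using root_coroot[OF assms assms] dual_vec_nonzero[OF assms] by simp
  show ?thesis
  proof (rule that[OF x f])
    show "bracket x f = coroot \<alpha>" using xy by (simp add: f_def coroot_def dual_elt_def bracket_msmult_right)
    show "bracket (coroot \<alpha>) x = msmult 2 x" "bracket (coroot \<alpha>) f = msmult (- 2) f"
      using x f coroot_lie[OF assms] 2 by (simp_all add: root_space_def)
    show "nilp x" "nilp f" using root_space_nilp x f assms roots_neg by blast+
  qed
qed

text \<open>In the natural representation the i-th eigenvector is raised by \<open>e\<close> as long
  as it stays nonzero; the resulting highest weight vector has weight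
  \<open>ev h i + 2 * of_nat k\<close>, a natural number.\<close>

lemma ev_coroot_int:
  assumes "\<alpha> \<in> roots G A" shows "ev (coroot \<alpha>) i \<in> \<int>"
proof -
  obtain e f where ef: "bracket e f = coroot \<alpha>" "bracket (coroot \<alpha>) e = msmult 2 e" "bracket (coroot \<alpha>) f = msmult (- 2) f"
    "nilp e" "nilp f" using sl2_triple[OF assms] by metis
  define h where "h = coroot \<alpha>"
  have he: "h ** e = e ** h + msmult 2 e" and hf: "h ** f = f ** h - msmult 2 f" and eff: "e ** f = f ** e + h"
    using ef(1-3) by (simp_all add: bracket_def h_def algebra_simps msmult_minus)
  define v where "v = P *v axis i 1"
  have "h ** P = P ** diagm (ev h)"
  proof -
    have "h ** P = dg P (ev h) ** P" using lieA_dg[OF coroot_lie[OF assms]] by (simp add: h_def)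
    also have "\<dots> = P ** diagm (ev h) ** (matrix_inv P ** P)" by (simp add: dg_def uncj_def matrix_mul_assoc)
    finally show ?thesis by (simp add: matrix_inv_left P)
  qed
  then have "h *v v = P *v (diagm (ev h) *v axis i 1)" by (simp add: v_def matrix_vector_mul_assoc)
  also have "diagm (ev h) *v axis i 1 = ev h i *s axis i 1"
  proof -
    have "(diagm (ev h) *v axis i 1) $ j = (ev h i *s axis i 1) $ j" for j
      unfolding diagm_mult_vec_nth by (simp add: axis_def)
    then show ?thesis by (simp add: vec_eq_iff)
  qed
  finally have hv: "h *v v = ev h i *s v" by (simp only: v_def vec.scale)
  have v0: "v \<noteq> 0"
  proof
    assume "v = 0"
    then have "matrix_inv P *v v = 0" by simp
    then have "(axis i 1 :: complex^'n) = 0" by (simp add: v_def matrix_vector_mul_assoc matrix_inv_left P)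
    then show False by (simp add: axis_eq_0_iff)
  qed
  have he_vec: "(h ** e) *v w = e *v (h *v w) + 2 *s (e *v w)" for w
  proof -
    have "msmult 2 e *v w = 2 *s (e *v w)"
      by (simp add: vec_eq_iff matrix_vector_mult_def sum_distrib_left mult_ac)
    then show ?thesis unfolding he by (simp only: matrix_vector_mult_add_rdistrib matrix_vector_mul_assoc)
  qed
  have hek: "h *v (mpow e k *v v) = (ev h i + 2 * of_nat k) *s (mpow e k *v v)" for k
  proof (induction k)
    case 0
    show ?case by (simp add: hv)
  next
    case (Suc k)
    have "h *v (mpow e (Suc k) *v v) = (h ** e) *v (mpow e k *v v)" by (simp add: matrix_vector_mul_assoc matrix_mul_assoc)
    also have "\<dots> = e *v (h *v (mpow e k *v v)) + 2 *s (e *v (mpow e k *v v))" by (rule he_vec)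
    also have "\<dots> = (ev h i + 2 * of_nat k) *s (e *v (mpow e k *v v)) + 2 *s (e *v (mpow e k *v v))"
      unfolding Suc by (simp only: vec.scale)
    also have "\<dots> = (ev h i + 2 * of_nat (Suc k)) *s (mpow e (Suc k) *v v)"
      by (simp add: vec_eq_iff matrix_vector_mul_assoc algebra_simps)
    finally show ?case .
  qed
  obtain k0 where "mpow e k0 = 0" using ef(4) by (auto simp: nilp_def)
  then have "mpow e k0 *v v = 0" by simp
  then obtain K where K: "mpow e K *v v = 0" "\<And>j. j < K \<Longrightarrow> mpow e j *v v \<noteq> 0"
    using exists_least_iff[of "\<lambda>k. mpow e k *v v = 0"] by blast
  then obtain k where k: "K = Suc k" using v0 by (cases K) auto
  define w where "w = mpow e k *v v"
  obtain l where "mpow f l = 0" using ef(5) by (auto simp: nilp_def)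
  then have "((\<lambda>u. f *v u) ^^ l) w = 0"
  proof -
    have "((\<lambda>u. f *v u) ^^ l) w = mpow f l *v w" for l
      by (induction l) (simp_all add: matrix_vector_mul_assoc)
    then show ?thesis using \<open>mpow f l = 0\<close> by simp
  qed
  moreover have "w \<noteq> 0" "e *v w = 0" using K k by (simp_all add: w_def matrix_vector_mul_assoc)
  moreover have "h *v w = (ev h i + 2 * of_nat k) *s w" using hek by (simp add: w_def)
  moreover have "e *v (f *v u) = f *v (e *v u) + h *v u" for u
    using eff by (simp add: matrix_vector_mul_assoc matrix_vector_mult_add_rdistrib)
  moreover have "h *v (f *v u) = f *v (h *v u) - 2 *s (f *v u)" for u
  proof -
    have "msmult 2 f *v u = 2 *s (f *v u)"
      by (simp add: vec_eq_iff matrix_vector_mult_def sum_distrib_left mult_ac)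
    then show ?thesis using hf by (simp add: matrix_vector_mul_assoc matrix_vector_mult_diff_rdistrib)
  qed
  ultimately have "\<exists>n::nat. ev h i + 2 * of_nat k = of_nat n"
    by (intro sl2_highest_weight[of "(*s)" "\<lambda>u. e *v u" "\<lambda>u. f *v u" "\<lambda>u. h *v u" w _ l])
      (simp_all add: vec.vector_space_axioms vec.scale)
  then obtain n :: nat where "ev h i = of_nat n - 2 * of_nat k" by (metis add_diff_cancel_right')
  then show ?thesis by (simp add: h_def)
qed

text \<open>For the coroot h, tr(h h) is computed in two ways: as a sum of squares of integers, and
  as \<open>4 / \<alpha> (dual_vec \<alpha>)\<close>.\<close>

lemma dual_vec_norm_pos:
  assumes "\<alpha> \<in> roots G A" obtains q :: real where "q > 0" "\<alpha> (dual_vec \<alpha>) = of_real q"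
proof -
  define h where "h = coroot \<alpha>"
  have "\<exists>z. ev h i = of_int z" for i using ev_coroot_int[OF assms, of i] by (auto simp: h_def Ints_def)
  then obtain z where z: "\<And>i. ev h i = of_int (z i)" by metis
  have hd: "h = dg P (ev h)" using lieA_dg[OF coroot_lie[OF assms]] by (simp add: h_def)
  have "trace (h ** h) = trace (dg P (ev h) ** dg P (ev h))" using hd by simp
  also have "\<dots> = (\<Sum>i\<in>UNIV. ev h i * ev h i)" by (simp only: dg_mult[OF P] trace_dg[OF P])
  finally have "trace (h ** h) = of_real (\<Sum>i\<in>UNIV. (real_of_int (z i))\<^sup>2)" by (simp add: z power2_eq_square)
  moreover have "trace (h ** h) = 4 / \<alpha> (dual_vec \<alpha>)"
  proof -
    have "trace (h ** h) = (2 / \<alpha> (dual_vec \<alpha>)) * (2 / \<alpha> (dual_vec \<alpha>)) * trace (dual_vec \<alpha> ** dual_vec \<alpha>)"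
      by (simp add: h_def coroot_def msmult_mult trace_msmult)
    then show ?thesis using dual_vec_trace[OF assms dual_vec_lie[OF assms]] dual_vec_nonzero[OF assms] by simp
  qed
  ultimately have eq: "\<alpha> (dual_vec \<alpha>) * of_real (\<Sum>i\<in>UNIV. (real_of_int (z i))\<^sup>2) = 4"
    using dual_vec_nonzero[OF assms] by (simp add: field_simps)
  define s where "s = (\<Sum>i\<in>UNIV. (real_of_int (z i))\<^sup>2)"
  have "s \<noteq> 0" using eq by (auto simp: s_def[symmetric])
  moreover have "s \<ge> 0" unfolding s_def by (intro sum_nonneg) simp
  ultimately have "s > 0" by simp
  moreover have "\<alpha> (dual_vec \<alpha>) = of_real (4 / s)" using eq \<open>s \<noteq> 0\<close> by (simp add: s_def[symmetric] field_simps)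
  ultimately show ?thesis by (intro that[of "4 / s"]) simp_all
qed

text \<open>Otherwise \<open>f\<close> kills a root vector of \<rho>, which is then a lowest weight
  vector. With \<open>e\<close> and \<open>f\<close> exchanged and the sign of the coroot reversed,
  \<open>sl2_highest_weight\<close> makes \<open>- \<rho> (coroot \<alpha>)\<close> a natural
  number.\<close>

lemma root_subtract:
  assumes \<alpha>: "\<alpha> \<in> roots G A" and \<rho>: "\<rho> \<in> roots G A" and pos: "Re (\<rho> (coroot \<alpha>)) > 0"
  shows "\<rho> - \<alpha> \<in> roots G A \<union> {0}"
proof (rule ccontr)
  assume n: "\<rho> - \<alpha> \<notin> roots G A \<union> {0}"
  obtain e f where ef: "e \<in> root_space G A \<alpha>" "f \<in> root_space G A (- \<alpha>)" "bracket e f = coroot \<alpha>"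
    "bracket (coroot \<alpha>) e = msmult 2 e" "nilp e" using sl2_triple[OF \<alpha>] by metis
  obtain z where z: "z \<in> root_space G A \<rho>" "z \<noteq> 0" using \<rho> by (auto simp: roots_def)
  have fz: "bracket f z = 0"
    by (rule rs_bracket_zero[OF roots_neg[OF \<alpha>] \<rho> _ ef(2) z(1)]) (use n in simp)
  obtain N where N: "\<And>ss w. set ss \<subseteq> {e} \<Longrightarrow> N \<le> length ss \<Longrightarrow> foldr bracket ss w = 0"
    using foldr_bracket_zero[OF wnil_nilp_singleton[OF ef(5)]] by blast
  have "foldr bracket (replicate k e) z = (bracket e ^^ k) z" for k by (induction k) auto
  moreover have "set (replicate N e) \<subseteq> {e}" by (simp add: set_replicate_conv_if)
  ultimately have nil: "(bracket e ^^ N) z = 0" using N[of "replicate N e" z] by simp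
  have "\<exists>n::nat. - \<rho> (coroot \<alpha>) = of_nat n"
  proof (rule sl2_highest_weight[of msmult "bracket f" "bracket e" "\<lambda>w. - bracket (coroot \<alpha>) w" z _ N])
    show "bracket f (bracket e w) = bracket e (bracket f w) + - bracket (coroot \<alpha>) w" for w
      using jacobi[of e f w] ef(3) by simp
    show "- bracket (coroot \<alpha>) (bracket e w) = bracket e (- bracket (coroot \<alpha>) w) - msmult 2 (bracket e w)" for w
    proof -
      have "bracket e (- bracket (coroot \<alpha>) w) = - bracket e (bracket (coroot \<alpha>) w)"
        using bracket_msmult_right[of e "- 1" "bracket (coroot \<alpha>) w"] by (simp add: msmult_minus)
      then show ?thesis using jacobi[of "coroot \<alpha>" e w] ef(4) by (simp add: bracket_msmult_left)
    qed
    show "- bracket (coroot \<alpha>) z = msmult (- \<rho> (coroot \<alpha>)) z"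
      using z(1) coroot_lie[OF \<alpha>] by (simp add: root_space_def msmult_minus)
  qed (simp_all add: vector_space_msmult bracket_msmult_right fz z nil)
  then obtain n :: nat where "\<rho> (coroot \<alpha>) = - of_nat n" by (metis minus_minus)
  then show False using pos by simp
qed

text \<open>Both X and Y kill a root vector of \<delta>, hence so does [X, Y], which acts on it by
  the scalar \<delta>([X, Y]). Arbitrary X and Y are allowed because coefficients of lattice
  elements are inserted later.\<close>

lemma strongly_orthogonal_dual_vec:
  assumes \<alpha>: "\<alpha> \<in> roots G A" and \<delta>: "\<delta> \<in> roots G A" and so: "strongly_orthogonal (roots G A) \<alpha> \<delta>"
  shows "X \<in> root_space G A \<alpha> \<Longrightarrow> Y \<in> root_space G A (- \<alpha>) \<Longrightarrow> \<delta> (bracket X Y) = 0" "\<delta> (dual_vec \<alpha>) = 0"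
proof -
  obtain z where z: "z \<in> root_space G A \<delta>" "z \<noteq> 0" using \<delta> by (auto simp: roots_def)
  have s: "\<alpha> + \<delta> \<notin> roots G A \<union> {0}" "\<alpha> - \<delta> \<notin> roots G A \<union> {0}" using so by (auto simp: strongly_orthogonal_def)
  have s': "- \<alpha> + \<delta> \<notin> roots G A \<union> {0}"
  proof
    assume "- \<alpha> + \<delta> \<in> roots G A \<union> {0}"
    then have "- (- \<alpha> + \<delta>) \<in> roots G A \<union> {0}" using roots_neg[of "- \<alpha> + \<delta>"] by auto
    moreover have "- (- \<alpha> + \<delta>) = \<alpha> - \<delta>" by simp
    ultimately show False using s(2) by metis
  qed
  show 1: "\<delta> (bracket X Y) = 0" if X: "X \<in> root_space G A \<alpha>" and Y: "Y \<in> root_space G A (- \<alpha>)" for X Y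
  proof -
    have "bracket X z = 0" using rs_bracket_zero[OF \<alpha> \<delta> s(1) X z(1)] .
    moreover have "bracket Y z = 0" using rs_bracket_zero[OF roots_neg[OF \<alpha>] \<delta> s' Y z(1)] .
    ultimately have "bracket (bracket X Y) z = 0" by (simp add: jacobi)
    moreover have "bracket X Y \<in> lie A" using rs_bracket[OF X Y] rs_0 by simp
    ultimately have "msmult (\<delta> (bracket X Y)) z = 0" using z(1) by (simp add: root_space_def)
    then show ?thesis using z(2) by (simp add: msmult_eq_0_iff)
  qed
  obtain x y where "dual_elt \<alpha> (dual_vec \<alpha>) x y" using dual_vec[OF \<alpha>] .
  then show "\<delta> (dual_vec \<alpha>) = 0" using 1[of x y] by (simp add: dual_elt_def)
qed

lemma pos_pairing_subtract:
  assumes \<alpha>: "\<alpha> \<in> roots G A" and \<rho>: "\<rho> \<in> roots G A" and pos: "Re (\<rho> (dual_vec \<alpha>)) > 0"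
  shows "\<rho> - \<alpha> \<in> roots G A \<union> {0}"
proof (rule root_subtract[OF \<alpha> \<rho>])
  obtain q where q: "q > 0" "\<alpha> (dual_vec \<alpha>) = of_real q" using dual_vec_norm_pos[OF \<alpha>] .
  have "\<rho> (coroot \<alpha>) = of_real (2 / q) * \<rho> (dual_vec \<alpha>)" using root_coroot[OF \<rho> \<alpha>] q by simp
  then have "Re (\<rho> (coroot \<alpha>)) = (2 / q) * Re (\<rho> (dual_vec \<alpha>))" by simp
  then show "Re (\<rho> (coroot \<alpha>)) > 0" using q pos by simp
qed

text \<open>Suppose \<rho> = \<alpha> + \<beta> + \<epsilon> were a root or 0, with \<epsilon> =
  \<delta> or -\<delta>. As \<epsilon> vanishes on the dual vector of \<alpha> + \<beta>, \<rho> is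
  positive there, so it has positive real part on the dual vector of \<alpha> or of \<beta>.
  Subtracting that root leaves \<beta> + \<epsilon> or \<alpha> + \<epsilon>, which are
  excluded.\<close>

theorem strongly_orthogonal_add:
  assumes \<alpha>: "\<alpha> \<in> roots G A" and \<beta>: "\<beta> \<in> roots G A" and \<gamma>: "\<alpha> + \<beta> \<in> roots G A" and \<delta>: "\<delta> \<in> roots G A"
    and so: "strongly_orthogonal (roots G A) \<alpha> \<delta>" "strongly_orthogonal (roots G A) \<beta> \<delta>"
  shows "strongly_orthogonal (roots G A) (\<alpha> + \<beta>) \<delta>"
proof -
  have ad: "(\<alpha> + \<beta>) (dual_vec \<rho>) = \<rho> (dual_vec (\<alpha> + \<beta>))" "(\<alpha> + \<beta>) (dual_vec \<rho>) = \<rho> (dual_vec \<alpha>) + \<rho> (dual_vec \<beta>)"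
    if "\<rho> \<in> roots G A" for \<rho>
    using dual_vec_sym[OF \<gamma> that] dual_vec_sym[OF \<alpha> that] dual_vec_sym[OF \<beta> that] by auto
  have \<delta>0: "\<delta> (dual_vec (\<alpha> + \<beta>)) = 0"
    using ad[OF \<delta>] strongly_orthogonal_dual_vec(2)[OF \<alpha> \<delta> so(1)] strongly_orthogonal_dual_vec(2)[OF \<beta> \<delta> so(2)] by simp
  obtain q where q: "q > 0" "(\<alpha> + \<beta>) (dual_vec (\<alpha> + \<beta>)) = of_real q" using dual_vec_norm_pos[OF \<gamma>] .
  have key: "\<alpha> + \<beta> + \<epsilon> \<notin> roots G A \<union> {0}"
    if \<epsilon>: "\<epsilon> (dual_vec (\<alpha> + \<beta>)) = 0" "\<alpha> + \<epsilon> \<notin> roots G A \<union> {0}" "\<beta> + \<epsilon> \<notin> roots G A \<union> {0}" for \<epsilon>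
  proof
    define \<rho> where "\<rho> = \<alpha> + \<beta> + \<epsilon>"
    assume "\<alpha> + \<beta> + \<epsilon> \<in> roots G A \<union> {0}"
    moreover have "\<rho> (dual_vec (\<alpha> + \<beta>)) = of_real q" using q(2) \<epsilon>(1) by (simp add: \<rho>_def)
    then have "\<rho> \<noteq> 0" using q(1) by auto
    ultimately have \<rho>: "\<rho> \<in> roots G A" by (simp add: \<rho>_def)
    have "Re (\<rho> (dual_vec \<alpha>)) + Re (\<rho> (dual_vec \<beta>)) = q"
      using ad[OF \<rho>] \<open>\<rho> (dual_vec (\<alpha> + \<beta>)) = of_real q\<close> by (metis Re_complex_of_real plus_complex.sel(1))
    then consider "Re (\<rho> (dual_vec \<alpha>)) > 0" | "Re (\<rho> (dual_vec \<beta>)) > 0" using q(1) by linarith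
    then show False
    proof cases
      case 1
      then have "\<rho> - \<alpha> \<in> roots G A \<union> {0}" by (rule pos_pairing_subtract[OF \<alpha> \<rho>])
      moreover have "\<rho> - \<alpha> = \<beta> + \<epsilon>" by (simp add: \<rho>_def algebra_simps)
      ultimately show False using \<epsilon>(3) by simp
    next
      case 2
      then have "\<rho> - \<beta> \<in> roots G A \<union> {0}" by (rule pos_pairing_subtract[OF \<beta> \<rho>])
      moreover have "\<rho> - \<beta> = \<alpha> + \<epsilon>" by (simp add: \<rho>_def algebra_simps)
      ultimately show False using \<epsilon>(2) by simp
    qed
  qed
  show ?thesis
    using key[of \<delta>] key[of "- \<delta>"] \<delta>0 so by (simp add: strongly_orthogonal_def)
qed

end

section \<open>Root valuation functions\<close>

locale rv_roots =
  fixes R :: "('b \<Rightarrow> complex) set" and r :: "('b \<Rightarrow> complex) \<Rightarrow> int"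
  assumes fin: "finite R" and neg: "\<And>\<alpha>. \<alpha> \<in> R \<Longrightarrow> - \<alpha> \<in> R" and zero: "0 \<notin> R"
    and so_add: "\<And>\<alpha> \<beta> \<delta>. \<alpha> \<in> R \<Longrightarrow> \<beta> \<in> R \<Longrightarrow> \<alpha> + \<beta> \<in> R \<Longrightarrow> \<delta> \<in> R \<Longrightarrow>
      strongly_orthogonal R \<alpha> \<delta> \<Longrightarrow> strongly_orthogonal R \<beta> \<delta> \<Longrightarrow> strongly_orthogonal R (\<alpha> + \<beta>) \<delta>"
    and rv: "root_valuation R r"
begin

lemma r_combination:
  assumes "finite T" "T \<subseteq> {\<beta>\<in>R. r \<beta> \<ge> m}" "\<alpha> \<in> R" "\<alpha> = (\<lambda>H. \<Sum>\<beta>\<in>T. of_rat (q \<beta>) * \<beta> H)"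
  shows "r \<alpha> \<ge> m"
proof -
  have "Q_closed R {\<alpha>\<in>R. r \<alpha> \<ge> m}" using rv by (simp add: root_valuation_def)
  then have "\<alpha> \<in> {\<alpha>\<in>R. r \<alpha> \<ge> m}" using assms unfolding Q_closed_def by blast
  then show ?thesis by simp
qed

lemma r_neg: "\<alpha> \<in> R \<Longrightarrow> r (- \<alpha>) = r \<alpha>"
proof -
  have le: "r \<alpha> \<le> r (- \<alpha>)" if "\<alpha> \<in> R" for \<alpha>
    using that neg by (intro r_combination[of "{\<alpha>}" _ _ "\<lambda>_. - 1"]) (auto simp: fun_eq_iff)
  assume "\<alpha> \<in> R"
  then show ?thesis using le[of \<alpha>] le[of "- \<alpha>"] neg by (simp add: antisym)
qed

lemma r_add:
  assumes "\<alpha> \<in> R" "\<beta> \<in> R" "\<alpha> + \<beta> \<in> R" shows "min (r \<alpha>) (r \<beta>) \<le> r (\<alpha> + \<beta>)"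
\<comment> \<open>Combinations range over sets, so equal summands need the coefficient 2 on a
  singleton.\<close>
proof (cases "\<alpha> = \<beta>")
  case True
  then show ?thesis using assms
    by (intro r_combination[of "{\<alpha>}" _ _ "\<lambda>_. 2"]) (auto simp: fun_eq_iff)
next
  case False
  then show ?thesis using assms
    by (intro r_combination[of "{\<alpha>, \<beta>}" _ _ "\<lambda>_. 1"]) (auto simp: fun_eq_iff)
qed

lemma so_neg: "strongly_orthogonal R (- \<alpha>) \<beta> \<longleftrightarrow> strongly_orthogonal R \<alpha> \<beta>"
proof -
  have "\<delta> \<in> R \<union> {0} \<longleftrightarrow> - \<delta> \<in> R \<union> {0}" for \<delta> using neg[of \<delta>] neg[of "- \<delta>"] by auto
  from this[of "- \<alpha> + \<beta>"] this[of "- \<alpha> - \<beta>"] show ?thesis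
    by (auto simp: strongly_orthogonal_def add.commute)
qed

lemma r_max_set: "finite {r \<beta> |\<beta>. \<beta> \<in> R \<and> \<not> strongly_orthogonal R \<alpha> \<beta>}"
  using fin by simp

lemma r_max_ge: "\<beta> \<in> R \<Longrightarrow> \<not> strongly_orthogonal R \<alpha> \<beta> \<Longrightarrow> r \<beta> \<le> r_max R r \<alpha>"
  unfolding r_max_def using r_max_set by (intro Max_ge) auto

lemma not_so_self: "\<not> strongly_orthogonal R \<alpha> \<alpha>"
  by (simp add: strongly_orthogonal_def)

lemma r_max_attained:
  assumes "\<alpha> \<in> R" obtains \<beta> where "\<beta> \<in> R" "\<not> strongly_orthogonal R \<alpha> \<beta>" "r_max R r \<alpha> = r \<beta>"
proof -
  have "r_max R r \<alpha> \<in> {r \<beta> |\<beta>. \<beta> \<in> R \<and> \<not> strongly_orthogonal R \<alpha> \<beta>}"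
    unfolding r_max_def using r_max_set not_so_self assms by (intro Max_in) auto
  then show ?thesis using that by auto
qed

lemma r_max_neg: "r_max R r (- \<alpha>) = r_max R r \<alpha>"
  by (simp add: r_max_def so_neg)

lemma r_max_add:
  assumes "\<alpha> \<in> R" "\<beta> \<in> R" "\<alpha> + \<beta> \<in> R"
  shows "r_max R r (\<alpha> + \<beta>) \<le> max (r_max R r \<alpha>) (r_max R r \<beta>)"
proof -
  obtain \<delta> where \<delta>: "\<delta> \<in> R" "\<not> strongly_orthogonal R (\<alpha> + \<beta>) \<delta>" "r_max R r (\<alpha> + \<beta>) = r \<delta>"
    using r_max_attained[OF assms(3)] .
  then have "\<not> strongly_orthogonal R \<alpha> \<delta> \<or> \<not> strongly_orthogonal R \<beta> \<delta>" using so_add assms by blast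
  then show ?thesis using r_max_ge[OF \<delta>(1), of \<alpha>] r_max_ge[OF \<delta>(1), of \<beta>] \<delta>(3) by auto
qed

text \<open>Among \<open>r \<alpha>\<close>, \<open>r \<beta>\<close>, \<open>r (\<alpha> + \<beta>)\<close> the minimum is attained at least twice, and none of them exceeds
  \<open>r_max \<alpha>\<close> or \<open>r_max \<beta>\<close>.\<close>

lemma r_max_ineq:
  assumes \<alpha>: "\<alpha> \<in> R" and \<beta>: "\<beta> \<in> R" and \<gamma>: "\<alpha> + \<beta> \<in> R"
  shows "r_max R r \<alpha> - r \<alpha> + (r_max R r \<beta> - r \<beta>) - (r_max R r (\<alpha> + \<beta>) - r (\<alpha> + \<beta>))
    \<ge> 2 * (r (\<alpha> + \<beta>) - min (r \<alpha>) (r \<beta>))"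
proof -
  define \<gamma> where "\<gamma> = \<alpha> + \<beta>"
  have \<gamma>R: "\<gamma> \<in> R" "- \<alpha> \<in> R" "- \<beta> \<in> R" using assms neg by (auto simp: \<gamma>_def)
  have e: "\<gamma> + - \<beta> = \<alpha>" "\<gamma> + - \<alpha> = \<beta>" by (auto simp: \<gamma>_def)
  have 1: "min (r \<alpha>) (r \<beta>) \<le> r \<gamma>" "min (r \<gamma>) (r \<beta>) \<le> r \<alpha>" "min (r \<gamma>) (r \<alpha>) \<le> r \<beta>"
    using r_add[OF \<alpha> \<beta> \<gamma>] r_add[OF \<gamma>R(1,3)] r_add[OF \<gamma>R(1,2)] \<alpha> \<beta> e r_neg
    by (auto simp: \<gamma>_def[symmetric])
  have 2: "r_max R r \<gamma> \<le> max (r_max R r \<alpha>) (r_max R r \<beta>)"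
    using r_max_add[OF \<alpha> \<beta> \<gamma>] by (simp add: \<gamma>_def)
  have so: "\<not> strongly_orthogonal R \<alpha> \<beta>" "\<not> strongly_orthogonal R \<beta> \<alpha>"
    "\<not> strongly_orthogonal R \<alpha> \<gamma>" "\<not> strongly_orthogonal R \<beta> \<gamma>"
    using \<gamma> \<gamma>R by (auto simp: strongly_orthogonal_def add.commute \<gamma>_def)
  have 3: "r \<alpha> \<le> r_max R r \<alpha>" "r \<beta> \<le> r_max R r \<alpha>" "r \<gamma> \<le> r_max R r \<alpha>"
    "r \<alpha> \<le> r_max R r \<beta>" "r \<beta> \<le> r_max R r \<beta>" "r \<gamma> \<le> r_max R r \<beta>"
    using so not_so_self \<alpha> \<beta> \<gamma>R(1) by (auto intro!: r_max_ge)
  \<comment> \<open>The minimum is the right form of the bound, since it equals the sum of the two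
    values minus their maximum.\<close>
  have "max (r \<alpha>) (max (r \<beta>) (r \<gamma>)) \<le> min (r_max R r \<alpha>) (r_max R r \<beta>)" using 3 by simp
  also have "\<dots> \<le> r_max R r \<alpha> + r_max R r \<beta> - r_max R r \<gamma>" using 2 by linarith
  finally have 4: "max (r \<alpha>) (max (r \<beta>) (r \<gamma>)) \<le> r_max R r \<alpha> + r_max R r \<beta> - r_max R r \<gamma>" .
  \<comment> \<open>When the minimum of three numbers occurs twice, their sum minus twice the
    minimum is their maximum.\<close>
  have "r \<gamma> + r \<alpha> + r \<beta> - 2 * min (r \<alpha>) (r \<beta>) \<le> max (r \<alpha>) (max (r \<beta>) (r \<gamma>))"
    using 1 by (auto simp: min_def max_def split: if_splits)
  from order_trans[OF this 4] show ?thesis unfolding \<gamma>_def[symmetric] by (simp add: algebra_simps)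
qed

lemma k0_neg_sum: "\<alpha> \<in> R \<Longrightarrow> k0 R r \<alpha> + k0 R r (- \<alpha>) = real_of_int (r_max R r \<alpha> - r \<alpha>)"
  by (simp add: k0_def r_max_neg r_neg)

lemma k1_ge_k0: "k0 R r \<alpha> \<le> real_of_int (k1 R r \<alpha>)"
  by (simp add: k1_def)

lemma k0_add:
  assumes "\<alpha> \<in> R" "\<beta> \<in> R" "\<alpha> + \<beta> \<in> R"
  shows "k0 R r \<alpha> + k0 R r \<beta> - k0 R r (\<alpha> + \<beta>) \<ge> real_of_int (r (\<alpha> + \<beta>) - min (r \<alpha>) (r \<beta>))"
proof -
  have "2 * real_of_int (r (\<alpha> + \<beta>) - min (r \<alpha>) (r \<beta>)) \<le> real_of_int
     (r_max R r \<alpha> - r \<alpha> + (r_max R r \<beta> - r \<beta>) - (r_max R r (\<alpha> + \<beta>) - r (\<alpha> + \<beta>)))"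
    using r_max_ineq[OF assms] by linarith
  then show ?thesis by (simp add: k0_def field_simps)
qed

lemma k1_neg_sum: "\<alpha> \<in> R \<Longrightarrow> k1 R r \<alpha> + k1 R r (- \<alpha>) \<ge> r_max R r \<alpha> - r \<alpha>"
proof -
  assume "\<alpha> \<in> R"
  then have "real_of_int (r_max R r \<alpha> - r \<alpha>) \<le> real_of_int (k1 R r \<alpha> + k1 R r (- \<alpha>))"
    using k0_neg_sum[of \<alpha>] k1_ge_k0[of \<alpha>] k1_ge_k0[of "- \<alpha>"] by linarith
  then show ?thesis by linarith
qed

text \<open>Rounding up the values at \<alpha> and \<beta> only helps; the value of
  \<open>k0\<close> at \<alpha> + \<beta> is bounded by an integer, hence so is its ceiling.\<close>

lemma k1_add:
  assumes "\<alpha> \<in> R" "\<beta> \<in> R" "\<alpha> + \<beta> \<in> R"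
  shows "k1 R r \<alpha> + k1 R r \<beta> - k1 R r (\<alpha> + \<beta>) \<ge> r (\<alpha> + \<beta>) - min (r \<alpha>) (r \<beta>)"
proof -
  have "k0 R r (\<alpha> + \<beta>) \<le> real_of_int (k1 R r \<alpha> + k1 R r \<beta> - (r (\<alpha> + \<beta>) - min (r \<alpha>) (r \<beta>)))"
    using k0_add[OF assms] k1_ge_k0[of \<alpha>] k1_ge_k0[of \<beta>] by linarith
  then have "k1 R r (\<alpha> + \<beta>) \<le> k1 R r \<alpha> + k1 R r \<beta> - (r (\<alpha> + \<beta>) - min (r \<alpha>) (r \<beta>))"
    unfolding k1_def[of R r "\<alpha> + \<beta>"] by (simp only: ceiling_le_iff)
  then show ?thesis by linarith
qed

end

section \<open>The lattice\<close>

text \<open>Lower bounds take the place of exact orders, so that all entries of a matrix product are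
  summed over one common range.\<close>

lemma fls_times_nth_bounds:
  fixes f g :: "complex fls"
  assumes f: "\<And>i. i < m \<Longrightarrow> fls_nth f i = 0" and g: "\<And>i. i < l \<Longrightarrow> fls_nth g i = 0"
  shows "fls_nth (f * g) n = (\<Sum>i=m..n - l. fls_nth f i * fls_nth g (n - i))"
proof (cases "f = 0 \<or> g = 0")
  case False
  then have "m \<le> fls_subdegree f" "l \<le> fls_subdegree g" using f g by (auto intro: fls_subdegree_geI)
  then show ?thesis
    unfolding fls_times_nth(2) by (intro sum.mono_neutral_left) auto
qed auto

section \<open>Coefficients of matrices over Laurent series\<close>

lemma coeff_mat_nth [simp]: "coeff_mat X k $ i $ j = fls_nth (X $ i $ j) k"
  by (simp add: coeff_mat_def)

lemma coeff_mat_eqI: "(\<And>k. coeff_mat X k = coeff_mat Y k) \<Longrightarrow> X = Y"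
  by (simp add: vec_eq_iff fls_eq_iff)

lemma coeff_mat_add: "coeff_mat (X + Y) k = coeff_mat X k + coeff_mat Y k"
  by (simp add: vec_eq_iff)

lemma coeff_mat_zero [simp]: "coeff_mat 0 k = 0"
  by (simp add: vec_eq_iff)

lemma coeff_mat_uminus: "coeff_mat (- X) k = - coeff_mat X k"
  by (simp add: vec_eq_iff)

definition low :: "int \<Rightarrow> complex fls^'n^'n \<Rightarrow> bool" where
  "low m X \<longleftrightarrow> (\<forall>k<m. coeff_mat X k = 0)"

lemma low_nth: "low m X \<Longrightarrow> k < m \<Longrightarrow> fls_nth (X $ i $ j) k = 0"
  unfolding low_def by (metis coeff_mat_nth zero_index)

lemma low_exists: "\<exists>m. low m X"
proof -
  define m where "m = Min (range (\<lambda>(i, j). fls_subdegree (X $ i $ j)))"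
  have "m \<le> fls_subdegree (X $ i $ j)" for i j
    unfolding m_def by (intro Min_le) (auto intro: range_eqI[of _ _ "(i, j)"])
  then have "coeff_mat X k $ i $ j = 0" if "k < m" for i j k
    using that by (simp add: order_less_le_trans)
  then show ?thesis unfolding low_def by (intro exI[of _ m]) (simp add: vec_eq_iff)
qed

lemma coeff_mat_mult:
  assumes "low m X" "low l Y"
  shows "coeff_mat (X ** Y) k = (\<Sum>a=m..k - l. coeff_mat X a ** coeff_mat Y (k - a))"
proof -
  have "fls_nth (X $ i $ b * Y $ b $ j) k = (\<Sum>a=m..k - l. fls_nth (X $ i $ b) a * fls_nth (Y $ b $ j) (k - a))"
    for i j b using low_nth assms by (intro fls_times_nth_bounds) blast+
  then show ?thesis
    by (simp add: vec_eq_iff matrix_matrix_mult_def fls_nth_sum) (simp add: sum.swap[of _ UNIV "{m..k - l}"])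
qed

lemma coeff_mat_bracket:
  assumes "low m X" "low l Y"
  shows "coeff_mat (bracket X Y) k = (\<Sum>a=m..k - l. bracket (coeff_mat X a) (coeff_mat Y (k - a)))"
proof -
  have "coeff_mat (Y ** X) k = (\<Sum>a=l..k - m. coeff_mat Y a ** coeff_mat X (k - a))"
    using assms by (intro coeff_mat_mult)
  also have "\<dots> = (\<Sum>a=m..k - l. coeff_mat Y (k - a) ** coeff_mat X a)"
    by (rule sum.reindex_bij_witness[of _ "\<lambda>a. k - a" "\<lambda>a. k - a"]) auto
  finally show ?thesis
    using coeff_mat_mult[OF assms, of k]
    by (simp add: bracket_def sum_subtractf) (simp add: vec_eq_iff)
qed

lemma coeff_mat_msmult:
  assumes "\<forall>k<m. fls_nth c k = 0" "low l X"
  shows "coeff_mat (msmult c X) k = (\<Sum>a=m..k - l. msmult (fls_nth c a) (coeff_mat X (k - a)))"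
proof -
  have "fls_nth (c * X $ i $ j) k = (\<Sum>a=m..k - l. fls_nth c a * fls_nth (X $ i $ j) (k - a))" for i j
    using assms(1) low_nth[OF assms(2)] by (intro fls_times_nth_bounds) auto
  then show ?thesis by (simp add: vec_eq_iff)
qed

lemma O_points_shift_iff: "X \<in> O_points_shift m V \<longleftrightarrow> (\<forall>k. coeff_mat X k \<in> V) \<and> low m X"
  by (auto simp: O_points_shift_def F_points_def low_def)

lemma O_points_shift_mono: "X \<in> O_points_shift m V \<Longrightarrow> l \<le> m \<Longrightarrow> X \<in> O_points_shift l V"
  by (auto simp: O_points_shift_iff low_def)

text \<open>The coefficients of the bracket are finite convolutions, so additive closure of
  \<open>Z\<close> suffices. The target will be a root space, {0} or the kernel of a root in
  \<open>lie A\<close>.\<close>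

lemma O_points_shift_bracket:
  assumes X: "X \<in> O_points_shift m V" and Y: "Y \<in> O_points_shift l W"
    and br: "\<And>x y. x \<in> V \<Longrightarrow> y \<in> W \<Longrightarrow> bracket x y \<in> Z"
    and Z: "0 \<in> Z" "\<And>x y. x \<in> Z \<Longrightarrow> y \<in> Z \<Longrightarrow> x + y \<in> Z"
  shows "bracket X Y \<in> O_points_shift (m + l) Z"
proof -
  have l: "low m X" "low l Y" using X Y by (auto simp: O_points_shift_iff)
  have sum: "(\<Sum>a\<in>I. f a) \<in> Z" if "\<And>a. f a \<in> Z" for f and I :: "int set"
    by (induction I rule: infinite_finite_induct) (auto simp: Z that)
  have "coeff_mat (bracket X Y) k \<in> Z" for k
    unfolding coeff_mat_bracket[OF l] using X Y by (intro sum br) (auto simp: O_points_shift_iff)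
  moreover have "low (m + l) (bracket X Y)"
    unfolding low_def by (auto simp: coeff_mat_bracket[OF l])
  ultimately show ?thesis by (simp add: O_points_shift_iff)
qed

lemma O_points_shift_msmult:
  assumes c: "\<forall>k<m. fls_nth c k = 0" and X: "X \<in> O_points_shift l V"
    and V: "0 \<in> V" "\<And>x y. x \<in> V \<Longrightarrow> y \<in> V \<Longrightarrow> x + y \<in> V" "\<And>x z. x \<in> V \<Longrightarrow> msmult z x \<in> V"
  shows "msmult c X \<in> O_points_shift (m + l) V"
proof -
  have l: "low l X" using X by (auto simp: O_points_shift_iff)
  have sum: "(\<Sum>a\<in>I. f a) \<in> V" if "\<And>a. f a \<in> V" for f and I :: "int set"
    by (induction I rule: infinite_finite_induct) (auto simp: V that)
  have "coeff_mat (msmult c X) k \<in> V" for k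
    unfolding coeff_mat_msmult[OF c l] using X by (intro sum V) (auto simp: O_points_shift_iff)
  moreover have "low (m + l) (msmult c X)"
    unfolding low_def by (auto simp: coeff_mat_msmult[OF c l])
  ultimately show ?thesis by (simp add: O_points_shift_iff)
qed

lemma bracket_sum_right: "bracket X (\<Sum>i\<in>I. f i) = (\<Sum>i\<in>I. bracket X (f i))" for X :: "'a::comm_ring_1^'n^'n"
  by (induction I rule: infinite_finite_induct) (simp_all add: bracket_add_right)

lemma bracket_sum_left: "bracket (\<Sum>i\<in>I. f i) X = (\<Sum>i\<in>I. bracket (f i) X)" for X :: "'a::comm_ring_1^'n^'n"
  by (induction I rule: infinite_finite_induct) (simp_all add: bracket_add_left)

section \<open>The lattice and its stabilizer\<close>

context ss_torus
begin

lemma root_add: "\<gamma> \<in> roots G A \<Longrightarrow> H \<in> lie A \<Longrightarrow> K \<in> lie A \<Longrightarrow> \<gamma> (H + K) = \<gamma> H + \<gamma> K"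
  using dual_vec_trace[of \<gamma> "H + K"] dual_vec_trace[of \<gamma> H] dual_vec_trace[of \<gamma> K]
  by (simp add: lie_add matrix_ring_simps trace_add)

lemma root_zero: "\<gamma> \<in> roots G A \<Longrightarrow> \<gamma> 0 = 0"
  using lieA_linear[of \<gamma> 0 0] by simp

text \<open>Since \<alpha>(0) = 0, the coefficient sequence vanishes below some index, and
  \<open>Abs_fls\<close> returns the intended series.\<close>

lemma extend_nth:
  assumes "\<alpha> \<in> roots G A" shows "fls_nth (extend \<alpha> u) k = \<alpha> (coeff_mat u k)"
proof -
  obtain m where "low m u" using low_exists by blast
  then have "\<forall>n<m. \<alpha> (coeff_mat u n) = 0" using root_zero[OF assms] by (auto simp: low_def)
  then show ?thesis unfolding extend_def by (simp add: nth_Abs_fls_lower_bound)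
qed

lemma aF_ge_iff:
  "u \<in> aF_ge G A r \<longleftrightarrow> (\<forall>k. coeff_mat u k \<in> lie A) \<and> (\<forall>\<alpha>\<in>roots G A. \<forall>k<r \<alpha>. \<alpha> (coeff_mat u k) = 0)"
proof -
  have "(f = 0 \<or> fls_subdegree f \<ge> n) \<longleftrightarrow> (\<forall>k<n. fls_nth f k = 0)" for f :: "complex fls" and n
    using fls_subdegree_geI[of f n] by (auto simp: order_less_le_trans)
  then show ?thesis by (simp add: aF_ge_def F_points_def extend_nth)
qed

lemma aF_eq_ge: "u \<in> aF_eq G A r \<Longrightarrow> u \<in> aF_ge G A r"
  by (simp add: aF_eq_def aF_ge_def)

lemma aF_ge_zero: "0 \<in> aF_ge G A r"
  by (simp add: aF_ge_iff root_zero)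

lemma aF_ge_add: "u \<in> aF_ge G A r \<Longrightarrow> v \<in> aF_ge G A r \<Longrightarrow> u + v \<in> aF_ge G A r"
  by (auto simp: aF_ge_iff coeff_mat_add lie_add root_add)

lemma bracket_extend:
  assumes \<alpha>: "\<alpha> \<in> roots G A" and u: "\<And>k. coeff_mat u k \<in> lie A" and x: "\<And>k. coeff_mat x k \<in> root_space G A \<alpha>"
  shows "bracket u x = msmult (extend \<alpha> u) x"
proof (rule coeff_mat_eqI)
  fix k
  obtain m l where ml: "low m u" "low l x" using low_exists by blast
  have "\<forall>j<m. fls_nth (extend \<alpha> u) j = 0"
    using ml(1) by (simp add: extend_nth[OF \<alpha>] low_def root_zero[OF \<alpha>])
  from coeff_mat_msmult[OF this ml(2), of k] coeff_mat_bracket[OF ml, of k]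
  show "coeff_mat (bracket u x) k = coeff_mat (msmult (extend \<alpha> u) x) k"
    using u x by (simp add: extend_nth[OF \<alpha>] root_space_def)
qed

lemma Lambda_add:
  assumes "X \<in> Lambda G A r l" "Y \<in> Lambda G A r l" shows "X + Y \<in> Lambda G A r l"
proof -
  obtain u x where X: "X = u + (\<Sum>\<alpha>\<in>roots G A. x \<alpha>)" "u \<in> aF_ge G A r"
    "\<And>\<alpha>. \<alpha> \<in> roots G A \<Longrightarrow> x \<alpha> \<in> O_points_shift (l \<alpha>) (root_space G A \<alpha>)"
    using assms(1) by (auto simp: Lambda_def)
  obtain v y where Y: "Y = v + (\<Sum>\<alpha>\<in>roots G A. y \<alpha>)" "v \<in> aF_ge G A r"
    "\<And>\<alpha>. \<alpha> \<in> roots G A \<Longrightarrow> y \<alpha> \<in> O_points_shift (l \<alpha>) (root_space G A \<alpha>)"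
    using assms(2) by (auto simp: Lambda_def)
  have "X + Y = (u + v) + (\<Sum>\<alpha>\<in>roots G A. x \<alpha> + y \<alpha>)" by (simp add: X Y sum.distrib algebra_simps)
  moreover have "x \<alpha> + y \<alpha> \<in> O_points_shift (l \<alpha>) (root_space G A \<alpha>)" if "\<alpha> \<in> roots G A" for \<alpha>
    using X(3)[OF that] Y(3)[OF that] by (simp add: O_points_shift_iff coeff_mat_add rs_add low_def)
  ultimately show ?thesis
    unfolding Lambda_def using aF_ge_add[OF X(2) Y(2)]
    by (intro CollectI exI[of _ "u + v"] exI[of _ "\<lambda>\<alpha>. x \<alpha> + y \<alpha>"]) simp
qed

lemma O_points_shift_zero: "0 \<in> O_points_shift m (root_space G A \<alpha>)"
  by (simp add: O_points_shift_iff rs_zero low_def)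

lemma Lambda_aF: "u \<in> aF_ge G A r \<Longrightarrow> u \<in> Lambda G A r l"
  unfolding Lambda_def
  by (intro CollectI exI[of _ u] exI[of _ "\<lambda>_. 0"]) (simp add: O_points_shift_zero)

lemma Lambda_root:
  assumes "\<alpha> \<in> roots G A" "X \<in> O_points_shift (l \<alpha>) (root_space G A \<alpha>)" shows "X \<in> Lambda G A r l"
  unfolding Lambda_def
proof (intro CollectI exI conjI)
  show "X = 0 + (\<Sum>\<beta>\<in>roots G A. if \<beta> = \<alpha> then X else 0)" using assms(1) finite_roots by simp
qed (use assms in \<open>auto simp: O_points_shift_zero aF_ge_zero\<close>)

lemma Lambda_sum: "(\<And>i. i \<in> I \<Longrightarrow> f i \<in> Lambda G A r l) \<Longrightarrow> (\<Sum>i\<in>I. f i) \<in> Lambda G A r l"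
  by (induction I rule: infinite_finite_induct) (auto intro: Lambda_add Lambda_aF aF_ge_zero)

lemma stab_lie_sum:
  assumes "\<And>i. i \<in> I \<Longrightarrow> f i \<in> stab_lie G (Lambda G A r l)" shows "(\<Sum>i\<in>I. f i) \<in> stab_lie G (Lambda G A r l)"
proof -
  have "coeff_mat (\<Sum>i\<in>I. f i) k = (\<Sum>i\<in>I. coeff_mat (f i) k)" for k
    by (induction I rule: infinite_finite_induct) (simp_all add: coeff_mat_add)
  then show ?thesis
    using assms by (auto simp: stab_lie_def F_points_def bracket_sum_left intro!: lie_sum Lambda_sum)
qed

lemma rv_roots: "root_valuation (roots G A) r \<Longrightarrow> rv_roots (roots G A) r"
  using finite_roots roots_neg zero_not_root strongly_orthogonal_add by unfold_locales auto

text \<open>Bracketing with the torus part raises the order by \<open>r \<alpha>\<close>. For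
  \<alpha> + \<beta> a root, condition (2) places the bracket in the lattice; for \<beta> =
  -\<alpha> the bracket falls into the torus part, and condition (1) decides.\<close>

lemma root_space_in_stab_lie:
  assumes rv: "root_valuation (roots G A) r" and \<alpha>: "\<alpha> \<in> roots G A"
    and y: "y \<in> O_points_shift (k1 (roots G A) r \<alpha>) (root_space G A \<alpha>)"
  shows "y \<in> stab_lie G (Lambda G A r (\<lambda>\<alpha>. r \<alpha> + k1 (roots G A) r \<alpha>))"
proof -
  interpret rv_roots "roots G A" r using rv by (rule rv_roots)
  define k where "k = k1 (roots G A) r"
  define l where "l = (\<lambda>\<alpha>. r \<alpha> + k \<alpha>)"
  let ?L = "Lambda G A r l"
  have y': "y \<in> O_points_shift (k \<alpha>) (root_space G A \<alpha>)" using y by (simp add: k_def)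
  then have yc: "\<And>j. coeff_mat y j \<in> root_space G A \<alpha>" by (simp add: O_points_shift_iff)
  have torus: "bracket y u \<in> ?L" if u: "u \<in> aF_ge G A r" for u
  proof -
    have uc: "\<And>j. coeff_mat u j \<in> lie A" using u by (simp add: aF_ge_iff)
    have "\<forall>j<r \<alpha>. fls_nth (extend \<alpha> u) j = 0"
      using u \<alpha> by (simp add: extend_nth[OF \<alpha>] aF_ge_iff)
    then have "msmult (extend \<alpha> u) y \<in> O_points_shift (r \<alpha> + k \<alpha>) (root_space G A \<alpha>)"
      using y' by (intro O_points_shift_msmult rs_zero rs_add rs_msmult)
    then have "- msmult (extend \<alpha> u) y \<in> O_points_shift (l \<alpha>) (root_space G A \<alpha>)"
      using rs_msmult[of _ \<alpha> "- 1"] by (simp add: O_points_shift_iff l_def low_def coeff_mat_uminus msmult_minus)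
    moreover have "bracket y u = - msmult (extend \<alpha> u) y"
      using bracket_anti[of y u] bracket_extend[OF \<alpha> uc yc] by simp
    ultimately show ?thesis using Lambda_root[OF \<alpha>] by simp
  qed
  have roots: "bracket y x \<in> ?L" if \<beta>: "\<beta> \<in> roots G A" and x: "x \<in> O_points_shift (l \<beta>) (root_space G A \<beta>)" for x \<beta>
  proof -
    have br: "bracket y x \<in> O_points_shift (k \<alpha> + l \<beta>) (root_space G A (\<alpha> + \<beta>))"
      by (intro O_points_shift_bracket[OF y' x] rs_bracket rs_zero rs_add)
    consider "\<alpha> + \<beta> \<in> roots G A" | "\<alpha> + \<beta> = 0" | "\<alpha> + \<beta> \<notin> roots G A \<union> {0}" by blast
    then show ?thesis
    proof cases
      case 1
      have "l (\<alpha> + \<beta>) \<le> k \<alpha> + l \<beta>" using k1_add[OF \<alpha> \<beta> 1] by (simp add: l_def k_def)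
      then show ?thesis using Lambda_root[OF 1] O_points_shift_mono[OF br] by blast
    next
      case 3
      have "bracket y x \<in> O_points_shift (k \<alpha> + l \<beta>) {0}"
        by (intro O_points_shift_bracket[OF y' x]) (auto dest: rs_bracket_zero[OF \<alpha> \<beta> 3])
      then have "bracket y x = 0" by (intro coeff_mat_eqI) (simp add: O_points_shift_iff)
      then show ?thesis using Lambda_aF[OF aF_ge_zero] by simp
    next
      case 2
      then have \<beta>_eq: "\<beta> = - \<alpha>" by (simp add: eq_neg_iff_add_eq_0 add.commute)
      have lA: "coeff_mat (bracket y x) j \<in> lie A" for j
        using br 2 rs_0 by (simp add: O_points_shift_iff)
      \<comment> \<open>A root strongly orthogonal to \<alpha> kills all coefficients of the
        bracket. For any other \<gamma> the coefficient itself is 0, since j <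
        \<open>r \<gamma>\<close> \<le> \<open>r_max (roots G A) r \<alpha>\<close> \<le>
        \<open>k \<alpha> + l \<beta>\<close>.\<close>
      have "\<gamma> (coeff_mat (bracket y x) j) = 0" if \<gamma>: "\<gamma> \<in> roots G A" and j: "j < r \<gamma>" for \<gamma> j
      proof (cases "strongly_orthogonal (roots G A) \<alpha> \<gamma>")
        case True
        have "bracket y x \<in> O_points_shift (k \<alpha> + l \<beta>) {H \<in> lie A. \<gamma> H = 0}"
        proof (rule O_points_shift_bracket[OF y' x])
          fix a b assume "a \<in> root_space G A \<alpha>" "b \<in> root_space G A \<beta>"
          then show "bracket a b \<in> {H \<in> lie A. \<gamma> H = 0}"
            using strongly_orthogonal_dual_vec(1)[OF \<alpha> \<gamma> True] rs_bracket[of a \<alpha> b \<beta>] rs_0 2 \<beta>_eq by simp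
        qed (auto simp: root_zero[OF \<gamma>] lie_add root_add[OF \<gamma>])
        then show ?thesis by (simp add: O_points_shift_iff)
      next
        case False
        have "r \<gamma> \<le> r_max (roots G A) r \<alpha>" using r_max_ge[OF \<gamma> False] .
        also have "\<dots> \<le> k \<alpha> + l \<beta>"
          using k1_neg_sum[OF \<alpha>] r_neg[OF \<alpha>] by (simp add: l_def k_def \<beta>_eq)
        finally have "coeff_mat (bracket y x) j = 0" using j br by (simp add: O_points_shift_iff low_def)
        then show ?thesis using root_zero[OF \<gamma>] by simp
      qed
      then show ?thesis using lA by (intro Lambda_aF) (simp add: aF_ge_iff)
    qed
  qed
  have "bracket y Y \<in> ?L" if "Y \<in> ?L" for Y
  proof -
    obtain u x where Y: "Y = u + (\<Sum>\<beta>\<in>roots G A. x \<beta>)" "u \<in> aF_ge G A r"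
      "\<And>\<beta>. \<beta> \<in> roots G A \<Longrightarrow> x \<beta> \<in> O_points_shift (l \<beta>) (root_space G A \<beta>)"
      using \<open>Y \<in> ?L\<close> by (auto simp: Lambda_def)
    show ?thesis unfolding Y(1) bracket_add_right bracket_sum_right
      by (rule Lambda_add[OF torus[OF Y(2)] Lambda_sum[OF roots[OF _ Y(3)]]])
  qed
  then show ?thesis using yc rs_lie by (auto simp: stab_lie_def F_points_def l_def k_def)
qed

theorem root_valuation_lattice_k1:
  assumes rv: "root_valuation (roots G A) r"
  shows "root_valuation_lattice G A r (\<lambda>\<alpha>. r \<alpha> + k1 (roots G A) r \<alpha>)"
  unfolding root_valuation_lattice_def
proof (intro ballI equalityI subsetI)
  define l where "l = (\<lambda>\<alpha>. r \<alpha> + k1 (roots G A) r \<alpha>)"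
  fix u Y assume u: "u \<in> aF_eq G A r"
  note ug = aF_eq_ge[OF u]
  { assume "Y \<in> {v + bracket X u |v X. v \<in> aF_ge G A r \<and> X \<in> stab_lie G (Lambda G A r l)}"
    then obtain v X where Y: "Y = v + bracket X u" "v \<in> aF_ge G A r" "X \<in> stab_lie G (Lambda G A r l)" by blast
    have "bracket X u \<in> Lambda G A r l" using Y(3) Lambda_aF[OF ug] by (simp add: stab_lie_def)
    then have "Y \<in> Lambda G A r l" unfolding Y(1) by (rule Lambda_add[OF Lambda_aF[OF Y(2)]])
  }
  then show "Y \<in> {v + bracket X u |v X. v \<in> aF_ge G A r \<and>
      X \<in> stab_lie G (Lambda G A r (\<lambda>\<alpha>. r \<alpha> + k1 (roots G A) r \<alpha>))} \<Longrightarrow>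
    Y \<in> Lambda G A r (\<lambda>\<alpha>. r \<alpha> + k1 (roots G A) r \<alpha>)" by (simp only: l_def)
  assume "Y \<in> Lambda G A r (\<lambda>\<alpha>. r \<alpha> + k1 (roots G A) r \<alpha>)"
  then obtain v x where Y: "Y = v + (\<Sum>\<alpha>\<in>roots G A. x \<alpha>)" "v \<in> aF_ge G A r"
    "\<And>\<alpha>. \<alpha> \<in> roots G A \<Longrightarrow> x \<alpha> \<in> O_points_shift (l \<alpha>) (root_space G A \<alpha>)"
    by (auto simp: Lambda_def l_def)
  \<comment> \<open>Solves [X, u] = x on each root space, where this bracket multiplies by minus
    \<alpha>(u). As \<alpha>(u) has valuation exactly \<open>r \<alpha>\<close>, the division lowers
    the bound \<open>l \<alpha>\<close> to \<open>k1 (roots G A) r \<alpha>\<close>.\<close>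
  define X where "X = (\<lambda>\<alpha>. msmult (- inverse (extend \<alpha> u)) (x \<alpha>))"
  have "X \<alpha> \<in> stab_lie G (Lambda G A r l) \<and> bracket (X \<alpha>) u = x \<alpha>" if \<alpha>: "\<alpha> \<in> roots G A" for \<alpha>
  proof
    have e: "extend \<alpha> u \<noteq> 0" "fls_subdegree (extend \<alpha> u) = r \<alpha>" using u \<alpha> by (auto simp: aF_eq_def)
    have "\<forall>k<(- r \<alpha>). fls_nth (- inverse (extend \<alpha> u)) k = 0"
      using e fls_inverse_subdegree[of "extend \<alpha> u"] by simp
    then have "X \<alpha> \<in> O_points_shift (- r \<alpha> + l \<alpha>) (root_space G A \<alpha>)"
      unfolding X_def by (intro O_points_shift_msmult Y(3) \<alpha> rs_zero rs_add rs_msmult)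
    then show "X \<alpha> \<in> stab_lie G (Lambda G A r l)"
      unfolding l_def by (intro root_space_in_stab_lie[OF rv \<alpha>]) simp
    have "bracket u (x \<alpha>) = msmult (extend \<alpha> u) (x \<alpha>)"
      using ug Y(3)[OF \<alpha>] by (intro bracket_extend[OF \<alpha>]) (auto simp: aF_ge_iff O_points_shift_iff)
    then have "bracket (x \<alpha>) u = msmult (- extend \<alpha> u) (x \<alpha>)"
      using bracket_anti[of "x \<alpha>" u] by (simp add: msmult_minus)
    then show "bracket (X \<alpha>) u = x \<alpha>"
      using e(1) by (simp add: X_def bracket_msmult_left msmult_msmult)
  qed
  then have "Y = v + bracket (\<Sum>\<alpha>\<in>roots G A. X \<alpha>) u" "(\<Sum>\<alpha>\<in>roots G A. X \<alpha>) \<in> stab_lie G (Lambda G A r l)"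
    unfolding Y(1) bracket_sum_left by (auto intro: stab_lie_sum)
  then show "Y \<in> {v + bracket X u |v X. v \<in> aF_ge G A r \<and>
      X \<in> stab_lie G (Lambda G A r (\<lambda>\<alpha>. r \<alpha> + k1 (roots G A) r \<alpha>))}"
    using Y(2) unfolding l_def by blast
qed

end

lemma maximal_torus_diagonalizable:
  fixes G A :: "(complex^'n^'n) set"
  assumes "semisimple_group G" "maximal_torus G A"
  obtains P where "ss_torus A P G"
proof -
  have "torus A" using assms(2) by (simp add: maximal_torus_def)
  note A = this[unfolded torus_def]
  from conjunct2[OF A] obtain P :: "complex^'n^'n" where
    "invertible P \<and> (\<forall>t\<in>A. \<forall>i j. i \<noteq> j \<longrightarrow> (matrix_inv P ** t ** P) $ i $ j = 0)" ..
  then have "diag_torus A P" using conjunct1[OF A] by (simp add: diag_torus_def cj_def)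
  then have "ss_torus A P G" using assms by (intro ss_torus.intro ss_torus_axioms.intro)
  then show ?thesis by (rule that)
qed

theorem lemma13p9:
  fixes G A :: "(complex^'n^'n) set"
    and R :: "(complex^'n^'n \<Rightarrow> complex) set"
    and r :: "(complex^'n^'n \<Rightarrow> complex) \<Rightarrow> int"
  assumes "semisimple_group G"
    and "maximal_torus G A"
    and "R = roots G A"
    and "root_valuation R r"
  shows "(\<forall>k \<in> {k0 R r, \<lambda>\<alpha>. real_of_int (k1 R r \<alpha>)}.
            (\<forall>\<alpha>\<in>R. k \<alpha> + k (-\<alpha>) \<ge> real_of_int (r_max R r \<alpha> - r \<alpha>)) \<and>
            (\<forall>\<alpha>\<in>R. \<forall>\<beta>\<in>R. \<alpha> + \<beta> \<in> R \<longrightarrow>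
               k \<alpha> + k \<beta> - k (\<alpha> + \<beta>) \<ge> real_of_int (r (\<alpha> + \<beta>) - min (r \<alpha>) (r \<beta>))))
         \<and> root_valuation_lattice G A r (\<lambda>\<alpha>. r \<alpha> + k1 R r \<alpha>)"
proof -
  obtain P where "ss_torus A P G" using maximal_torus_diagonalizable[OF assms(1,2)] .
  then interpret ss_torus A P G .
  have rvG: "root_valuation (roots G A) r" using assms(3,4) by simp
  interpret rv_roots R r using rv_roots[OF rvG] assms(3) by simp
  have k1: "real_of_int (r_max R r \<alpha> - r \<alpha>) \<le> real_of_int (k1 R r \<alpha>) + real_of_int (k1 R r (- \<alpha>))"
    if "\<alpha> \<in> R" for \<alpha>
    using k1_neg_sum[OF that] by linarith
  have k1': "real_of_int (r (\<alpha> + \<beta>) - min (r \<alpha>) (r \<beta>)) \<le>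
      real_of_int (k1 R r \<alpha>) + real_of_int (k1 R r \<beta>) - real_of_int (k1 R r (\<alpha> + \<beta>))"
    if "\<alpha> \<in> R" "\<beta> \<in> R" "\<alpha> + \<beta> \<in> R" for \<alpha> \<beta>
    using k1_add[OF that] by linarith
  show ?thesis
    using k0_neg_sum k0_add k1 k1' root_valuation_lattice_k1[OF rvG] by (auto simp: assms(3))
qed

end
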